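(* Let $d\ge 2$ be a fixed integer, let $\mathcal J\subset((d-1)^{-1},\infty)$ be a compact interval, and let $0\le p=p(n)\le 1$ be a sequence such that $c=c(n)=\binom{n-1}{d-1}p\in\mathcal J$ for all $n$. Let $0<\rho=\rho(n)<1$ be the unique solution to $\rho=\exp(c(\rho^{d-1}-1))$, and set $$\sigma^2=\sigma(n)^2=\frac{\rho\left[1-\rho+c(d-1)(\rho-\rho^{d-1})\right]n}{(1-c(d-1)\rho^{d-1})^2}.$$ Then $\sigma^{-1}\big(\mathcal N(H_d(n,p))-(1-\rho)n\big)$ converges in distribution to the standard normal distribution as $n\to\infty$.
   Context: A $d$-uniform hypergraph $H=(V,E)$ has edges that are $d$-element subsets of $V$. A vertex $w$ is reachable from $v$ if $v=w$ or there are edges $e_1,\dots,e_k$ with $v\in e_1$, $w\in e_k$ and $e_i\cap e_{i+1}\neq\emptyset$; the equivalence classes of reachability are the components, and the order of a component is its number of vertices. $\mathcal N(H)$ denotes the maximum order of a component of $H$. $H_d(n,p)$ is the random $d$-uniform hypergraph on $V=\{1,\dots,n\}$ in which each of the $\binom nd$ possible edges is present independently with probability $p$. *)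

theory Defs
  imports "HOL-Probability.Probability" "HOL-Library.Ramsey"
begin

type_synonym 'a hypergraph = "'a set \<times> 'a set set"

abbreviation verts :: "'a hypergraph \<Rightarrow> 'a set" where "verts \<equiv> fst"
abbreviation edges :: "'a hypergraph \<Rightarrow> 'a set set" where "edges \<equiv> snd"

definition uniform_hypergraph :: "nat \<Rightarrow> 'a hypergraph \<Rightarrow> bool" where
  "uniform_hypergraph d H \<longleftrightarrow> edges H \<subseteq> nsets (verts H) d"

definition reachable :: "'a hypergraph \<Rightarrow> 'a rel" where
  "reachable H = {(v, w). v \<in> verts H \<and> w \<in> verts H \<and>
     (v = w \<or> (\<exists>es. es \<noteq> [] \<and> set es \<subseteq> edges H \<and> v \<in> hd es \<and> w \<in> last es \<and>
                    successively (\<lambda>e f. e \<inter> f \<noteq> {}) es))}"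

definition components :: "'a hypergraph \<Rightarrow> 'a set set" where
  "components H = verts H // reachable H"

(* Meaningful for finite nonempty vertex sets only. *)
definition max_component_order :: "'a hypergraph \<Rightarrow> nat" where
  "max_component_order H = Max (card ` components H)"

lemma equiv_reachable: "equiv (verts H) (reachable H)"
proof (rule equivI)
  show "reachable H \<subseteq> verts H \<times> verts H" and "refl_on (verts H) (reachable H)"
    by (auto simp: reachable_def refl_on_def)
  show "sym (reachable H)"
  proof (rule symI)
    fix v w assume vw: "(v, w) \<in> reachable H"
    show "(w, v) \<in> reachable H"
    proof (cases "v = w")
      case False
      with vw obtain es where "es \<noteq> []" "set es \<subseteq> edges H" "v \<in> hd es" "w \<in> last es"
        "successively (\<lambda>e f. e \<inter> f \<noteq> {}) es"
        by (auto simp: reachable_def)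
      hence "rev es \<noteq> [] \<and> set (rev es) \<subseteq> edges H \<and> w \<in> hd (rev es) \<and> v \<in> last (rev es) \<and>
        successively (\<lambda>e f. e \<inter> f \<noteq> {}) (rev es)"
        by (simp add: hd_rev last_rev Int_commute)
      with vw show ?thesis unfolding reachable_def by blast
    qed (use vw in auto)
  qed
  show "trans (reachable H)"
  proof (rule transI)
    fix u v w assume uv: "(u, v) \<in> reachable H" and vw: "(v, w) \<in> reachable H"
    show "(u, w) \<in> reachable H"
    proof (cases "u = v \<or> v = w")
      case False
      with uv obtain es where es: "es \<noteq> []" "set es \<subseteq> edges H" "u \<in> hd es" "v \<in> last es"
        "successively (\<lambda>e f. e \<inter> f \<noteq> {}) es"
        by (auto simp: reachable_def)
      from False vw obtain fs where fs: "fs \<noteq> []" "set fs \<subseteq> edges H" "v \<in> hd fs" "w \<in> last fs"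
        "successively (\<lambda>e f. e \<inter> f \<noteq> {}) fs"
        by (auto simp: reachable_def)
      from es fs have "es @ fs \<noteq> [] \<and> set (es @ fs) \<subseteq> edges H \<and> u \<in> hd (es @ fs) \<and>
        w \<in> last (es @ fs) \<and> successively (\<lambda>e f. e \<inter> f \<noteq> {}) (es @ fs)"
        by (auto simp: successively_append_iff)
      with uv vw show ?thesis unfolding reachable_def by blast
    qed (use uv vw in auto)
  qed
qed

definition random_hypergraph :: "nat \<Rightarrow> nat \<Rightarrow> real \<Rightarrow> nat hypergraph pmf" where
  "random_hypergraph d n p =
     map_pmf (\<lambda>X. ({1..n}, {e \<in> nsets {1..n} d. X e}))
       (Pi_pmf (nsets {1..n} d) False (\<lambda>_. bernoulli_pmf p))"

lemma uniform_random_hypergraph: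
  "H \<in> set_pmf (random_hypergraph d n p) \<Longrightarrow> verts H = {1..n} \<and> uniform_hypergraph d H"
  by (auto simp: random_hypergraph_def uniform_hypergraph_def)

(* Well defined for c > 1 / (d - 1), by the lemma that follows. *)
definition rho :: "nat \<Rightarrow> real \<Rightarrow> real" where
  "rho d c = (THE r. 0 < r \<and> r < 1 \<and> r = exp (c * (r ^ (d - 1) - 1)))"

lemma rho_ex1:
  fixes d :: nat and c :: real
  assumes d: "2 \<le> d" and c: "1 / (real d - 1) < c"
  shows "\<exists>!r. 0 < r \<and> r < 1 \<and> r = exp (c * (r ^ (d - 1) - 1))"
proof -
  define k where "k = d - 1"
  define g where "g r = ln r - c * (r ^ k - 1)" for r :: real
  define g' where "g' r = 1 / r - c * (real k * r ^ (k - 1))" for r :: real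
  have k: "k > 0" and kd: "real k = real d - 1"
    using d by (auto simp: k_def)
  have ck: "c * k > 1"
    using c k unfolding kd[symmetric] by (simp add: field_simps)
  have c0: "c > 0"
    using ck k by (smt (verit) mult_nonpos_nonneg of_nat_0_le_iff)
  have deriv: "(g has_real_derivative g' r) (at r)" if "r > 0" for r
    unfolding g_def g'_def using that by (auto intro!: derivative_eq_intros simp: field_simps)
  have isCont: "isCont g r" if "r > 0" for r
    using deriv[OF that] DERIV_isCont by blast
  have g'_eq: "g' r = (1 - c * k * r ^ k) / r" if "r > 0" for r
    using that k by (cases k) (auto simp: g'_def field_simps)
  have root_iff: "(r = exp (c * (r ^ (d - 1) - 1))) \<longleftrightarrow> g r = 0" if "r > 0" for r
    using that unfolding g_def k_def by (metis exp_ln ln_exp eq_iff_diff_eq_0)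
  have g1: "g 1 = 0" by (simp add: g_def)
  have rolle: "\<exists>z. a < z \<and> z < b \<and> c * k * z ^ k = 1"
    if "0 < a" "a < b" "g a = 0" "g b = 0" for a b
  proof -
    have "\<exists>z. a < z \<and> z < b \<and> g b - g a = (b - a) * g' z"
      using that by (intro MVT2 deriv) auto
    then obtain z where z: "a < z" "z < b" "g b - g a = (b - a) * g' z" by blast
    from z that have "g' z = 0" "z > 0" by auto
    hence "c * k * z ^ k = 1" using g'_eq[of z] by simp
    with z show ?thesis by blast
  qed
  have no_two: False if ab: "0 < a" "a < b" "b < 1" "g a = 0" "g b = 0" for a b
  proof -
    obtain y where y: "a < y" "y < b" "c * k * y ^ k = 1" using rolle[OF ab(1,2,4,5)] by blast
    obtain z where z: "b < z" "z < 1" "c * k * z ^ k = 1" using rolle[of b 1] ab g1 by (meson less_trans)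
    have "y ^ k < z ^ k" using y z ab k by (intro power_strict_mono) auto
    thus False using y z ck by (metis mult_less_cancel_left_pos less_irrefl less_trans zero_less_one)
  qed
  have unique: "a = b" if "0 < a" "a < 1" "g a = 0" "0 < b" "b < 1" "g b = 0" for a b
    using no_two[of a b] no_two[of b a] that by (cases a b rule: linorder_cases) auto
  define m where "m = root k (1 / (c * k))"
  have m: "0 < m" "m < 1" "c * k * m ^ k = 1"
    using k ck by (auto simp: m_def)
  have gm: "g m > 0"
  proof -
    have "\<exists>z. m < z \<and> z < 1 \<and> g 1 - g m = (1 - m) * g' z"
      using m by (intro MVT2 deriv) auto
    then obtain z where z: "m < z" "z < 1" "g 1 - g m = (1 - m) * g' z" by blast
    have "m ^ k < z ^ k" using z m k by (intro power_strict_mono) auto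
    hence "c * k * z ^ k > 1" using m(3) ck by (metis mult_less_cancel_left_pos less_trans zero_less_one)
    hence "g' z < 0" using g'_eq[of z] z m by (auto intro!: divide_neg_pos)
    hence "(1 - m) * g' z < 0" using m by (simp add: mult_pos_neg)
    thus ?thesis using z g1 by simp
  qed
  have ge: "g (exp (- c)) < 0"
    using c0 by (simp add: g_def algebra_simps)
  have "\<exists>r. 0 < r \<and> r < 1 \<and> g r = 0"
  proof (cases "exp (- c) \<le> m")
    case True
    have "\<exists>r. exp (- c) \<le> r \<and> r \<le> m \<and> g r = 0"
      using True ge gm
      by (intro IVT') (auto intro!: continuous_at_imp_continuous_on isCont intro: less_le_trans[OF exp_gt_zero])
    thus ?thesis using m by (meson exp_gt_zero le_less_trans less_le_trans)
  next
    case False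
    have "\<exists>r. m \<le> r \<and> r \<le> exp (- c) \<and> g r = 0"
      using False ge gm m
      by (intro IVT2') (auto intro!: continuous_at_imp_continuous_on isCont)
    moreover have "exp (- c) < 1" using c0 by simp
    ultimately show ?thesis using m by (meson le_less_trans less_le_trans)
  qed
  then obtain r where r: "0 < r" "r < 1" "g r = 0" by blast
  show ?thesis
  proof (rule ex1I[of _ r])
    show "0 < r \<and> r < 1 \<and> r = exp (c * (r ^ (d - 1) - 1))"
      using r root_iff by blast
    fix s assume "0 < s \<and> s < 1 \<and> s = exp (c * (s ^ (d - 1) - 1))"
    with root_iff[of s] show "s = r" using unique r by blast
  qed
qed

definition giant_variance :: "nat \<Rightarrow> real \<Rightarrow> nat \<Rightarrow> real" where
  "giant_variance d c n =
     rho d c * (1 - rho d c + c * (real d - 1) * (rho d c - rho d c ^ (d - 1))) * real n /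
       (1 - c * (real d - 1) * rho d c ^ (d - 1))\<^sup>2"

end

theory Submission
  imports Defs "HOL-Real_Asymp.Real_Asymp"
begin

text \<open>
  Expose the hypergraph vertex by vertex, starting from a set of \<open>\<kappa>\<close> roots: if \<open>m\<close> vertices are left and \<open>u\<close>
  of them are undiscovered, each undiscovered vertex escapes the next step with a probability depending on
  \<open>m\<close> only, so \<open>a(m) u\<close> with \<open>a(m) = (1 - p)\<close> to the power \<open>(m - 1 choose d - 1)\<close> is a martingale. It stops
  when \<open>m = u = S\<close>, the number of vertices not reached from the roots. Hence \<open>S a(S)\<close> is asymptotically
  normal, and \<open>x = S / n\<close> almost solves \<open>x exp (- c x^(d-1)) = exp (- c)\<close>, whose roots are \<open>1\<close> and \<open>\<rho>\<close>.
  Linearising at \<open>\<rho>\<close> gives the central limit theorem for \<open>S\<close>; the conditional variances telescope, which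
  yields \<open>\<sigma>\<close>. An exponential supermartingale rules out \<open>x\<close> near \<open>1\<close> once \<open>\<kappa>\<close> tends to infinity.

  Two distinct large clusters would have to be of order \<open>(1 - \<rho>) n\<close> each, and so would their union, as the
  cluster of a larger seed set. So there is only one giant, and with \<open>\<kappa>\<close> of order \<open>n\<close> to the power \<open>1/4\<close> it
  differs from the seeded cluster by \<open>O(\<kappa>)\<close> vertices.
\<close>

subsection \<open>Expectations over finitely supported distributions\<close>

text \<open>The exploration stops at a random time, when \<open>S\<close> vertices are left, and
  this time is itself the quantity sought. The conditional variance accumulated until then is
  therefore random too. Only then is the random variance replaced by its value at
  \<open>\<rho>\<close>, at the price of the second moment of \<open>S - \<rho> * n\<close>. As
  \<open>c\<close> and \<open>\<rho>\<close> vary with \<open>n\<close>, every estimate is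
  non-asymptotic, with constants built from \<open>k\<close>, \<open>K\<close>,
  \<open>\<delta>\<close>, \<open>\<gamma>\<close> and the Fourier variable alone; limits are taken
  only at the very end. The number of seeds is a compromise: the exploration must not die early, yet
  the seeds shift all quantities by about their number, which has to stay below the fluctuations of
  order \<open>sqrt n\<close>.\<close>

abbreviation (input) "expect \<equiv> measure_pmf.expectation"

lemma expectation_bind_finite:
  fixes h :: "'b \<Rightarrow> 'c::{banach, second_countable_topology}"
  assumes "finite (set_pmf M)" "\<And>x. x \<in> set_pmf M \<Longrightarrow> finite (set_pmf (f x))"
  shows "expect (M \<bind> f) h =
    expect M (\<lambda>x. expect (f x) h)"
proof -
  have "expect (M \<bind> f) h =
      (\<Sum>a\<in>set_pmf M. pmf M a *\<^sub>R expect (f a) h)"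
    using assms by (intro pmf_expectation_bind) auto
  also have "\<dots> = expect M (\<lambda>x. expect (f x) h)"
    using assms by (intro integral_measure_pmf[symmetric]) auto
  finally show ?thesis .
qed

lemma expectation_mono_finite:
  fixes f g :: "'a \<Rightarrow> real"
  assumes "finite (set_pmf M)" "\<And>x. x \<in> set_pmf M \<Longrightarrow> f x \<le> g x"
  shows "expect M f \<le> expect M g"
  using assms
  by (intro integral_mono_AE) (auto simp: AE_measure_pmf_iff integrable_measure_pmf_finite)

lemma expectation_cong_pmf:
  fixes f g :: "'a \<Rightarrow> 'b::{banach, second_countable_topology}"
  assumes "\<And>x. x \<in> set_pmf M \<Longrightarrow> f x = g x"
  shows "expect M f = expect M g"
  using assms by (intro integral_cong_AE) (auto simp: AE_measure_pmf_iff)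

lemma expectation_diff_finite:
  fixes f g :: "'a \<Rightarrow> 'b::{banach, second_countable_topology}"
  assumes "finite (set_pmf M)"
  shows "expect M (\<lambda>x. f x - g x) =
    expect M f - expect M g"
  using assms by (intro Bochner_Integration.integral_diff integrable_measure_pmf_finite)

lemma expectation_add_finite:
  fixes f g :: "'a \<Rightarrow> 'b::{banach, second_countable_topology}"
  assumes "finite (set_pmf M)"
  shows "expect M (\<lambda>x. f x + g x) =
    expect M f + expect M g"
  using assms by (intro Bochner_Integration.integral_add integrable_measure_pmf_finite)

lemma expectation_sum_finite:
  fixes f :: "'i \<Rightarrow> 'a \<Rightarrow> 'b::{banach, second_countable_topology}"
  assumes "finite (set_pmf M)"
  shows "expect M (\<lambda>x. \<Sum>i\<in>I. f i x) =
    (\<Sum>i\<in>I. expect M (f i))"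
  using assms by (intro Bochner_Integration.integral_sum integrable_measure_pmf_finite)

lemma expectation_nonneg:
  fixes f :: "'a \<Rightarrow> real"
  assumes "\<And>x. x \<in> set_pmf M \<Longrightarrow> 0 \<le> f x"
  shows "0 \<le> expect M f"
  using assms by (intro integral_nonneg_AE) (auto simp: AE_measure_pmf_iff)

lemma norm_expectation_le:
  fixes f :: "'a \<Rightarrow> 'b::{banach, second_countable_topology}"
  shows "norm (expect M f) \<le> expect M (\<lambda>x. norm (f x))"
  by (rule integral_norm_bound)

lemma prob_eq_expectation:
  "measure_pmf.prob M A = expect M (\<lambda>x. of_bool (x \<in> A))"
proof -
  have "expect M (indicator A :: _ \<Rightarrow> real) =
      expect M (\<lambda>x. of_bool (x \<in> A))"
    by (rule arg_cong[of _ _ "expect M"]) (auto simp: indicator_def fun_eq_iff)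
  thus ?thesis by simp
qed

lemma prob_le_expectation:
  fixes f :: "'a \<Rightarrow> real"
  assumes "finite (set_pmf M)" "\<And>x. x \<in> set_pmf M \<Longrightarrow> 0 \<le> f x"
    "\<And>x. x \<in> set_pmf M \<Longrightarrow> x \<in> A \<Longrightarrow> 1 \<le> f x"
  shows "measure_pmf.prob M A \<le> expect M f"
  unfolding prob_eq_expectation using assms by (intro expectation_mono_finite) (auto simp: of_bool_def)

subsection \<open>Random subsets\<close>

definition random_subset :: "real \<Rightarrow> 'a set \<Rightarrow> 'a set pmf" where
  "random_subset p A = map_pmf (\<lambda>X. {e \<in> A. X e}) (Pi_pmf A False (\<lambda>_. bernoulli_pmf p))"

lemma set_random_subset: "E \<in> set_pmf (random_subset p A) \<Longrightarrow> E \<subseteq> A"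
  by (auto simp: random_subset_def)

lemma finite_set_random_subset [simp]: "finite A \<Longrightarrow> finite (set_pmf (random_subset p A))"
  by (rule finite_subset[of _ "Pow A"]) (auto dest: set_random_subset)

lemma random_subset_Un:
  assumes "finite A" "finite B" "A \<inter> B = {}"
  shows "random_subset p (A \<union> B) =
    random_subset p A \<bind> (\<lambda>E. map_pmf (\<lambda>F. E \<union> F) (random_subset p B))"
proof -
  have eq: "{e \<in> A \<union> B. if e \<in> A then f e else g e} = {e \<in> A. f e} \<union> {e \<in> B. g e}" for f g
    using assms(3) by auto
  show ?thesis
    unfolding random_subset_def Pi_pmf_union[OF assms]
    by (simp only: map_pmf_comp pair_pmf_def map_bind_pmf bind_map_pmf case_prod_conv eq
        map_return_pmf)
       (simp only: map_pmf_def bind_assoc_pmf bind_return_pmf)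
qed

lemma prob_random_subset_disjoint:
  assumes "finite A" "B \<subseteq> A" "0 \<le> p" "p \<le> 1"
  shows "measure_pmf.prob (random_subset p A) {E. E \<inter> B = {}} = (1 - p) ^ card B"
proof -
  have "measure_pmf.prob (random_subset p A) {E. E \<inter> B = {}} =
    measure_pmf.prob (Pi_pmf A False (\<lambda>_. bernoulli_pmf p))
      (Pi A (\<lambda>e. if e \<in> B then {False} else UNIV))"
    unfolding random_subset_def measure_map_pmf using assms(2)
    by (intro arg_cong[where f = "measure_pmf.prob _"]) (auto simp: vimage_def Pi_def split: if_splits)
  also have "\<dots> = (\<Prod>e\<in>A. if e \<in> B then 1 - p else 1)"
    unfolding measure_Pi_pmf_Pi[OF assms(1)]
    using assms by (intro prod.cong) (auto simp: measure_pmf_single)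
  also have "\<dots> = (1 - p) ^ card B"
    using assms by (simp add: prod.If_cases Int_absorb1 inf.absorb2)
  finally show ?thesis .
qed

text \<open>By independence the left side is a product of factors
  \<open>1 + p * (exp 1 - 1)\<close>, and \<open>exp 1 \<le> 3\<close> makes each at most
  \<open>exp (2 * p)\<close>. The moments of an exploration step are all drawn from this
  bound.\<close>

lemma expectation_exp_card_random_subset:
  assumes "finite A" "0 \<le> p" "p \<le> 1"
  shows "expect (random_subset p A) (\<lambda>E. exp (real (card E)))
    \<le> exp (2 * (p * real (card A)))"
proof -
  have "expect (random_subset p A) (\<lambda>E. exp (real (card E))) =
    expect (Pi_pmf A False (\<lambda>_. bernoulli_pmf p))
      (\<lambda>X. \<Prod>e\<in>A. if X e then exp 1 else 1 :: real)"
    unfolding random_subset_def integral_map_pmf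
  proof (intro expectation_cong_pmf)
    fix X :: "'a \<Rightarrow> bool"
    show "exp (real (card {e \<in> A. X e})) = (\<Prod>e\<in>A. if X e then exp 1 else 1 :: real)"
      using assms(1)
      by (simp add: prod.If_cases exp_of_nat_mult[symmetric] Collect_conj_eq[symmetric] Int_def)
  qed
  also have "\<dots> = (\<Prod>e\<in>A. expect (bernoulli_pmf p) (\<lambda>b. if b then exp 1 else 1 :: real))"
    using assms
    by (intro expectation_prod_Pi_pmf[where f = "\<lambda>_ b. if b then exp 1 else 1 :: real"])
       (auto intro!: integrable_measure_pmf_finite)
  also have "\<dots> = (1 + p * (exp 1 - 1)) ^ card A"
    using assms by (simp add: algebra_simps)
  also have "\<dots> \<le> (exp (2 * p)) ^ card A"
  proof (intro power_mono)
    have "exp (1::real) \<le> 3" by (rule exp_le)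
    hence "p * (exp 1 - 1) \<le> p * 2" using assms by (intro mult_left_mono) auto
    also have "p * 2 \<le> exp (2 * p) - 1" using exp_ge_add_one_self[of "2 * p"] by linarith
    finally show "1 + p * (exp 1 - 1) \<le> exp (2 * p)" by simp
  qed (use assms in simp)
  also have "\<dots> = exp (2 * (p * real (card A)))"
    by (simp add: exp_of_nat_mult[symmetric] mult_ac)
  finally show ?thesis .
qed

subsection \<open>Clusters\<close>

definition link :: "'a set set \<Rightarrow> 'a rel" where
  "link E = {(v, w). \<exists>e\<in>E. v \<in> e \<and> w \<in> e}"

definition cluster :: "'a set set \<Rightarrow> 'a set \<Rightarrow> 'a set" where
  "cluster E R = (link E)\<^sup>* `` R"

lemma subset_cluster: "R \<subseteq> cluster E R"
  by (auto simp: cluster_def)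

lemma cluster_self: "x \<in> cluster E {x}"
  by (simp add: cluster_def)

lemma cluster_link: "v \<in> cluster E R \<Longrightarrow> e \<in> E \<Longrightarrow> v \<in> e \<Longrightarrow> w \<in> e \<Longrightarrow> w \<in> cluster E R"
  unfolding cluster_def link_def by (auto intro: rtrancl_into_rtrancl)

lemma cluster_least:
  assumes "R \<subseteq> S" "\<And>e v w. e \<in> E \<Longrightarrow> v \<in> e \<Longrightarrow> w \<in> e \<Longrightarrow> v \<in> S \<Longrightarrow> w \<in> S"
  shows "cluster E R \<subseteq> S"
proof
  fix w assume "w \<in> cluster E R"
  then obtain v where "v \<in> R" "(v, w) \<in> (link E)\<^sup>*" by (auto simp: cluster_def)
  from this(2,1) show "w \<in> S"
    by (induction rule: rtrancl_induct) (use assms in \<open>auto simp: link_def\<close>)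
qed

lemma cluster_subset: "R \<subseteq> V \<Longrightarrow> \<Union>E \<subseteq> V \<Longrightarrow> cluster E R \<subseteq> V"
  by (rule cluster_least) auto

lemma cluster_empty [simp]: "cluster E {} = {}"
  by (simp add: cluster_def)

lemma cluster_Un: "cluster E (R \<union> R') = cluster E R \<union> cluster E R'"
  by (auto simp: cluster_def)

lemma cluster_UN: "cluster E R = (\<Union>v\<in>R. cluster E {v})"
  by (auto simp: cluster_def)

lemma sym_link: "sym (link E)"
  by (auto simp: link_def sym_def)

lemma cluster_sym: "w \<in> cluster E {v} \<Longrightarrow> v \<in> cluster E {w}"
  using sym_rtrancl[OF sym_link[of E]] by (auto simp: cluster_def sym_def)

lemma cluster_trans: "w \<in> cluster E {v} \<Longrightarrow> u \<in> cluster E {w} \<Longrightarrow> u \<in> cluster E {v}"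
  by (auto simp: cluster_def)

lemma cluster_eq:
  assumes "w \<in> cluster E {v}"
  shows "cluster E {w} = cluster E {v}"
proof (intro equalityI subsetI)
  fix u
  show "u \<in> cluster E {v}" if "u \<in> cluster E {w}"
    using assms that by (rule cluster_trans)
  show "u \<in> cluster E {w}" if "u \<in> cluster E {v}"
    using cluster_sym[OF assms] that by (rule cluster_trans)
qed

lemma cluster_disjoint:
  assumes "cluster E {w} \<noteq> cluster E {v}"
  shows "cluster E {w} \<inter> cluster E {v} = {}"
proof (rule ccontr)
  assume "cluster E {w} \<inter> cluster E {v} \<noteq> {}"
  then obtain u where "u \<in> cluster E {w}" "u \<in> cluster E {v}" by blast
  from cluster_eq[OF this(1)] cluster_eq[OF this(2)] show False using assms by simp
qed

text \<open>The recursion behind the exploration. Once the vertices sharing an edge with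
  \<open>v\<close> are roots themselves, \<open>v\<close> and its edges can be deleted: a path
  through \<open>v\<close> can be cut there and restarted at such a root.\<close>

lemma cluster_step:
  assumes "v \<in> R"
  shows "cluster E R = insert v (cluster {e \<in> E. v \<notin> e} ((R \<union> \<Union>{e \<in> E. v \<in> e}) - {v}))"
    (is "_ = insert v ?C")
proof
  have sub: "(R \<union> \<Union>{e \<in> E. v \<in> e}) - {v} \<subseteq> ?C"
    by (rule subset_cluster)
  show "cluster E R \<subseteq> insert v ?C"
  proof (rule cluster_least)
    show "R \<subseteq> insert v ?C"
      using sub by auto
    fix e x y assume *: "e \<in> E" "x \<in> e" "y \<in> e" "x \<in> insert v ?C"
    show "y \<in> insert v ?C"
    proof (cases "v \<in> e")
      case True
      hence "y = v \<or> y \<in> (R \<union> \<Union>{e \<in> E. v \<in> e}) - {v}" using * by auto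
      thus ?thesis using sub by (meson insertCI subsetD)
    next
      case False
      hence "x \<in> ?C" using * by auto
      from cluster_link[OF this _ *(2,3)] have "y \<in> ?C" using * False by simp
      thus ?thesis by simp
    qed
  qed
  have v: "v \<in> cluster E R" using assms subset_cluster[of R E] by (rule rev_subsetD)
  have "?C \<subseteq> cluster E R"
  proof (rule cluster_least)
    have "\<Union>{e \<in> E. v \<in> e} \<subseteq> cluster E R"
      using cluster_link[OF v] by blast
    thus "(R \<union> \<Union>{e \<in> E. v \<in> e}) - {v} \<subseteq> cluster E R"
      using subset_cluster[of R E] by blast
    show "w \<in> cluster E R"
      if "e \<in> {e \<in> E. v \<notin> e}" "x \<in> e" "w \<in> e" "x \<in> cluster E R" for e x w
      using cluster_link[OF that(4) _ that(2,3)] that(1) by simp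
  qed
  with v show "insert v ?C \<subseteq> cluster E R" by simp
qed

subsection \<open>Exploring a random hypergraph vertex by vertex\<close>

declare finite_imp_finite_nsets [simp]

definition star :: "nat \<Rightarrow> 'a set \<Rightarrow> 'a \<Rightarrow> 'a set set" where
  "star d V v = {e \<in> nsets V d. v \<in> e}"

lemma finite_star [simp]: "finite V \<Longrightarrow> finite (star d V v)"
  by (simp add: star_def)

text \<open>In an exploration state \<open>(V, U)\<close>, \<open>V\<close> holds the vertices not yet exposed and \<open>U \<subseteq> V\<close> the undiscovered
  ones; \<open>V - U\<close> is the queue.\<close>

definition leftover :: "nat \<Rightarrow> real \<Rightarrow> 'a set \<Rightarrow> 'a set \<Rightarrow> nat pmf" where
  "leftover d p V U = map_pmf (\<lambda>E. card (V - cluster E (V - U))) (random_subset p (nsets V d))"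

lemma finite_set_leftover [simp]: "finite V \<Longrightarrow> finite (set_pmf (leftover d p V U))"
  by (simp add: leftover_def)

lemma leftover_all: "leftover d p V V = return_pmf (card V)"
  by (simp add: leftover_def)

text \<open>Edges through \<open>v\<close> and edges inside \<open>V - {v}\<close> are independent,
  so deleting \<open>v\<close> leaves a fresh random hypergraph on the rest. As \<open>v\<close> is
  an arbitrary element of the queue, no order of exploration has to be fixed.\<close>

lemma leftover_step:
  assumes "finite V" "U \<subseteq> V" "v \<in> V" "v \<notin> U"
  shows "leftover d p V U =
    random_subset p (star d V v) \<bind> (\<lambda>E. leftover d p (V - {v}) (U - \<Union>E))"
proof -
  let ?A = "star d V v" and ?B = "nsets (V - {v}) d"
  have split: "nsets V d = ?A \<union> ?B" and disj: "?A \<inter> ?B = {}"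
    using assms by (auto simp: star_def nsets_def)
  have fin: "finite ?A" "finite ?B"
    using assms by (auto intro: finite_imp_finite_nsets)
  have eq: "card (V - cluster (E \<union> F) (V - U)) =
      card ((V - {v}) - cluster F ((V - {v}) - (U - \<Union>E)))"
    if "E \<in> set_pmf (random_subset p ?A)" "F \<in> set_pmf (random_subset p ?B)" for E F
  proof -
    have E: "E \<subseteq> ?A" and F: "F \<subseteq> ?B" using that by (auto dest: set_random_subset)
    have EF: "{e \<in> E \<union> F. v \<in> e} = E" "{e \<in> E \<union> F. v \<notin> e} = F"
      using E F by (auto simp: star_def nsets_def)
    have R: "(V - U \<union> \<Union>E) - {v} = (V - {v}) - (U - \<Union>E)"
      using E assms by (fastforce simp: star_def nsets_def)
    have "cluster (E \<union> F) (V - U) = insert v (cluster F ((V - {v}) - (U - \<Union>E)))"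
      using cluster_step[of v "V - U" "E \<union> F"] assms unfolding EF R by simp
    thus ?thesis by (intro arg_cong[of _ _ card]) auto
  qed
  show ?thesis
    unfolding leftover_def split random_subset_Un[OF fin disj] map_bind_pmf map_pmf_comp
    by (intro bind_pmf_cong map_pmf_cong refl) (use eq in auto)
qed

definition undisc :: "'a set \<Rightarrow> 'a set set \<Rightarrow> nat" where
  "undisc U E = card (U - \<Union>E)"

text \<open>Optional stopping by induction on \<open>card V\<close>, one exploration step per
  unfolding. The process stops when the queue is empty, that is in a state with
  \<open>V = U\<close>, which is why \<open>\<Psi>\<close> is evaluated on the diagonal.\<close>

lemma leftover_supermartingale:
  fixes \<Psi> :: "nat \<Rightarrow> nat \<Rightarrow> real"
  assumes step: "\<And>(V :: 'a set) U v. finite V \<Longrightarrow> card V \<le> n \<Longrightarrow> U \<subseteq> V \<Longrightarrow> v \<in> V \<Longrightarrow> v \<notin> U \<Longrightarrow>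
      expect (random_subset p (star d V v)) (\<lambda>E. \<Psi> (card V - 1) (undisc U E))
      \<le> \<Psi> (card V) (card U)"
    and "finite (V :: 'a set)" "card V \<le> n" "U \<subseteq> V"
  shows "expect (leftover d p V U) (\<lambda>S. \<Psi> S S) \<le> \<Psi> (card V) (card U)"
  using assms(2-4)
proof (induction "card V" arbitrary: V U rule: less_induct)
  case less
  show ?case
  proof (cases "U = V")
    case True
    thus ?thesis by (simp add: leftover_all)
  next
    case False
    then obtain v where v: "v \<in> V" "v \<notin> U" using less.prems by auto
    let ?M = "random_subset p (star d V v)"
    have "expect (leftover d p V U) (\<lambda>S. \<Psi> S S) =
      expect ?M (\<lambda>E.
        expect (leftover d p (V - {v}) (U - \<Union>E)) (\<lambda>S. \<Psi> S S))"
      unfolding leftover_step[OF less.prems(1,3) v]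
      using less.prems by (intro expectation_bind_finite) auto
    also have "\<dots> \<le> expect ?M (\<lambda>E. \<Psi> (card V - 1) (undisc U E))"
    proof (rule expectation_mono_finite)
      fix E
      have "card (V - {v}) < card V" using less.prems v by (intro psubset_card_mono) auto
      thus "expect (leftover d p (V - {v}) (U - \<Union>E)) (\<lambda>S. \<Psi> S S)
        \<le> \<Psi> (card V - 1) (undisc U E)"
        using less(1)[of "V - {v}" "U - \<Union>E"] less.prems v by (auto simp: undisc_def)
    qed (use less.prems in simp)
    also have "\<dots> \<le> \<Psi> (card V) (card U)" by (rule step[OF less.prems v])
    finally show ?thesis .
  qed
qed

text \<open>\<open>\<Gamma>\<close> is an error budget: in each state it pays for the defect of the
  next step and, on average, for the budget required afterwards. Its nonnegativity settles the final
  states.\<close>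

lemma leftover_approx_martingale:
  fixes \<Xi> :: "nat \<Rightarrow> nat \<Rightarrow> 'b::{banach, second_countable_topology}" and \<Gamma> :: "nat \<Rightarrow> nat \<Rightarrow> real"
  assumes step: "\<And>(V :: 'a set) U v. finite V \<Longrightarrow> card V \<le> n \<Longrightarrow> U \<subseteq> V \<Longrightarrow> v \<in> V \<Longrightarrow> v \<notin> U \<Longrightarrow>
      norm (expect (random_subset p (star d V v)) (\<lambda>E. \<Xi> (card V - 1) (undisc U E))
        - \<Xi> (card V) (card U)) +
      expect (random_subset p (star d V v)) (\<lambda>E. \<Gamma> (card V - 1) (undisc U E))
      \<le> \<Gamma> (card V) (card U)"
    and nonneg: "\<And>m u. 0 \<le> \<Gamma> m u"
    and "finite (V :: 'a set)" "card V \<le> n" "U \<subseteq> V"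
  shows "norm (expect (leftover d p V U) (\<lambda>S. \<Xi> S S) - \<Xi> (card V) (card U))
    \<le> \<Gamma> (card V) (card U)"
  using assms(3-5)
proof (induction "card V" arbitrary: V U rule: less_induct)
  case less
  show ?case
  proof (cases "U = V")
    case True
    thus ?thesis by (simp add: leftover_all nonneg)
  next
    case False
    then obtain v where v: "v \<in> V" "v \<notin> U" using less.prems by auto
    let ?M = "random_subset p (star d V v)"
    let ?I = "\<lambda>E. expect (leftover d p (V - {v}) (U - \<Union>E)) (\<lambda>S. \<Xi> S S)"
    have fin: "finite (set_pmf ?M)" using less.prems by simp
    have "expect (leftover d p V U) (\<lambda>S. \<Xi> S S) - \<Xi> (card V) (card U) =
       expect ?M (\<lambda>E. ?I E - \<Xi> (card V - 1) (undisc U E)) +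
       (expect ?M (\<lambda>E. \<Xi> (card V - 1) (undisc U E)) - \<Xi> (card V) (card U))"
      unfolding leftover_step[OF less.prems(1,3) v]
      using less.prems fin by (subst expectation_bind_finite) (auto simp: expectation_diff_finite)
    hence "norm (expect (leftover d p V U) (\<lambda>S. \<Xi> S S) - \<Xi> (card V) (card U)) \<le>
       expect ?M (\<lambda>E. norm (?I E - \<Xi> (card V - 1) (undisc U E))) +
       norm (expect ?M (\<lambda>E. \<Xi> (card V - 1) (undisc U E)) - \<Xi> (card V) (card U))"
      by (simp only: order.trans[OF norm_triangle_ineq add_right_mono[OF norm_expectation_le]])
    moreover have "expect ?M (\<lambda>E. norm (?I E - \<Xi> (card V - 1) (undisc U E))) \<le>
       expect ?M (\<lambda>E. \<Gamma> (card V - 1) (undisc U E))"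
    proof (rule expectation_mono_finite[OF fin])
      fix E
      have "card (V - {v}) < card V" using less.prems v by (intro psubset_card_mono) auto
      thus "norm (?I E - \<Xi> (card V - 1) (undisc U E)) \<le> \<Gamma> (card V - 1) (undisc U E)"
        using less(1)[of "V - {v}" "U - \<Union>E"] less.prems v by (auto simp: undisc_def)
    qed
    ultimately show ?thesis using step[OF less.prems v] by linarith
  qed
qed

subsection \<open>One exploration step\<close>

lemma card_star:
  assumes "finite V" "v \<in> V"
  shows "card (star (Suc k) V v) = (card V - 1) choose k"
proof -
  have eq: "star (Suc k) V v = nsets V (Suc k) - nsets (V - {v}) (Suc k)"
    by (auto simp: star_def nsets_def)
  have "card (star (Suc k) V v) = card (nsets V (Suc k)) - card (nsets (V - {v}) (Suc k))"
    unfolding eq using assms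
    by (intro card_Diff_subset finite_imp_finite_nsets nsets_mono) auto
  also have "\<dots> = (card V choose Suc k) - ((card V - 1) choose Suc k)"
    using assms by simp
  also have "\<dots> = (card V - 1) choose k"
    using assms by (cases "card V") auto
  finally show ?thesis .
qed

lemma card_star_meeting:
  assumes "finite V" "v \<in> V" "W \<subseteq> V" "v \<notin> W"
  shows "card {e \<in> star (Suc k) V v. e \<inter> W \<noteq> {}} =
    ((card V - 1) choose k) - ((card V - card W - 1) choose k)"
proof -
  have eq: "{e \<in> star (Suc k) V v. e \<inter> W \<noteq> {}} = star (Suc k) V v - star (Suc k) (V - W) v"
    by (auto simp: star_def nsets_def)
  have "card {e \<in> star (Suc k) V v. e \<inter> W \<noteq> {}} =
      card (star (Suc k) V v) - card (star (Suc k) (V - W) v)"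
    unfolding eq using assms
    by (intro card_Diff_subset) (auto simp: star_def nsets_def)
  thus ?thesis
    using assms by (simp add: card_star card_Diff_subset finite_subset)
qed

text \<open>All of \<open>W\<close> escapes exactly when none of the edges through \<open>v\<close>
  that meet \<open>W\<close> is present; the exponent counts these edges as a complement.\<close>

lemma prob_star_avoids:
  assumes "finite V" "v \<in> V" "W \<subseteq> V" "v \<notin> W" "0 \<le> p" "p \<le> 1"
  shows "measure_pmf.prob (random_subset p (star (Suc k) V v)) {E. \<Union>E \<inter> W = {}} =
    (1 - p) ^ (((card V - 1) choose k) - ((card V - card W - 1) choose k))"
proof -
  let ?B = "{e \<in> star (Suc k) V v. e \<inter> W \<noteq> {}}"
  have "measure_pmf.prob (random_subset p (star (Suc k) V v)) {E. \<Union>E \<inter> W = {}} =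
    measure_pmf.prob (random_subset p (star (Suc k) V v)) {E. E \<inter> ?B = {}}"
    by (intro measure_pmf.finite_measure_eq_AE) (auto simp: AE_measure_pmf_iff dest!: set_random_subset)
  also have "\<dots> = (1 - p) ^ card ?B"
    using assms by (intro prob_random_subset_disjoint) auto
  finally show ?thesis unfolding card_star_meeting[OF assms(1-4)] .
qed

lemma undisc_eq_sum:
  assumes "finite U"
  shows "real (undisc U E) = (\<Sum>w\<in>U. of_bool (\<Union>E \<inter> {w} = {}))"
proof -
  have "U - \<Union>E = U \<inter> {w. \<Union>E \<inter> {w} = {}}" by auto
  thus ?thesis using assms by (simp add: undisc_def sum_of_bool_eq)
qed

lemma expectation_undisc:
  assumes "finite V" "U \<subseteq> V" "v \<in> V" "v \<notin> U" "0 \<le> p" "p \<le> 1"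
  shows "expect (random_subset p (star (Suc k) V v)) (\<lambda>E. real (undisc U E)) =
    real (card U) * (1 - p) ^ (((card V - 1) choose k) - ((card V - 2) choose k))"
proof -
  have finU: "finite U" using assms finite_subset by blast
  have "expect (random_subset p (star (Suc k) V v)) (\<lambda>E. real (undisc U E)) =
    (\<Sum>w\<in>U. measure_pmf.prob (random_subset p (star (Suc k) V v)) {E. \<Union>E \<inter> {w} = {}})"
    using assms by (simp add: undisc_eq_sum[OF finU] expectation_sum_finite prob_eq_expectation)
  also have "\<dots> = (\<Sum>w\<in>U. (1 - p) ^ (((card V - 1) choose k) - ((card V - 2) choose k)))"
    using assms by (intro sum.cong refl, subst prob_star_avoids) (auto simp: numeral_2_eq_2)
  finally show ?thesis by simp
qed

text \<open>The square is a sum over ordered pairs of vertices that both escape. Diagonal pairs ask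
  for one vertex to be avoided and give the first term; the others ask for two, hence
  \<open>card V - 3\<close>.\<close>

lemma expectation_undisc_sq:
  assumes "finite V" "U \<subseteq> V" "v \<in> V" "v \<notin> U" "0 \<le> p" "p \<le> 1"
  shows "expect (random_subset p (star (Suc k) V v)) (\<lambda>E. (real (undisc U E))\<^sup>2) =
    real (card U) * (1 - p) ^ (((card V - 1) choose k) - ((card V - 2) choose k)) +
    real (card U) * (real (card U) - 1) *
      (1 - p) ^ (((card V - 1) choose k) - ((card V - 3) choose k))"
proof -
  have finU: "finite U" using assms finite_subset by blast
  let ?M = "random_subset p (star (Suc k) V v)"
  let ?q = "(1 - p) ^ (((card V - 1) choose k) - ((card V - 2) choose k))"
  let ?q2 = "(1 - p) ^ (((card V - 1) choose k) - ((card V - 3) choose k))"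
  have "(real (undisc U E))\<^sup>2 = (\<Sum>w\<in>U. \<Sum>x\<in>U. of_bool (E \<in> {E. \<Union>E \<inter> {w, x} = {}}))" for E
    unfolding undisc_eq_sum[OF finU] power2_eq_square sum_product
    by (intro sum.cong refl) (auto simp: of_bool_conj[symmetric] simp flip: of_bool_conj)
  hence "expect ?M (\<lambda>E. (real (undisc U E))\<^sup>2) =
    (\<Sum>w\<in>U. \<Sum>x\<in>U. measure_pmf.prob ?M {E. \<Union>E \<inter> {w, x} = {}})"
    using assms by (simp add: expectation_sum_finite prob_eq_expectation)
  also have "\<dots> = (\<Sum>w\<in>U. \<Sum>x\<in>U. if x = w then ?q else ?q2)"
  proof (intro sum.cong refl)
    fix w x assume "w \<in> U" "x \<in> U"
    hence "card V - card {w, x} - 1 = (if x = w then card V - 2 else card V - 3)" by auto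
    thus "measure_pmf.prob ?M {E. \<Union>E \<inter> {w, x} = {}} = (if x = w then ?q else ?q2)"
      using assms \<open>w \<in> U\<close> \<open>x \<in> U\<close> by (subst prob_star_avoids) auto
  qed
  also have "\<dots> = (\<Sum>w\<in>U. ?q + (real (card U) - 1) * ?q2)"
  proof (intro sum.cong refl)
    fix w assume w: "w \<in> U"
    have "(\<Sum>x\<in>U. if x = w then ?q else ?q2) = ?q + (\<Sum>x\<in>U - {w}. ?q2)"
      using finU w by (simp add: sum.remove[of U w])
    moreover have "real (card U - 1) = real (card U) - 1"
      using w finU card_gt_0_iff[of U] by (auto simp: of_nat_diff Suc_leI)
    ultimately show "(\<Sum>x\<in>U. if x = w then ?q else ?q2) = ?q + (real (card U) - 1) * ?q2"
      using finU w by simp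
  qed
  finally show ?thesis by (simp add: algebra_simps)
qed

lemma undisc_loss_le:
  assumes "finite V" "U \<subseteq> V" "E \<subseteq> star d V v"
  shows "real (card U) - real (undisc U E) \<le> real d * real (card E)" and "undisc U E \<le> card U"
proof -
  have finU: "finite U" using assms finite_subset by blast
  show "undisc U E \<le> card U" unfolding undisc_def by (intro card_mono finU) auto
  have finE: "finite E" using assms(1,3) finite_star finite_subset by metis
  have fine: "finite e" "card e = d" if "e \<in> E" for e
    using that assms by (auto simp: star_def nsets_def)
  have "card U - undisc U E = card (U \<inter> \<Union>E)"
    unfolding undisc_def using finU card_Diff_subset_Int[of U "\<Union>E"]
    by (simp add: card_Diff_subset_Int card_mono)
  also have "\<dots> \<le> card (\<Union>E)" using finE fine by (intro card_mono) auto
  also have "\<dots> \<le> (\<Sum>e\<in>E. card e)" by (rule card_Union_le_sum_card) 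
  also have "\<dots> = d * card E" using fine by simp
  finally have "card U - undisc U E \<le> d * card E" .
  thus "real (card U) - real (undisc U E) \<le> real d * real (card E)"
    by (metis of_nat_diff_real of_nat_mult of_nat_le_iff of_nat_0_le_iff diff_le_eq le_add_diff_inverse le_diff_conv of_nat_add add.commute)
qed

section \<open>Elementary bounds for exponentials and powers\<close>

lemma power_le_fact_exp:
  fixes x :: real
  assumes "0 \<le> x"
  shows "x ^ j \<le> fact j * exp x"
proof -
  have "(\<Sum>i\<in>{j}. x ^ i /\<^sub>R fact i) \<le> (\<Sum>i. x ^ i /\<^sub>R fact i)"
    using assms by (intro sum_le_suminf summable_exp_generic) auto
  thus ?thesis by (simp add: exp_def field_simps)
qed

lemma exp_neg_le_quadratic:
  fixes x :: real
  assumes "0 \<le> x"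
  shows "exp (- x) \<le> 1 - x + x\<^sup>2 / 2"
proof -
  define f where "f y = 1 - y + y\<^sup>2 / 2 - exp (- y)" for y :: real
  have "f 0 \<le> f x"
  proof (rule DERIV_nonneg_imp_nondecreasing[OF assms])
    fix y :: real assume "0 \<le> y" "y \<le> x"
    have "(f has_real_derivative (- 1 + y + exp (- y))) (at y)"
      unfolding f_def by (auto intro!: derivative_eq_intros)
    moreover have "0 \<le> - 1 + y + exp (- y)" using exp_ge_add_one_self[of "- y"] by linarith
    ultimately show "\<exists>z. (f has_real_derivative z) (at y) \<and> 0 \<le> z" by blast
  qed
  thus ?thesis by (simp add: f_def)
qed

lemma one_minus_power_bounds:
  fixes p :: real
  assumes "0 \<le> p" "p \<le> 1"
  shows "1 - p * real j \<le> (1 - p) ^ j"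
    and "(1 - p) ^ j \<le> 1 - p * real j + (p * real j)\<^sup>2 / 2"
proof -
  show "1 - p * real j \<le> (1 - p) ^ j"
    using Bernoulli_inequality[of "- p" j] assms by (simp add: mult.commute)
  have "(1 - p) ^ j \<le> exp (- p) ^ j"
    using assms exp_ge_add_one_self[of "- p"] by (intro power_mono) auto
  also have "\<dots> = exp (- (p * real j))"
    by (simp add: exp_of_nat_mult[symmetric] mult.commute)
  also have "\<dots> \<le> 1 - p * real j + (p * real j)\<^sup>2 / 2"
    using assms by (intro exp_neg_le_quadratic) simp
  finally show "(1 - p) ^ j \<le> 1 - p * real j + (p * real j)\<^sup>2 / 2" .
qed

text \<open>Here \<open>k\<close> is the \<open>d - 1\<close> of the paper, and \<open>K\<close> is a bound that will not depend on \<open>n\<close>.\<close>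

locale sparse_regime =
  fixes k n :: nat and p K :: real
  assumes k: "1 \<le> k" and p: "0 \<le> p" "p \<le> 1" and K1: "1 \<le> K" and Kn: "K \<le> real n"
    and deg_n: "p * real ((n - 1) choose k) \<le> K"
    and codeg_le: "m \<le> n \<Longrightarrow> p * real ((m - 2) choose (k - 1)) \<le> K / real n"
    and codeg_diff_le: "m \<le> n \<Longrightarrow>
      p * real ((m - 2) choose (k - 1)) - p * real ((m - 1 - 2) choose (k - 1)) \<le> K / (real n)\<^sup>2"
begin

text \<open>The \<open>a(m)\<close> of the overview: the probability that a given one of
  \<open>m\<close> vertices lies in no edge among them.\<close>

definition wt :: "nat \<Rightarrow> real" where "wt m = (1 - p) ^ ((m - 1) choose k)"

text \<open>For \<open>m < 2\<close> truncated subtraction makes \<open>codeg m = codeg 2\<close>. This is wanted: for \<open>k = 1\<close> a difference of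
  degrees would jump by \<open>p\<close> at \<open>m = 2\<close>, which exceeds the bound \<open>K / n\<^sup>2\<close> on the increments.\<close>

definition codeg :: "nat \<Rightarrow> real" where "codeg m = p * real ((m - 2) choose (k - 1))"
text \<open>A common bound for second and third moments of a step: \<open>6\<close> is
  \<open>fact 3\<close>, the cube comes from edges having \<open>Suc k\<close> vertices, and
  \<open>exp (3 * K)\<close> is \<open>exp K\<close> times the bound \<open>exp (2 * K)\<close> for
  the exponential moment of the number of edges at \<open>v\<close>.\<close>

definition mom :: real where "mom = 6 * real (Suc k) ^ 3 * exp (3 * K)"

lemma n_pos: "0 < n" using K1 Kn by (cases n) auto

lemma wt_nonneg: "0 \<le> wt m" and wt_le_1: "wt m \<le> 1"
  using p by (auto simp: wt_def power_le_one)

lemma wt_antimono: "m' \<le> m \<Longrightarrow> wt m \<le> wt m'"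
  unfolding wt_def using p by (intro power_decreasing binomial_right_mono) auto

lemma deg_le: "m \<le> n \<Longrightarrow> p * real ((m - 1) choose k) \<le> K"
proof -
  assume "m \<le> n"
  hence "p * real ((m - 1) choose k) \<le> p * real ((n - 1) choose k)"
    using p by (intro mult_left_mono of_nat_mono binomial_right_mono) auto
  thus ?thesis using deg_n by linarith
qed

lemma codeg_nonneg: "0 \<le> codeg m" using p by (simp add: codeg_def)

lemma codeg_le': "m \<le> n \<Longrightarrow> codeg m \<le> K / real n"
  using codeg_le by (simp add: codeg_def)

lemma codeg_mono: "m' \<le> m \<Longrightarrow> codeg m' \<le> codeg m"
  unfolding codeg_def using p by (intro mult_left_mono of_nat_mono binomial_right_mono) auto

lemma codeg_diff_le': "m \<le> n \<Longrightarrow> codeg m - codeg (m - 1) \<le> K / (real n)\<^sup>2"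
  using codeg_diff_le by (simp add: codeg_def)

lemma choose_codeg:
  assumes "2 \<le> m"
  shows "(m - 1) choose k = ((m - 2) choose k) + ((m - 2) choose (k - 1))"
proof -
  obtain m' where "m = Suc (Suc m')" using assms by (metis add_2_eq_Suc le_Suc_ex)
  moreover obtain k' where "k = Suc k'" using k by (cases k) auto
  ultimately show ?thesis by simp
qed

lemma wt_step: "2 \<le> m \<Longrightarrow> wt (m - 1) * (1 - p) ^ (((m - 1) choose k) - ((m - 2) choose k)) = wt m"
  using choose_codeg[of m] by (simp add: wt_def power_add mult.commute numeral_2_eq_2)

lemma mom_ge: "K \<le> mom" "1 \<le> mom"
proof -
  have "1 * exp K \<le> (6 * real (Suc k) ^ 3) * exp (3 * K)"
  proof (intro mult_mono)
    have "1 \<le> real (Suc k) ^ 3" by (intro one_le_power) simp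
    thus "1 \<le> 6 * real (Suc k) ^ 3" by linarith
  qed (use K1 in auto)
  moreover have "K \<le> exp K" using exp_ge_add_one_self[of K] by linarith
  ultimately show "K \<le> mom" by (simp add: mom_def)
  thus "1 \<le> mom" using K1 by linarith
qed

end

section \<open>Drift and moments of a single step\<close>

locale exploration_step = sparse_regime +
  fixes V U :: "'a set" and v :: 'a
  assumes V: "finite V" "card V \<le> n" and U: "U \<subseteq> V" and v: "v \<in> V" "v \<notin> U"
begin

abbreviation "M \<equiv> random_subset p (star (Suc k) V v)"
abbreviation "m \<equiv> card V"
abbreviation "u \<equiv> card U"

definition inc :: "'a set set \<Rightarrow> real" where
  "inc E = wt (m - 1) * real (undisc U E) - wt m * real u"

lemma finite_M [simp]: "finite (set_pmf M)" using V by simp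

lemma u_less: "u < m"
  using V U v by (intro psubset_card_mono) auto

lemma u_le_n: "real u \<le> real n" using u_less V by simp

text \<open>The probability of escaping is exactly the factor that \<open>wt\<close> gains when
  \<open>m\<close> drops by one. The case \<open>u = 0\<close> is separate because
  \<open>wt_step\<close> needs \<open>2 \<le> m\<close>.\<close>

lemma drift: "wt (m - 1) * expect M (\<lambda>E. real (undisc U E)) = wt m * real u"
proof (cases "u = 0")
  case True
  thus ?thesis using expectation_undisc[OF V(1) U v p] by simp
next
  case False
  hence "2 \<le> m" using u_less by linarith
  thus ?thesis
    using wt_step[of m] expectation_undisc[OF V(1) U v p, of k] by (simp add: mult_ac)
qed

lemma inc_mean: "expect M inc = 0"
  unfolding inc_def using drift by (simp add: expectation_diff_finite)

lemma expectation_undisc_le: "expect M (\<lambda>E. real (undisc U E)) \<le> real u"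
proof -
  have "expect M (\<lambda>E. real (undisc U E)) \<le> expect M (\<lambda>_. real u)"
    using undisc_loss_le[OF V(1) U] by (intro expectation_mono_finite) (auto dest: set_random_subset)
  thus ?thesis by simp
qed

text \<open>Each of at most \<open>n\<close> undiscovered vertices is lost with probability at most
  \<open>codeg m \<le> K / n\<close>.\<close>

lemma expectation_undisc_ge: "real u - K \<le> expect M (\<lambda>E. real (undisc U E))"
proof (cases "u = 0")
  case True
  thus ?thesis using K1 by (intro order.trans[OF _ expectation_nonneg]) auto
next
  case False
  hence m2: "2 \<le> m" using u_less by linarith
  have "1 - codeg m \<le> (1 - p) ^ (((m - 1) choose k) - ((m - 2) choose k))"
    using one_minus_power_bounds(1)[OF p, of "(m - 2) choose (k - 1)"] choose_codeg[OF m2]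
    by (simp add: codeg_def)
  hence "real u * (1 - codeg m) \<le> expect M (\<lambda>E. real (undisc U E))"
    using expectation_undisc[OF V(1) U v p, of k] by (simp add: mult_left_mono)
  moreover have "real u * codeg m \<le> real n * (K / real n)"
    using u_le_n codeg_le'[OF V(2)] codeg_nonneg by (intro mult_mono) auto
  ultimately show ?thesis using n_pos by (simp add: algebra_simps)
qed

lemma expectation_exp_card: "expect M (\<lambda>E. exp (real (card E))) \<le> exp (2 * K)"
proof -
  have "expect M (\<lambda>E. exp (real (card E))) \<le> exp (2 * (p * real (card (star (Suc k) V v))))"
    using V p by (intro expectation_exp_card_random_subset) auto
  also have "\<dots> \<le> exp (2 * K)"
    using deg_le[OF V(2)] V v by (simp add: card_star)
  finally show ?thesis .
qed

text \<open>By \<open>drift\<close>, \<open>inc\<close> is a weight of at most one times the centred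
  number of survivors. That number is at most \<open>Suc k * card E\<close> below \<open>u\<close>
  and its mean at most \<open>K\<close> below \<open>u\<close>.\<close>

lemma abs_inc_le:
  assumes "E \<in> set_pmf M"
  shows "\<bar>inc E\<bar> \<le> real (Suc k) * (real (card E) + K)"
proof -
  let ?e = "expect M (\<lambda>E. real (undisc U E))"
  note loss = undisc_loss_le[OF V(1) U set_random_subset[OF assms]]
  have "inc E = wt (m - 1) * (real (undisc U E) - ?e)"
    using drift by (simp add: inc_def right_diff_distrib)
  hence "\<bar>inc E\<bar> = wt (m - 1) * \<bar>real (undisc U E) - ?e\<bar>"
    using wt_nonneg by (simp add: abs_mult)
  also have "\<dots> \<le> 1 * \<bar>real (undisc U E) - ?e\<bar>"
    using wt_le_1 by (intro mult_right_mono) auto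
  also have "\<dots> \<le> real (Suc k) * real (card E) + K"
    using loss expectation_undisc_le expectation_undisc_ge by (simp add: abs_le_iff)
  also have "\<dots> \<le> real (Suc k) * (real (card E) + K)"
    using K1 mult_right_mono[of 1 "real (Suc k)" K] by (simp add: distrib_left)
  finally show ?thesis .
qed

lemma expectation_exp_bound:
  assumes "\<And>E. E \<in> set_pmf M \<Longrightarrow> f E \<le> C * exp (real (card E) + K)" "0 \<le> C"
  shows "expect M f \<le> C * exp (3 * K)"
proof -
  have "expect M f \<le> expect M (\<lambda>E. (C * exp K) * exp (real (card E)))"
    using assms(1) by (intro expectation_mono_finite) (auto simp: exp_add mult_ac)
  also have "\<dots> = (C * exp K) * expect M (\<lambda>E. exp (real (card E)))"
    by simp
  also have "\<dots> \<le> (C * exp K) * exp (2 * K)"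
    using assms(2) expectation_exp_card by (intro mult_left_mono) auto
  also have "\<dots> = C * exp (3 * K)" by (simp add: exp_add[symmetric])
  finally show ?thesis .
qed

lemma inc_moment3: "expect M (\<lambda>E. \<bar>inc E\<bar> ^ 3) \<le> mom"
  unfolding mom_def
proof (rule expectation_exp_bound)
  fix E assume E: "E \<in> set_pmf M"
  have "\<bar>inc E\<bar> ^ 3 \<le> (real (Suc k) * (real (card E) + K)) ^ 3"
    using abs_inc_le[OF E] by (intro power_mono) auto
  also have "\<dots> = real (Suc k) ^ 3 * (real (card E) + K) ^ 3" by (rule power_mult_distrib)
  also have "\<dots> \<le> real (Suc k) ^ 3 * (fact 3 * exp (real (card E) + K))"
    using K1 by (intro mult_left_mono power_le_fact_exp) auto
  also have "\<dots> = 6 * real (Suc k) ^ 3 * exp (real (card E) + K)"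
    by (simp add: fact_numeral)
  finally show "\<bar>inc E\<bar> ^ 3 \<le> 6 * real (Suc k) ^ 3 * exp (real (card E) + K)" .
qed simp

lemma sq_moment:
  assumes "\<And>E. E \<in> set_pmf M \<Longrightarrow> \<bar>f E\<bar> \<le> real (Suc k) * (real (card E) + K)"
  shows "expect M (\<lambda>E. (f E)\<^sup>2) \<le> mom"
  unfolding mom_def
proof (rule expectation_exp_bound)
  fix E assume E: "E \<in> set_pmf M"
  have "(f E)\<^sup>2 \<le> (real (Suc k) * (real (card E) + K))\<^sup>2"
    using assms[OF E] K1 by (intro abs_le_square_iff[THEN iffD1]) auto
  also have "\<dots> = (real (Suc k))\<^sup>2 * (real (card E) + K)\<^sup>2" by (rule power_mult_distrib)
  also have "\<dots> \<le> real (Suc k) ^ 3 * (6 * exp (real (card E) + K))"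
  proof (intro mult_mono)
    show "(real (Suc k))\<^sup>2 \<le> real (Suc k) ^ 3" by (intro power_increasing) auto
    have "(real (card E) + K)\<^sup>2 \<le> 2 * exp (real (card E) + K)"
      using K1 power_le_fact_exp[of "real (card E) + K" 2] by simp
    thus "(real (card E) + K)\<^sup>2 \<le> 6 * exp (real (card E) + K)"
      using exp_gt_zero[of "real (card E) + K"] by linarith
  qed auto
  also have "\<dots> = 6 * real (Suc k) ^ 3 * exp (real (card E) + K)" by simp
  finally show "(f E)\<^sup>2 \<le> 6 * real (Suc k) ^ 3 * exp (real (card E) + K)" .
qed simp

lemma inc_moment2: "expect M (\<lambda>E. (inc E)\<^sup>2) \<le> mom"
  using abs_inc_le by (rule sq_moment)

lemma loss_moment2: "expect M (\<lambda>E. (real u - real (undisc U E))\<^sup>2) \<le> mom"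
proof (rule sq_moment)
  fix E assume "E \<in> set_pmf M"
  note loss = undisc_loss_le[OF V(1) U set_random_subset[OF this]]
  have "real (Suc k) * real (card E) \<le> real (Suc k) * (real (card E) + K)"
    using K1 by (intro mult_left_mono) auto
  moreover have "0 \<le> real u - real (undisc U E)" using loss(2) by simp
  ultimately show "\<bar>real u - real (undisc U E)\<bar> \<le> real (Suc k) * (real (card E) + K)"
    using loss(1) by linarith
qed

end

section \<open>Conditional variance of a single step\<close>

context exploration_step
begin

lemma wt_diff_le: "wt (m - 1) - wt m \<le> K / real n"
proof (cases "2 \<le> m")
  case True
  have "wt (m - 1) - wt m = wt (m - 1) * (1 - (1 - p) ^ ((m - 2) choose (k - 1)))"
    using wt_step[OF True] choose_codeg[OF True] by (simp add: right_diff_distrib)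
  also have "\<dots> \<le> 1 * codeg m"
    using one_minus_power_bounds(1)[OF p, of "(m - 2) choose (k - 1)"] wt_le_1 wt_nonneg p
    by (intro mult_mono) (auto simp: codeg_def power_le_one)
  also have "\<dots> \<le> K / real n" using codeg_le'[OF V(2)] by simp
  finally show ?thesis .
next
  case False
  \<comment> \<open>For \<open>m < 2\<close> truncated subtraction gives both weights the same
    exponent.\<close>
  hence "m - 1 - 1 = m - 1" by simp
  hence "wt (m - 1) = wt m" unfolding wt_def by simp
  thus ?thesis using K1 by simp
qed

text \<open>The variance has two sources. Each vertex alone contributes a Bernoulli variance, which
  yields \<open>y * (wt (m - 1) - wt m)\<close>. Two vertices are positively correlated, because an
  edge through \<open>v\<close> that contains both has to be absent only once; this yields
  \<open>y\<^sup>2 * z\<close>.\<close>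

lemma inc_var_main:
  defines "y \<equiv> wt m * real u" and "z \<equiv> codeg m - codeg (m - 1)"
  shows "\<bar>expect M (\<lambda>E. (inc E)\<^sup>2) - (y * (wt (m - 1) - wt m) + y\<^sup>2 * z)\<bar>
    \<le> 2 * K\<^sup>2 / real n"
proof -
  let ?w1 = "wt (m - 1)" and ?w0 = "wt m"
  let ?e1 = "expect M (\<lambda>E. real (undisc U E))"
  let ?e2 = "expect M (\<lambda>E. (real (undisc U E))\<^sup>2)"
  have "expect M (\<lambda>E. (inc E)\<^sup>2) =
      expect M (\<lambda>E. ?w1\<^sup>2 * (real (undisc U E))\<^sup>2 - (2 * ?w1 * y) * real (undisc U E) + y\<^sup>2)"
    by (intro expectation_cong_pmf) (simp add: inc_def y_def power2_eq_square algebra_simps)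
  also have "\<dots> = ?w1\<^sup>2 * ?e2 - 2 * y * (?w1 * ?e1) + y\<^sup>2"
    by (simp add: expectation_diff_finite expectation_add_finite)
  also have "\<dots> = ?w1\<^sup>2 * ?e2 - y\<^sup>2"
    unfolding drift by (simp add: y_def power2_eq_square)
  finally have E: "expect M (\<lambda>E. (inc E)\<^sup>2) = ?w1\<^sup>2 * ?e2 - y\<^sup>2" .
  have z0: "0 \<le> z" using codeg_mono[of "m - 1" m] by (simp add: z_def)
  have z1: "z \<le> K / (real n)\<^sup>2" using codeg_diff_le'[OF V(2)] by (simp add: z_def)
  have nn: "1 \<le> real n" using n_pos by simp
  have "K / (real n)\<^sup>2 \<le> real n / (real n)\<^sup>2" using Kn by (intro divide_right_mono) auto
  also have "\<dots> \<le> 1" using nn by (simp add: power2_eq_square)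
  finally have z2: "z \<le> 1" using z1 by simp
  have C0: "0 \<le> 2 * K\<^sup>2 / real n" by simp
  show ?thesis
  proof (cases "u = 0")
    case True
    thus ?thesis using E C0 expectation_undisc_sq[OF V(1) U v p, of k] by (simp add: y_def)
  next
    case False
    hence m2: "2 \<le> m" using u_less by linarith
    let ?q = "(1 - p) ^ (((m - 1) choose k) - ((m - 2) choose k))"
    let ?q2 = "(1 - p) ^ (((m - 1) choose k) - ((m - 3) choose k))"
    let ?G = "?w1\<^sup>2 * ?q2"
    have wq: "?w1 * ?q = ?w0" by (rule wt_step[OF m2])
    have e2: "?e2 = real u * ?q + real u * (real u - 1) * ?q2"
      by (rule expectation_undisc_sq[OF V(1) U v p])
    have "?w1\<^sup>2 * ?e2 = real u * (?w1 * (?w1 * ?q)) + real u * (real u - 1) * ?G"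
      unfolding e2 by (simp add: power2_eq_square algebra_simps)
    \<comment> \<open>The diagonal terms cancel, and only the correlation of pairs is left to
      compare with \<open>y\<^sup>2 * z\<close>; \<open>?G\<close> is \<open>?w1\<^sup>2\<close>
      times the probability that both members of a pair escape.\<close>
    hence key: "?w1\<^sup>2 * ?e2 - y\<^sup>2 - (y * (?w1 - ?w0) + y\<^sup>2 * z) =
        real u * (real u - 1) * (?G - ?w0\<^sup>2) - (real u)\<^sup>2 * ?w0\<^sup>2 * z"
      unfolding wq y_def by (simp add: power2_eq_square algebra_simps)
    show ?thesis
    \<comment> \<open>With \<open>m = 2\<close> there is a single undiscovered vertex, hence no
      pair, and \<open>z = 0\<close> by the truncated subtraction in \<open>codeg\<close>.\<close>
    proof (cases "m = 2")
      case True
      hence "u = 1" using False u_less by simp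
      moreover have "z = 0" using True by (simp add: z_def codeg_def)
      ultimately show ?thesis using key E C0 by simp
    next
      case False
      hence m3: "3 \<le> m" using m2 by simp
      \<comment> \<open>The number of edges through \<open>v\<close> and two given undiscovered
        vertices. The product of the two single escape probabilities counts them twice and the joint
        probability once, whence \<open>?G * x = ?w0\<^sup>2\<close> below.\<close>
      define e3 where "e3 = ((m - 2) choose (k - 1)) - ((m - 3) choose (k - 1))"
      define x where "x = (1 - p) ^ e3"
      have b: "(m - 1) choose k = ((m - 2) choose k) + ((m - 2) choose (k - 1))"
        by (rule choose_codeg[OF m2])
      have b': "(m - 2) choose k = ((m - 3) choose k) + ((m - 3) choose (k - 1))"
        using choose_codeg[of "m - 1"] m3 by (simp add: numeral_eq_Suc)
      have le: "(m - 3) choose (k - 1) \<le> (m - 2) choose (k - 1)"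
        by (intro binomial_right_mono) auto
      have pe3: "p * real e3 = z"
        using le by (simp add: e3_def z_def codeg_def of_nat_diff right_diff_distrib numeral_eq_Suc)
      have ex: "((m - 2) choose k) + ((m - 2) choose k) +
          (((m - 1) choose k) - ((m - 3) choose k)) + e3 = ((m - 1) choose k) + ((m - 1) choose k)"
        using b b' le unfolding e3_def by linarith
      have Gx: "?G * x = ?w0\<^sup>2"
      proof -
        have "?w1 = (1 - p) ^ ((m - 2) choose k)" by (simp add: wt_def numeral_eq_Suc)
        hence "?G * x = (1 - p) ^ (((m - 2) choose k) + ((m - 2) choose k) +
          (((m - 1) choose k) - ((m - 3) choose k)) + e3)"
          by (simp add: x_def power2_eq_square power_add mult_ac)
        thus ?thesis unfolding ex by (simp add: wt_def power2_eq_square power_add)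
      qed
      have x: "1 - z \<le> x" "x \<le> 1 - z + z\<^sup>2 / 2" "0 \<le> x" "x \<le> 1"
        using one_minus_power_bounds[OF p, of e3] p unfolding x_def pe3 by (auto simp: power_le_one)
      have G: "0 \<le> ?G" "?G \<le> 1"
        using p wt_nonneg wt_le_1 by (auto simp: power_le_one intro!: mult_le_one)
      have A: "?G - ?w0\<^sup>2 = ?G * (1 - x)" using Gx by (simp add: right_diff_distrib)
      have A1: "0 \<le> ?G * (1 - x)" "?G * (1 - x) \<le> z"
        using G x mult_mono[of ?G 1 "1 - x" z] z0 by auto
      have "1 - x - x * z = 1 - x * (1 + z)" by (simp add: algebra_simps)
      moreover have "x * (1 + z) \<ge> (1 - z) * (1 + z)" using x z0 by (intro mult_right_mono) auto
      moreover have "x * (1 + z) \<le> (1 - z + z\<^sup>2 / 2) * (1 + z)" using x z0 by (intro mult_right_mono) auto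
      moreover have "(1 - z + z\<^sup>2 / 2) * (1 + z) = 1 - z\<^sup>2 / 2 * (1 - z)"
        by (simp add: power2_eq_square field_simps)
      moreover have "(1 - z) * (1 + z) = 1 - z\<^sup>2" by (simp add: power2_eq_square algebra_simps)
      moreover have "0 \<le> z\<^sup>2 / 2 * (1 - z)" using z2 by simp
      ultimately have B: "0 \<le> 1 - x - x * z" "1 - x - x * z \<le> z\<^sup>2" by linarith+
      have B1: "0 \<le> ?G * (1 - x - x * z)" "?G * (1 - x - x * z) \<le> z\<^sup>2"
        using G B mult_mono[of ?G 1 "1 - x - x * z" "z\<^sup>2"] by auto
      \<comment> \<open>The first term on the right is of order
        \<open>n\<^sup>2 * z\<^sup>2\<close>, the second of order \<open>n * z\<close>; since
        \<open>z \<le> K / n\<^sup>2\<close>, both are of order \<open>1 / n\<close>.\<close>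
      have "real u * (real u - 1) * (?G - ?w0\<^sup>2) - (real u)\<^sup>2 * ?w0\<^sup>2 * z =
          (real u)\<^sup>2 * (?G * (1 - x - x * z)) - real u * (?G * (1 - x))"
        unfolding A Gx[symmetric] by (simp add: power2_eq_square algebra_simps)
      moreover have "(real u)\<^sup>2 * (?G * (1 - x - x * z)) \<le> (real n)\<^sup>2 * z\<^sup>2"
        using B1 u_le_n by (intro mult_mono power_mono) auto
      moreover have "real u * (?G * (1 - x)) \<le> real n * z"
        using A1 u_le_n by (intro mult_mono) auto
      moreover have "0 \<le> (real u)\<^sup>2 * (?G * (1 - x - x * z))" "0 \<le> real u * (?G * (1 - x))"
        using A1 B1 by simp_all
      moreover have "real n * z \<le> K\<^sup>2 / real n"
      proof -
        have "real n * z \<le> real n * (K / (real n)\<^sup>2)" using z1 by (intro mult_left_mono) auto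
        also have "\<dots> = K / real n" using n_pos by (simp add: power2_eq_square)
        also have "\<dots> \<le> K\<^sup>2 / real n" using K1 by (intro divide_right_mono) (auto simp: power2_eq_square)
        finally show ?thesis .
      qed
      moreover have "(real n)\<^sup>2 * z\<^sup>2 \<le> K\<^sup>2 / real n"
      proof -
        have "(real n)\<^sup>2 * z\<^sup>2 \<le> (real n)\<^sup>2 * (K / (real n)\<^sup>2)\<^sup>2"
          using z1 z0 by (intro mult_left_mono power_mono) auto
        also have "\<dots> = K\<^sup>2 / real n / real n" using n_pos by (simp add: power2_eq_square)
        also have "\<dots> \<le> K\<^sup>2 / real n" using nn divide_left_mono[of 1 "real n" "K\<^sup>2 / real n"] by simp
        finally show ?thesis .
      qed
      ultimately show ?thesis using key E C0 by linarith
    qed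
  qed
qed

text \<open>With a constant \<open>\<mu>\<close> in place of the current value \<open>y\<close> the
  variance becomes a function of \<open>m\<close> alone. The cost is proportional to
  \<open>\<bar>y - \<mu>\<bar> / n\<close>, because the weight difference is at most
  \<open>K / n\<close>, the codegree difference at most \<open>K / n\<^sup>2\<close>, and
  \<open>y + \<mu> \<le> 2 * n\<close>.\<close>

lemma inc_var:
  assumes mu: "0 \<le> \<mu>" "\<mu> \<le> real n"
  shows "\<bar>expect M (\<lambda>E. (inc E)\<^sup>2) -
      (\<mu> * (wt (m - 1) - wt m) + \<mu>\<^sup>2 * (codeg m - codeg (m - 1)))\<bar>
    \<le> 3 * K\<^sup>2 * ((\<bar>wt m * real u - \<mu>\<bar> + 1) / real n)"
proof -
  define y z a where "y = wt m * real u" and "z = codeg m - codeg (m - 1)" and "a = wt (m - 1) - wt m"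
  have y: "0 \<le> y" "y \<le> real n"
    using wt_nonneg wt_le_1 u_le_n mult_mono[of "wt m" 1 "real u" "real n"] by (auto simp: y_def)
  have z: "0 \<le> z" "z \<le> K / (real n)\<^sup>2"
    using codeg_mono[of "m - 1" m] codeg_diff_le'[OF V(2)] by (auto simp: z_def)
  have a: "0 \<le> a" "a \<le> K / real n"
    using wt_antimono[of "m - 1" m] wt_diff_le by (auto simp: a_def)
  have "\<bar>y * a - \<mu> * a\<bar> = \<bar>y - \<mu>\<bar> * a"
    using a by (simp add: abs_mult[symmetric] left_diff_distrib[symmetric] abs_mult)
  also have "\<dots> \<le> \<bar>y - \<mu>\<bar> * (K / real n)" using a by (intro mult_left_mono) auto
  finally have 1: "\<bar>y * a - \<mu> * a\<bar> \<le> K * (\<bar>y - \<mu>\<bar> / real n)" by (simp add: mult.commute)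
  have "\<bar>y\<^sup>2 * z - \<mu>\<^sup>2 * z\<bar> = \<bar>y - \<mu>\<bar> * ((y + \<mu>) * z)"
  proof -
    have "y\<^sup>2 * z - \<mu>\<^sup>2 * z = (y - \<mu>) * ((y + \<mu>) * z)" by (simp add: power2_eq_square algebra_simps)
    thus ?thesis using y mu z by (simp add: abs_mult)
  qed
  also have "\<dots> \<le> \<bar>y - \<mu>\<bar> * ((2 * real n) * (K / (real n)\<^sup>2))"
    using y mu z by (intro mult_left_mono mult_mono) auto
  also have "\<dots> = 2 * K * (\<bar>y - \<mu>\<bar> / real n)" using n_pos by (simp add: power2_eq_square)
  finally have 2: "\<bar>y\<^sup>2 * z - \<mu>\<^sup>2 * z\<bar> \<le> 2 * K * (\<bar>y - \<mu>\<bar> / real n)" .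
  have 3: "\<bar>expect M (\<lambda>E. (inc E)\<^sup>2) - (y * a + y\<^sup>2 * z)\<bar> \<le> 2 * K\<^sup>2 / real n"
    using inc_var_main unfolding y_def a_def z_def .
  have "3 * K * (\<bar>y - \<mu>\<bar> / real n) \<le> 3 * K\<^sup>2 * (\<bar>y - \<mu>\<bar> / real n)"
    using K1 by (intro mult_right_mono) (auto simp: power2_eq_square)
  moreover have "2 * K\<^sup>2 / real n \<le> 3 * K\<^sup>2 * (1 / real n)"
    by (simp add: divide_right_mono)
  moreover have "3 * K\<^sup>2 * ((\<bar>y - \<mu>\<bar> + 1) / real n) = 3 * K\<^sup>2 * (\<bar>y - \<mu>\<bar> / real n) + 3 * K\<^sup>2 * (1 / real n)"
    by (simp add: add_divide_distrib distrib_left)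
  ultimately show ?thesis
    using 1 2 3 unfolding y_def[symmetric] a_def[symmetric] z_def[symmetric] by linarith
qed

text \<open>The cross term vanishes because \<open>inc\<close> has mean zero.\<close>

lemma dev_step:
  "expect M (\<lambda>E. (wt (m - 1) * real (undisc U E) - \<mu>)\<^sup>2)
    \<le> (wt m * real u - \<mu>)\<^sup>2 + mom"
proof -
  define b where "b = wt m * real u - \<mu>"
  have "expect M (\<lambda>E. (wt (m - 1) * real (undisc U E) - \<mu>)\<^sup>2) =
    expect M (\<lambda>E. (inc E)\<^sup>2 + (2 * b) * inc E + b\<^sup>2)"
    by (intro expectation_cong_pmf) (simp add: inc_def b_def power2_eq_square algebra_simps)
  also have "\<dots> = expect M (\<lambda>E. (inc E)\<^sup>2) + b\<^sup>2"
    by (simp add: expectation_add_finite inc_mean)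
  finally show ?thesis using inc_moment2 by (simp add: b_def)
qed

end

context sparse_regime
begin

text \<open>By \<open>dev_step\<close> the squared deviation gains at most \<open>mom\<close> in
  mean per step, so it becomes a supermartingale when \<open>mom\<close> is added for each vertex
  not yet exposed.\<close>

lemma second_moment:
  assumes "finite V" "card V \<le> n" "U \<subseteq> V"
  shows "expect (leftover (Suc k) p V U) (\<lambda>S. (wt S * real S - \<mu>)\<^sup>2)
    \<le> (wt (card V) * real (card U) - \<mu>)\<^sup>2 + mom * real n"
proof -
  let ?\<Psi> = "\<lambda>m u. (wt m * real u - \<mu>)\<^sup>2 + mom * real m"
  have "expect (leftover (Suc k) p V U) (\<lambda>S. (wt S * real S - \<mu>)\<^sup>2) \<le>
    expect (leftover (Suc k) p V U) (\<lambda>S. ?\<Psi> S S)"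
    using assms mom_ge by (intro expectation_mono_finite) auto
  also have "\<dots> \<le> ?\<Psi> (card V) (card U)"
  proof (rule leftover_supermartingale[OF _ assms])
    fix V U :: "'a set" and v
    assume A: "finite V" "card V \<le> n" "U \<subseteq> V" "v \<in> V" "v \<notin> U"
    interpret exploration_step k n p K V U v using A by unfold_locales
    have "real (m - 1) = real m - 1" using u_less by (simp add: of_nat_diff)
    hence "mom * real (m - 1) = mom * real m - mom" by (simp add: right_diff_distrib)
    moreover have "expect M (\<lambda>E. ?\<Psi> (m - 1) (undisc U E)) =
        expect M (\<lambda>E. (wt (m - 1) * real (undisc U E) - \<mu>)\<^sup>2) + mom * real (m - 1)"
      by (simp add: expectation_add_finite)
    ultimately show "expect M (\<lambda>E. ?\<Psi> (m - 1) (undisc U E)) \<le> ?\<Psi> m u"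
      using dev_step[of \<mu>] by linarith
  qed
  also have "\<dots> \<le> (wt (card V) * real (card U) - \<mu>)\<^sup>2 + mom * real n"
    using assms mom_ge by (intro add_left_mono mult_left_mono) auto
  finally show ?thesis .
qed

end

subsection \<open>The martingale central limit theorem\<close>

text \<open>The compensator \<open>exp x\<close> cancels the variance term \<open>1 - x\<close> of a
  characteristic function up to second order.\<close>

lemma exp_times_one_minus:
  fixes x :: real
  assumes "0 \<le> x"
  shows "\<bar>exp x * (1 - x) - 1\<bar> \<le> x\<^sup>2 * exp x"
proof -
  have "exp x * (1 - x) \<le> exp x * exp (- x)"
    using exp_ge_add_one_self[of "- x"] by (intro mult_left_mono) auto
  hence "exp x * (1 - x) \<le> 1" by (simp add: exp_add[symmetric])
  moreover have "exp x * exp (- x) \<le> exp x * (1 - x + x\<^sup>2)"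
    using exp_neg_le_quadratic[OF assms] by (intro mult_left_mono) (auto intro: order.trans)
  hence "1 \<le> exp x * (1 - x) + x\<^sup>2 * exp x" by (simp add: exp_add[symmetric] algebra_simps)
  ultimately show ?thesis by (simp add: abs_le_iff)
qed

lemma iexp_quadratic: "cmod (iexp x - (1 + \<i> * x - x\<^sup>2 / 2)) \<le> \<bar>x\<bar> ^ 3 / 6"
  using iexp_approx1[of x 2] by (simp add: eval_nat_numeral field_simps power2_eq_square)

context exploration_step
begin

lemma char_inc:
  "cmod (expect M (\<lambda>E. iexp (\<tau> * inc E)) -
      (1 - \<tau>\<^sup>2 * expect M (\<lambda>E. (inc E)\<^sup>2) / 2)) \<le> \<bar>\<tau>\<bar> ^ 3 * mom / 6"
proof -
  let ?a = "\<lambda>E. 1 + \<i> * (\<tau> * inc E) - (\<tau> * inc E)\<^sup>2 / 2"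
  have "expect M ?a = 1 + \<i> * (\<tau> * complex_of_real (expect M inc)) -
      \<tau>\<^sup>2 / 2 * complex_of_real (expect M (\<lambda>E. (inc E)\<^sup>2))"
    unfolding integral_complex_of_real[symmetric]
    by (simp add: expectation_diff_finite expectation_add_finite power_mult_distrib
        del: integral_complex_of_real of_real_power)
  hence a: "expect M ?a =
      1 - \<tau>\<^sup>2 * expect M (\<lambda>E. (inc E)\<^sup>2) / 2"
    by (simp add: inc_mean)
  have "cmod (expect M (\<lambda>E. iexp (\<tau> * inc E)) - expect M ?a) =
      cmod (expect M (\<lambda>E. iexp (\<tau> * inc E) - ?a E))"
    by (simp add: expectation_diff_finite)
  also have "\<dots> \<le> expect M (\<lambda>E. cmod (iexp (\<tau> * inc E) - ?a E))"
    by (rule norm_expectation_le)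
  also have "\<dots> \<le> expect M (\<lambda>E. \<bar>\<tau>\<bar> ^ 3 / 6 * \<bar>inc E\<bar> ^ 3)"
  proof (rule expectation_mono_finite)
    fix E
    show "cmod (iexp (\<tau> * inc E) - ?a E) \<le> \<bar>\<tau>\<bar> ^ 3 / 6 * \<bar>inc E\<bar> ^ 3"
      using iexp_quadratic[of "\<tau> * inc E"] by (simp add: abs_mult power_mult_distrib)
  qed simp
  also have "\<dots> = \<bar>\<tau>\<bar> ^ 3 / 6 * expect M (\<lambda>E. \<bar>inc E\<bar> ^ 3)" by simp
  also have "\<dots> \<le> \<bar>\<tau>\<bar> ^ 3 / 6 * mom" using inc_moment3 by (intro mult_left_mono) auto
  finally show ?thesis unfolding a by simp
qed

lemma char_step:
  fixes \<tau> \<mu> \<Theta> :: real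
  assumes mu: "0 \<le> \<mu>" "\<mu> \<le> real n" and \<Theta>: "1 \<le> \<Theta>" "\<tau>\<^sup>2 * real n \<le> \<Theta>"
  defines "w \<equiv> \<mu> * (wt (m - 1) - wt m) + \<mu>\<^sup>2 * (codeg m - codeg (m - 1))"
  shows "cmod (exp (complex_of_real (\<tau>\<^sup>2 * w / 2)) *
      expect M (\<lambda>E. iexp (\<tau> * inc E)) - 1)
    \<le> exp (\<Theta> * K) * \<Theta>\<^sup>2 * (mom + 4 * K\<^sup>2) *
        (1 / sqrt (real n) ^ 3 + (wt m * real u - \<mu>)\<^sup>2 / sqrt (real n) ^ 5)"
proof -
  define r where "r = sqrt (real n)"
  define s where "s = \<tau>\<^sup>2"
  define \<sigma> where "\<sigma> = expect M (\<lambda>E. (inc E)\<^sup>2)"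
  define D where "D = (wt m * real u - \<mu>)\<^sup>2"
  define F where "F = expect M (\<lambda>E. iexp (\<tau> * inc E))"
  have nn: "1 \<le> real n" using n_pos by simp
  have r1: "1 \<le> r" and rn: "r\<^sup>2 = real n" using nn by (auto simp: r_def)
  have r0: "0 < r" using r1 by linarith
  have s0: "0 \<le> s" by (simp add: s_def)
  have sn: "s \<le> \<Theta> / r\<^sup>2" using \<Theta> nn unfolding s_def rn by (simp add: field_simps)
  have "\<mu>\<^sup>2 * (codeg m - codeg (m - 1)) \<le> (real n)\<^sup>2 * (K / (real n)\<^sup>2)"
    using mu codeg_diff_le'[OF V(2)] codeg_mono[of "m - 1" m] by (intro mult_mono power_mono) auto
  moreover have "\<mu> * (wt (m - 1) - wt m) \<le> real n * (K / real n)"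
    using mu wt_diff_le wt_antimono[of "m - 1" m] by (intro mult_mono) auto
  ultimately have w2: "w \<le> 2 * K" using n_pos by (simp add: w_def)
  have w0: "0 \<le> w"
    using mu wt_antimono[of "m - 1" m] codeg_mono[of "m - 1" m] by (simp add: w_def)
  define x where "x = s * w / 2"
  have x0: "0 \<le> x" using s0 w0 by (simp add: x_def)
  have xs: "x \<le> s * K" using w2 s0 mult_left_mono[of w "2 * K" s] by (simp add: x_def)
  have rr: "1 \<le> r\<^sup>2" using r1 by simp
  have "s \<le> \<Theta>"
  proof -
    have "\<Theta> / r\<^sup>2 \<le> \<Theta> / 1" using \<Theta> rr by (intro divide_left_mono) auto
    thus ?thesis using sn by simp
  qed
  hence "s * K \<le> \<Theta> * K" using K1 by (intro mult_right_mono) auto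
  hence xT: "exp x \<le> exp (\<Theta> * K)" using xs by (subst exp_le_cancel_iff) linarith
  have Fb: "cmod (F - (1 - s * \<sigma> / 2)) \<le> \<bar>\<tau>\<bar> ^ 3 * mom / 6"
    using char_inc[of \<tau>] by (simp add: F_def s_def \<sigma>_def)
  have dec: "exp (complex_of_real x) * F - 1 = exp (complex_of_real x) * (F - (1 - s * \<sigma> / 2)) +
      complex_of_real (exp x * (s * (w - \<sigma>) / 2)) + complex_of_real (exp x * (1 - x) - 1)"
    by (simp add: x_def exp_of_real[symmetric] algebra_simps diff_divide_distrib)
  have "cmod (exp (complex_of_real x) * F - 1) \<le>
     cmod (exp (complex_of_real x) * (F - (1 - s * \<sigma> / 2))) +
     cmod (complex_of_real (exp x * (s * (w - \<sigma>) / 2))) + cmod (complex_of_real (exp x * (1 - x) - 1))"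
    unfolding dec by (intro norm_triangle_le order.refl add_right_mono norm_triangle_ineq)
  also have "cmod (exp (complex_of_real x) * (F - (1 - s * \<sigma> / 2))) \<le> exp x * (\<bar>\<tau>\<bar> ^ 3 * mom / 6)"
    using Fb by (simp add: norm_mult exp_of_real)
  also have "cmod (complex_of_real (exp x * (s * (w - \<sigma>) / 2))) = exp x * (s * \<bar>\<sigma> - w\<bar> / 2)"
    using s0 unfolding norm_of_real by (simp add: abs_mult abs_minus_commute)
  also have "cmod (complex_of_real (exp x * (1 - x) - 1)) \<le> exp x * x\<^sup>2"
    unfolding norm_of_real using exp_times_one_minus[OF x0] by (simp add: mult.commute)
  finally have main: "cmod (exp (complex_of_real x) * F - 1) \<le>
      exp x * (\<bar>\<tau>\<bar> ^ 3 * mom / 6 + s * \<bar>\<sigma> - w\<bar> / 2 + x\<^sup>2)"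
    by (simp add: distrib_left)
  have t3: "\<bar>\<tau>\<bar> ^ 3 \<le> \<Theta>\<^sup>2 / r ^ 3"
  proof -
    have "\<bar>\<tau>\<bar> * r = sqrt (s * real n)" by (simp add: s_def r_def real_sqrt_mult)
    also have "\<dots> \<le> sqrt \<Theta>" using \<Theta> by (simp add: s_def)
    finally have "(\<bar>\<tau>\<bar> * r) ^ 3 \<le> sqrt \<Theta> ^ 3" using r0 by (intro power_mono) auto
    also have "\<dots> \<le> sqrt \<Theta> ^ 4" using \<Theta> by (intro power_increasing) auto
    also have "\<dots> = \<Theta>\<^sup>2" using \<Theta> power_mult[of "sqrt \<Theta>" 2 2] by simp
    finally show ?thesis using r0 by (simp add: power_mult_distrib field_simps)
  qed
  have A1: "\<bar>\<tau>\<bar> ^ 3 * mom / 6 \<le> \<Theta>\<^sup>2 * mom * (1 / r ^ 3)"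
  proof -
    have "\<bar>\<tau>\<bar> ^ 3 * mom / 6 \<le> \<bar>\<tau>\<bar> ^ 3 * mom" using mom_ge by simp
    also have "\<dots> \<le> \<Theta>\<^sup>2 / r ^ 3 * mom" using t3 mom_ge by (intro mult_right_mono) auto
    finally show ?thesis by (simp add: mult.commute)
  qed
  have A2: "x\<^sup>2 \<le> \<Theta>\<^sup>2 * K\<^sup>2 * (1 / r ^ 3)"
  proof -
    have "x\<^sup>2 \<le> (\<Theta> / r\<^sup>2 * K)\<^sup>2"
      using xs x0 sn K1 mult_right_mono[OF sn, of K] by (intro power_mono) auto
    also have "\<dots> = \<Theta>\<^sup>2 * K\<^sup>2 * (1 / r ^ 4)" by (simp add: power_mult_distrib power_divide power_mult[symmetric])
    also have "\<dots> \<le> \<Theta>\<^sup>2 * K\<^sup>2 * (1 / r ^ 3)"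
      using r1 by (intro mult_left_mono divide_left_mono power_increasing) auto
    finally show ?thesis .
  qed
  have A3: "s * \<bar>\<sigma> - w\<bar> / 2 \<le> \<Theta>\<^sup>2 * (3 * K\<^sup>2) * (1 / r ^ 3 + D / r ^ 5)"
  proof -
    let ?b = "\<bar>wt m * real u - \<mu>\<bar>"
    have b2: "?b\<^sup>2 = D" by (simp add: D_def)
    \<comment> \<open>\<open>inc_var\<close> is linear in the distance \<open>?b\<close>, while only
      its square \<open>D\<close> is controlled in mean. The arithmetic-geometric mean inequality
      trades \<open>?b\<close> for \<open>r + D / r\<close>.\<close>
    have "2 * (r * ?b) \<le> r\<^sup>2 + ?b\<^sup>2"
      using sum_squares_bound[of r ?b] by (simp add: mult.assoc)
    hence "r * ?b \<le> r\<^sup>2 + D" using b2 r0 by (smt (verit) zero_le_power2 mult_nonneg_nonneg abs_ge_zero)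
    hence b1: "?b \<le> (r\<^sup>2 + D) / r" using r0 by (simp add: field_simps)
    define e where "e = D / r"
    have "0 \<le> e" using r0 by (simp add: D_def e_def)
    moreover have "?b \<le> r + e"
      using b1 r0 by (simp add: e_def add_divide_distrib power2_eq_square)
    ultimately have "?b + 1 \<le> 2 * (r + e)" using r1 by argo
    hence b: "?b + 1 \<le> 2 * (r + D / r)" by (simp add: e_def)
    have "\<bar>\<sigma> - w\<bar> \<le> 3 * K\<^sup>2 * ((?b + 1) / real n)"
      using inc_var[OF mu] by (simp add: \<sigma>_def w_def)
    also have "\<dots> \<le> 3 * K\<^sup>2 * ((2 * (r + D / r)) / real n)"
      using b by (intro mult_left_mono divide_right_mono) auto
    finally have "s * \<bar>\<sigma> - w\<bar> \<le> \<Theta> / r\<^sup>2 * (3 * K\<^sup>2 * ((2 * (r + D / r)) / real n))"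
      using sn s0 \<Theta> by (intro mult_mono) auto
    also have "\<dots> = \<Theta> * (3 * K\<^sup>2) * (2 * (1 / r ^ 3 + D / r ^ 5))"
      unfolding rn[symmetric] using r0 by (simp add: field_simps eval_nat_numeral)
    also have "\<dots> \<le> \<Theta>\<^sup>2 * (3 * K\<^sup>2) * (2 * (1 / r ^ 3 + D / r ^ 5))"
    proof (intro mult_right_mono)
      show "\<Theta> \<le> \<Theta>\<^sup>2" using \<Theta> by (simp add: power2_eq_square)
      show "0 \<le> 2 * (1 / r ^ 3 + D / r ^ 5)" using r0 b2[symmetric] by simp
    qed simp
    finally have "s * \<bar>\<sigma> - w\<bar> \<le> \<Theta>\<^sup>2 * (3 * K\<^sup>2) * (2 * (1 / r ^ 3 + D / r ^ 5))" .
    hence "s * \<bar>\<sigma> - w\<bar> \<le> 2 * (\<Theta>\<^sup>2 * (3 * K\<^sup>2) * (1 / r ^ 3 + D / r ^ 5))"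
      by (simp only: mult.left_commute[of _ 2])
    thus ?thesis by simp
  qed
  have "0 \<le> D / r ^ 5" using r0 by (simp add: D_def)
  hence A4: "\<Theta>\<^sup>2 * (mom + K\<^sup>2) * (1 / r ^ 3) \<le> \<Theta>\<^sup>2 * (mom + K\<^sup>2) * (1 / r ^ 3 + D / r ^ 5)"
    using mom_ge by (intro mult_left_mono) auto
  have A5: "\<Theta>\<^sup>2 * (mom + 4 * K\<^sup>2) * P =
      \<Theta>\<^sup>2 * (mom + K\<^sup>2) * P + \<Theta>\<^sup>2 * (3 * K\<^sup>2) * P" for P
    by (simp add: algebra_simps)
  have A6: "\<Theta>\<^sup>2 * (mom + K\<^sup>2) * P = \<Theta>\<^sup>2 * mom * P + \<Theta>\<^sup>2 * K\<^sup>2 * P" for P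
    by (simp add: algebra_simps)
  have "\<bar>\<tau>\<bar> ^ 3 * mom / 6 + s * \<bar>\<sigma> - w\<bar> / 2 + x\<^sup>2 \<le> \<Theta>\<^sup>2 * (mom + 4 * K\<^sup>2) * (1 / r ^ 3 + D / r ^ 5)"
    using A1 A2 A3 A4 A5[of "1 / r ^ 3 + D / r ^ 5"] A6[of "1 / r ^ 3"] by linarith
  moreover have "0 \<le> \<Theta>\<^sup>2 * (mom + 4 * K\<^sup>2) * (1 / r ^ 3 + D / r ^ 5)"
    using mom_ge r0 by (simp add: D_def)
  ultimately have "exp x * (\<bar>\<tau>\<bar> ^ 3 * mom / 6 + s * \<bar>\<sigma> - w\<bar> / 2 + x\<^sup>2) \<le>
      exp (\<Theta> * K) * (\<Theta>\<^sup>2 * (mom + 4 * K\<^sup>2) * (1 / r ^ 3 + D / r ^ 5))"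
    using xT by (intro order.trans[OF mult_left_mono mult_right_mono]) auto
  with main show ?thesis
    unfolding x_def s_def F_def r_def D_def by (simp add: mult.assoc)
qed

end

section \<open>Accumulated variance and the compensated characteristic function\<close>

context sparse_regime
begin

text \<open>By \<open>inc_var\<close> the conditional variance of a step is close to its value on the deterministic trajectory
  \<open>wt m * u = \<mu>\<close>, and those values telescope to \<open>qvar\<close>.\<close>

definition qvar :: "real \<Rightarrow> nat \<Rightarrow> real" where
  "qvar \<mu> m = \<mu> * (wt m - wt n) + \<mu>\<^sup>2 * (codeg n - codeg m)"

lemma qvar_bounds:
  assumes "0 \<le> \<mu>" "\<mu> \<le> real n" "m \<le> n"
  shows "0 \<le> qvar \<mu> m" "qvar \<mu> m \<le> 2 * K * real n"
proof -
  show "0 \<le> qvar \<mu> m"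
    using assms wt_antimono[of m n] codeg_mono[of m n] by (simp add: qvar_def)
  have "\<mu>\<^sup>2 * (codeg n - codeg m) \<le> (real n)\<^sup>2 * (K / real n)"
    using assms codeg_le'[of n] codeg_nonneg[of m] codeg_mono[of m n] by (intro mult_mono power_mono) auto
  moreover have "\<mu> * (wt m - wt n) \<le> real n * 1"
    using assms wt_le_1[of m] wt_nonneg[of n] wt_antimono[of m n] by (intro mult_mono) auto
  moreover have "real n \<le> K * real n" using K1 mult_right_mono[of 1 K "real n"] by simp
  moreover have "(real n)\<^sup>2 * (K / real n) = K * real n" using n_pos by (simp add: power2_eq_square)
  ultimately show "qvar \<mu> m \<le> 2 * K * real n" unfolding qvar_def by linarith
qed

text \<open>The constant of \<open>char_step\<close> times another
  \<open>exp (\<Theta> * K)\<close>, which bounds the compensator. The factor \<open>1 + mom\<close>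
  comes from summing over \<open>n\<close> steps, along which the mean of the squared deviation
  stays below \<open>mom * n\<close>.\<close>

definition clt_const :: "real \<Rightarrow> real" where
  "clt_const \<Theta> = exp (2 * \<Theta> * K) * \<Theta>\<^sup>2 * (mom + 4 * K\<^sup>2) * (1 + mom)"

text \<open>The compensator stays inside the expectation because the accumulated variance depends on
  the random final state. Each step multiplies the compensated exponential by a factor whose mean is
  \<open>1\<close> up to the error of \<open>char_step\<close>; \<open>n\<close> errors of order
  \<open>n\<close> to the power \<open>-3/2\<close> leave the order
  \<open>1 / sqrt n\<close>.\<close>

lemma char_leftover:
  fixes \<tau> \<Theta> :: real and V :: "'a set"
  assumes V: "finite V" "card V = n" "U \<subseteq> V"
    and \<Theta>: "1 \<le> \<Theta>" "\<tau>\<^sup>2 * real n \<le> \<Theta>"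
  defines "\<mu> \<equiv> wt n * real (card U)"
  shows "cmod (expect (leftover (Suc k) p V U) (\<lambda>S.
      exp (complex_of_real (\<tau>\<^sup>2 * qvar \<mu> S / 2)) * iexp (\<tau> * (wt S * real S - \<mu>))) - 1)
    \<le> clt_const \<Theta> / sqrt (real n)"
proof -
  define r where "r = sqrt (real n)"
  define Z where "Z = exp (2 * \<Theta> * K) * \<Theta>\<^sup>2 * (mom + 4 * K\<^sup>2)"
  define D where "D m u = (wt m * real u - \<mu>)\<^sup>2" for m u :: nat
  define \<Xi> where "\<Xi> m u = exp (complex_of_real (\<tau>\<^sup>2 * qvar \<mu> m / 2)) *
      iexp (\<tau> * (wt m * real u - \<mu>))" for m u :: nat
  \<comment> \<open>A step errs by \<open>Z (1 / r^3 + D / r^5)\<close>, and the mean of \<open>D\<close> grows by at most \<open>mom\<close> per step.\<close>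
  define \<Gamma> where "\<Gamma> m u = Z * (real m / r ^ 3 + real m / r ^ 5 * (D m u + mom * real m))" for m u :: nat
  have nn: "1 \<le> real n" using n_pos by simp
  have r0: "0 < r" and rn: "r\<^sup>2 = real n" using nn by (auto simp: r_def)
  have Z0: "0 \<le> Z" using mom_ge by (simp add: Z_def)
  have D0: "0 \<le> D m u" for m u by (simp add: D_def)
  have mu: "0 \<le> \<mu>" "\<mu> \<le> real n"
    using wt_nonneg wt_le_1[of n] V card_mono[of V U] mult_mono[of "wt n" 1 "real (card U)" "real n"]
    by (auto simp: \<mu>_def)
  have "cmod (expect (leftover (Suc k) p V U) (\<lambda>S. \<Xi> S S) - \<Xi> (card V) (card U))
      \<le> \<Gamma> (card V) (card U)"
  proof (rule leftover_approx_martingale[where n = n])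
    fix m u show "0 \<le> \<Gamma> m u" using Z0 r0 D0 mom_ge by (simp add: \<Gamma>_def)
  next
    fix V U :: "'a set" and v
    assume A: "finite V" "card V \<le> n" "U \<subseteq> V" "v \<in> V" "v \<notin> U"
    interpret exploration_step k n p K V U v using A by unfold_locales
    define w where "w = \<mu> * (wt (m - 1) - wt m) + \<mu>\<^sup>2 * (codeg m - codeg (m - 1))"
    have qv: "qvar \<mu> (m - 1) = qvar \<mu> m + w" by (simp add: qvar_def w_def algebra_simps)
    have "\<Xi> (m - 1) (undisc U E) = \<Xi> m u * (exp (complex_of_real (\<tau>\<^sup>2 * w / 2)) * iexp (\<tau> * inc E))" for E
      unfolding \<Xi>_def qv inc_def by (simp add: exp_add[symmetric] algebra_simps add_divide_distrib)
    hence "expect M (\<lambda>E. \<Xi> (m - 1) (undisc U E)) - \<Xi> m u =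
        \<Xi> m u * (exp (complex_of_real (\<tau>\<^sup>2 * w / 2)) * expect M (\<lambda>E. iexp (\<tau> * inc E)) - 1)"
      by (simp add: right_diff_distrib)
    hence eq: "cmod (expect M (\<lambda>E. \<Xi> (m - 1) (undisc U E)) - \<Xi> m u) =
        cmod (\<Xi> m u) * cmod (exp (complex_of_real (\<tau>\<^sup>2 * w / 2)) *
          expect M (\<lambda>E. iexp (\<tau> * inc E)) - 1)"
      by (simp only: norm_mult)
    have "cmod (\<Xi> m u) = exp (\<tau>\<^sup>2 * qvar \<mu> m / 2)"
      by (simp add: \<Xi>_def norm_mult exp_of_real)
    also have "\<dots> \<le> exp (\<Theta> * K)"
    proof -
      have "\<tau>\<^sup>2 * qvar \<mu> m \<le> \<tau>\<^sup>2 * (2 * K * real n)"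
        using qvar_bounds[OF mu A(2)] by (intro mult_left_mono) auto
      also have "\<dots> = (\<tau>\<^sup>2 * real n) * (2 * K)" by simp
      also have "\<dots> \<le> \<Theta> * (2 * K)" using \<Theta> K1 by (intro mult_right_mono) auto
      finally show ?thesis by simp
    qed
    finally have \<Xi>_le: "cmod (\<Xi> m u) \<le> exp (\<Theta> * K)" .
    have step_le: "cmod (exp (complex_of_real (\<tau>\<^sup>2 * w / 2)) *
          expect M (\<lambda>E. iexp (\<tau> * inc E)) - 1) \<le>
        exp (\<Theta> * K) * \<Theta>\<^sup>2 * (mom + 4 * K\<^sup>2) * (1 / r ^ 3 + D m u / r ^ 5)"
      using char_step[OF mu \<Theta>] unfolding w_def r_def D_def .
    have "exp (\<Theta> * K) * (exp (\<Theta> * K) * \<Theta>\<^sup>2 * (mom + 4 * K\<^sup>2) * (1 / r ^ 3 + D m u / r ^ 5)) =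
        Z * (1 / r ^ 3 + D m u / r ^ 5)"
      by (simp add: Z_def exp_add[symmetric] mult_ac mult_exp_exp)
    with mult_mono[OF \<Xi>_le step_le]
    have err: "cmod (expect M (\<lambda>E. \<Xi> (m - 1) (undisc U E)) - \<Xi> m u)
        \<le> Z * (1 / r ^ 3 + D m u / r ^ 5)"
      unfolding eq by (metis exp_ge_zero norm_ge_zero)
    have m1: "real (m - 1) = real m - 1" using u_less by (simp add: of_nat_diff)
    have "expect M (\<lambda>E. \<Gamma> (m - 1) (undisc U E)) =
        Z * (real (m - 1) / r ^ 3 + real (m - 1) / r ^ 5 *
          (expect M (\<lambda>E. D (m - 1) (undisc U E)) + mom * real (m - 1)))"
      by (simp add: \<Gamma>_def expectation_add_finite)
    also have "\<dots> \<le> Z * (real (m - 1) / r ^ 3 + real (m - 1) / r ^ 5 * (D m u + mom * real m))"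
    proof -
      have "expect M (\<lambda>E. D (m - 1) (undisc U E)) + mom * real (m - 1) \<le> D m u + mom * real m"
        using dev_step[of \<mu>] unfolding D_def m1 by (simp add: right_diff_distrib)
      thus ?thesis using Z0 r0 by (intro mult_left_mono add_left_mono) auto
    qed
    \<comment> \<open>The drop from \<open>m\<close> to \<open>m - 1\<close> in the two prefactors
      releases the amount that pays for the current step.\<close>
    also have "\<dots> = \<Gamma> m u - Z * (1 / r ^ 3 + (D m u + mom * real m) / r ^ 5)"
      unfolding m1 \<Gamma>_def using r0 by (simp add: field_simps)
    also have "\<dots> \<le> \<Gamma> m u - Z * (1 / r ^ 3 + D m u / r ^ 5)"
      using Z0 r0 mom_ge by (intro diff_left_mono mult_left_mono add_left_mono divide_right_mono) auto
    finally show "norm (expect M (\<lambda>E. \<Xi> (card V - 1) (undisc U E)) - \<Xi> (card V) (card U)) +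
        expect M (\<lambda>E. \<Gamma> (card V - 1) (undisc U E)) \<le> \<Gamma> (card V) (card U)"
      using err by linarith
  qed (use V in auto)
  moreover have "\<Xi> (card V) (card U) = 1"
    using V(2) by (simp add: \<Xi>_def qvar_def \<mu>_def)
  moreover have "\<Gamma> (card V) (card U) = clt_const \<Theta> / r"
  proof -
    have "D n (card U) = 0" by (simp add: D_def \<mu>_def)
    thus ?thesis unfolding \<Gamma>_def V(2) clt_const_def Z_def[symmetric] rn[symmetric]
      using r0 by (simp add: field_simps eval_nat_numeral)
  qed
  ultimately show ?thesis by (simp add: \<Xi>_def r_def)
qed

end

subsection \<open>Asymptotics of the parameters\<close>

text \<open>Truncated subtraction is harmless: for \<open>N \<le> j\<close> both sides
  vanish.\<close>

lemma choose_Suc_absorb: "real (N choose Suc j) * real (Suc j) = real (N choose j) * real (N - j)"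
proof -
  have "Suc j * (N choose Suc j) = (N - j) * (N choose j)"
  proof (cases N)
    case (Suc N')
    thus ?thesis using Suc_times_binomial[of j N'] binomial_absorb_comp[of N j] by simp
  qed simp
  hence "real (Suc j * (N choose Suc j)) = real ((N - j) * (N choose j))" by (rule arg_cong)
  thus ?thesis by (simp only: of_nat_mult mult.commute)
qed

lemma factor_ratio:
  fixes S n a :: nat
  assumes "S \<le> n" "a < n"
  shows "\<bar>real (S - a) / real (n - a) - real S / real n\<bar> \<le> real a / real n"
proof (cases "a \<le> S")
  case True
  let ?t = "(real n - real S) / (real n - real a)"
  have n: "0 < real n" "0 < real n - real a" using assms by auto
  have eq: "real S / real n - real (S - a) / real (n - a) = real a / real n * ?t"
    using True assms n by (simp add: of_nat_diff field_simps)
  have t: "0 \<le> ?t" "?t \<le> 1" using True assms n by (auto simp: field_simps)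
  have "\<bar>real S / real n - real (S - a) / real (n - a)\<bar> = real a / real n * ?t"
    unfolding eq using t by (intro abs_of_nonneg mult_nonneg_nonneg) auto
  also have "\<dots> \<le> real a / real n * 1" using t by (intro mult_left_mono) auto
  finally show ?thesis by (simp only: abs_minus_commute mult_1_right)
next
  case False
  hence "real S / real n \<le> real a / real n" by (intro divide_right_mono) auto
  with False show ?thesis by simp
qed

text \<open>The quotient is a product of \<open>j\<close> factors
  \<open>(S - (h + i)) / (n - (h + i))\<close>, each at most one and within
  \<open>(h + i) / n\<close> of \<open>S / n\<close>, so the errors add up. The offset
  \<open>h\<close> will be \<open>1\<close> for degrees and \<open>2\<close> for codegrees.\<close>

lemma choose_ratio:
  fixes S n h j :: nat
  assumes "S \<le> n" "h + j \<le> n"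
  shows "\<bar>real ((S - h) choose j) / real ((n - h) choose j) - (real S / real n) ^ j\<bar>
    \<le> real (j * (h + j)) / real n"
  using assms(2)
proof (induction j)
  case (Suc j)
  let ?r = "real ((S - h) choose j) / real ((n - h) choose j)"
  let ?f = "real (S - (h + j)) / real (n - (h + j))"
  let ?x = "real S / real n"
  have n: "0 < real n" using Suc by simp
  have x: "0 \<le> ?x" "?x \<le> 1" using assms n by auto
  have r: "0 \<le> ?r" "?r \<le> 1"
    using assms Suc.prems by (auto intro!: divide_le_eq_1[THEN iffD2] binomial_right_mono)
  have "real ((n - h) choose Suc j) * real (Suc j) \<noteq> 0" using Suc.prems by simp
  hence "real ((S - h) choose Suc j) / real ((n - h) choose Suc j) =
      (real ((S - h) choose Suc j) * real (Suc j)) / (real ((n - h) choose Suc j) * real (Suc j))"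
    by (intro mult_divide_mult_cancel_right[symmetric]) simp
  also have "\<dots> = ?r * ?f" unfolding choose_Suc_absorb by simp
  finally have eq: "real ((S - h) choose Suc j) / real ((n - h) choose Suc j) = ?r * ?f" .
  have "?r * ?f - ?x ^ Suc j = ?r * (?f - ?x) + (?r - ?x ^ j) * ?x" by (simp add: algebra_simps)
  hence "\<bar>?r * ?f - ?x ^ Suc j\<bar> \<le> \<bar>?r * (?f - ?x)\<bar> + \<bar>(?r - ?x ^ j) * ?x\<bar>"
    by (simp only: abs_triangle_ineq)
  also have "\<dots> = ?r * \<bar>?f - ?x\<bar> + \<bar>?r - ?x ^ j\<bar> * ?x" using r x by (simp only: abs_mult abs_of_nonneg)
  also have "\<dots> \<le> 1 * (real (h + j) / real n) + real (j * (h + j)) / real n * 1"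
    using r x factor_ratio[OF assms(1), of "h + j"] Suc
    by (intro add_mono mult_mono) auto
  also have "\<dots> = real (Suc j * (h + j)) / real n" by (simp add: add_divide_distrib distrib_right)
  also have "\<dots> \<le> real (Suc j * (h + Suc j)) / real n"
    by (intro divide_right_mono of_nat_mono mult_le_mono) auto
  finally show ?case unfolding eq .
qed simp

lemma exp_neg_lipschitz:
  fixes a b :: real
  assumes "0 \<le> a" "0 \<le> b"
  shows "\<bar>exp (- a) - exp (- b)\<bar> \<le> \<bar>a - b\<bar>"
proof -
  have *: "exp (- a) - exp (- b) \<le> b - a" if "0 \<le> a" "a \<le> b" for a b :: real
  proof -
    have "exp (- a) - exp (- b) = exp (- a) * (1 - exp (- (b - a)))"
      by (simp add: right_diff_distrib exp_add[symmetric])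
    also have "\<dots> \<le> 1 * (b - a)"
    proof (intro mult_mono)
      show "1 - exp (- (b - a)) \<le> b - a" using exp_ge_add_one_self[of "- (b - a)"] by linarith
    qed (use that in auto)
    finally show ?thesis by simp
  qed
  show ?thesis using *[of a b] *[of b a] assms by (cases "a \<le> b") auto
qed

text \<open>\<open>K\<close> collects all constants: \<open>1 + c\<^sub>2\<close> serves
  \<open>1 \<le> K\<close> and the degree bound, \<open>c\<^sub>2\<^sup>2\<close> the error of
  writing \<open>exp (- p)\<close> for \<open>1 - p\<close>, and the cubic term the codegrees and
  the binomial quotients.\<close>

lemma sparse_regime_asymptotics:
  fixes k :: nat and c\<^sub>2 :: real
  assumes k: "1 \<le> k" and c2: "0 \<le> c\<^sub>2"
  defines "K \<equiv> 1 + c\<^sub>2 + c\<^sub>2\<^sup>2 + 4 * c\<^sub>2 * real (k + 1) ^ 3"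
  assumes n: "K \<le> real n" "k + 3 \<le> n"
    and p: "0 \<le> p" "p \<le> 1" and c: "c = real ((n - 1) choose k) * p" "c \<le> c\<^sub>2"
  shows "sparse_regime k n p K"
    and "S \<le> n \<Longrightarrow> \<bar>(1 - p) ^ ((S - 1) choose k) - exp (- (c * (real S / real n) ^ k))\<bar> \<le> K / real n"
    and "S \<le> n \<Longrightarrow> \<bar>real n * (p * real ((S - 2) choose (k - 1))) - c * real k * (real S / real n) ^ (k - 1)\<bar>
      \<le> K / real n"
proof -
  have c0: "0 \<le> c" using p c by simp
  have n0: "0 < real n" and n4: "4 \<le> n" using n k by auto
  let ?N = "real ((n - 1) choose k)"
  have N0: "0 < ?N" using n by simp
  have pc: "p = c / ?N" using c N0 by simp
  define a where "a = c\<^sub>2 * real (k + 1) ^ 3"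
  have a0: "0 \<le> a" using c2 by (simp add: a_def)
  have K: "K = 1 + c\<^sub>2 + c\<^sub>2\<^sup>2 + 4 * a" by (simp add: K_def a_def)
  have K_ge: "4 * a \<le> K" "1 + c\<^sub>2 \<le> K" "1 \<le> K" "c\<^sub>2\<^sup>2 + a \<le> K"
    using a0 c2 zero_le_power2[of c\<^sub>2] unfolding K by linarith+
  have kpow: "real (k + 1) \<le> real (k + 1) ^ 3" "real (k + 1) ^ 2 \<le> real (k + 1) ^ 3"
    using power_increasing[of 1 3 "real (k + 1)"] power_increasing[of 2 3 "real (k + 1)"] by auto
  have a_ge: "c\<^sub>2 * x \<le> a" if "x \<le> real (k + 1) ^ 3" for x
    unfolding a_def using that c2 by (intro mult_left_mono)
  have ck_le: "c * x \<le> c\<^sub>2 * x" if "0 \<le> x" for x using c that by (intro mult_right_mono)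
  have half: "1 / (real n - 1) \<le> 2 / real n" "1 / (real n - 2) \<le> 2 / real n"
    using n4 by (auto simp: field_simps)
  obtain k' where k': "k = Suc k'" using k by (cases k) auto
  \<comment> \<open>The absorption identity expresses the codegree by the degree, hence by
    \<open>c\<close>. Applied one level further down it also gives the increment of the codegree,
    below.\<close>
  have cod: "p * real ((n - 2) choose (k - 1)) = c * real k / (real n - 1)"
  proof -
    have "Suc k' * (Suc (n - 2) choose Suc k') = Suc (n - 2) * ((n - 2) choose k')"
      by (rule Suc_times_binomial)
    moreover have "Suc (n - 2) = n - 1" using n4 by simp
    ultimately have "k * ((n - 1) choose k) = (n - 1) * ((n - 2) choose (k - 1))" by (simp add: k')
    hence "real (k * ((n - 1) choose k)) = real ((n - 1) * ((n - 2) choose (k - 1)))" by (rule arg_cong)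
    hence "real k * ?N = (real n - 1) * real ((n - 2) choose (k - 1))" using n4 by (simp add: of_nat_diff)
    moreover have "real n - 1 \<noteq> 0" using n4 by auto
    ultimately have "real ((n - 2) choose (k - 1)) = real k * ?N / (real n - 1)" by (simp add: field_simps)
    thus ?thesis using pc N0 by simp
  qed
  have cod_le: "c * real k / (real n - 1) \<le> K / real n"
  proof -
    have "c * real k / (real n - 1) = c * real k * (1 / (real n - 1))" by simp
    also have "\<dots> \<le> c\<^sub>2 * real k * (2 / real n)"
      using half c c0 n4 by (intro mult_mono) auto
    also have "\<dots> = (2 * (c\<^sub>2 * real k)) / real n" by simp
    also have "\<dots> \<le> K / real n"
      using a_ge[of "real k"] kpow a0 K_ge by (intro divide_right_mono) auto
    finally show ?thesis .
  qed
  show "sparse_regime k n p K"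
  proof
    show "1 \<le> K" by (rule K_ge)
    show "p * ?N \<le> K" using c K_ge by (simp add: mult.commute)
    fix m assume m: "m \<le> n"
    have "p * real ((m - 2) choose (k - 1)) \<le> p * real ((n - 2) choose (k - 1))"
      using m p by (intro mult_left_mono of_nat_mono binomial_right_mono) auto
    with cod cod_le show "p * real ((m - 2) choose (k - 1)) \<le> K / real n" by linarith
    show "p * real ((m - 2) choose (k - 1)) - p * real ((m - 1 - 2) choose (k - 1)) \<le> K / (real n)\<^sup>2"
    proof (cases "3 \<le> m \<and> 2 \<le> k")
      case True
      obtain m' where "m = 3 + m'" using True le_Suc_ex by blast
      hence m': "m = Suc (Suc (Suc m'))" by simp
      obtain k'' where "k = 2 + k''" using True le_Suc_ex by blast
      hence k'': "k = Suc (Suc k'')" by simp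
      have "p * real ((m - 2) choose (k - 1)) - p * real ((m - 1 - 2) choose (k - 1)) = p * real ((m - 3) choose (k - 2))"
        by (simp add: m' k'' algebra_simps)
      also have "\<dots> \<le> p * real ((n - 3) choose (k - 2))"
        using m p by (intro mult_left_mono of_nat_mono binomial_right_mono) auto
      also have "\<dots> = c * real k / (real n - 1) * real (k - 1) / (real n - 2)"
      proof -
        have "Suc k'' * (Suc (n - 3) choose Suc k'') = Suc (n - 3) * ((n - 3) choose k'')"
          by (rule Suc_times_binomial)
        moreover have "Suc (n - 3) = n - 2" using n4 by simp
        ultimately have "(k - 1) * ((n - 2) choose (k - 1)) = (n - 2) * ((n - 3) choose (k - 2))"
          by (simp add: k'')
        hence "real ((k - 1) * ((n - 2) choose (k - 1))) = real ((n - 2) * ((n - 3) choose (k - 2)))"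
          by (rule arg_cong)
        hence "real (k - 1) * real ((n - 2) choose (k - 1)) = (real n - 2) * real ((n - 3) choose (k - 2))"
          using n4 by (simp add: of_nat_diff)
        moreover have "real n - 2 \<noteq> 0" using n4 by auto
        ultimately have "real ((n - 3) choose (k - 2)) =
            real (k - 1) * real ((n - 2) choose (k - 1)) / (real n - 2)" by (simp add: field_simps)
        hence "p * real ((n - 3) choose (k - 2)) =
            (p * real ((n - 2) choose (k - 1))) * real (k - 1) / (real n - 2)" by simp
        thus ?thesis unfolding cod .
      qed
      also have "\<dots> = (c * (real k * real (k - 1))) * ((1 / (real n - 1)) * (1 / (real n - 2)))" by simp
      also have "\<dots> \<le> (c\<^sub>2 * real (k + 1) ^ 3) * ((2 / real n) * (2 / real n))"
      proof (intro mult_mono)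
        have "real k * real (k - 1) \<le> (real (k + 1))\<^sup>2"
          unfolding power2_eq_square by (intro mult_mono) auto
        thus "real k * real (k - 1) \<le> real (k + 1) ^ 3" using kpow(2) by (rule order.trans)
      qed (use half c c0 c2 n4 in auto)
      also have "\<dots> = 4 * a / (real n)\<^sup>2" by (simp add: a_def power2_eq_square)
      also have "\<dots> \<le> K / (real n)\<^sup>2" using K_ge by (intro divide_right_mono) auto
      finally show ?thesis .
    next
      case False
      \<comment> \<open>Either \<open>k = 1\<close>, where both binomials are \<open>1\<close>, or
        \<open>m \<le> 2\<close>, where both upper entries are \<open>0\<close>.\<close>
      hence "(m - 2) choose (k - 1) = (m - 1 - 2) choose (k - 1) \<or> m - 2 = m - 1 - 2"
        using k by (auto simp: not_le)
      hence "(m - 2) choose (k - 1) = (m - 1 - 2) choose (k - 1)" by auto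
      thus ?thesis using K_ge by simp
    qed
  qed (use k p n in auto)
  show "\<bar>(1 - p) ^ ((S - 1) choose k) - exp (- (c * (real S / real n) ^ k))\<bar> \<le> K / real n" if S: "S \<le> n"
  proof -
    let ?j = "(S - 1) choose k"
    have jle: "real ?j \<le> ?N" using S by (intro of_nat_mono binomial_right_mono) auto
    have pj: "p * real ?j = c * (real ?j / ?N)" using pc by simp
    \<comment> \<open>Since \<open>1 \<le> k < n - 1\<close>, the binomial coefficient is at least
      \<open>n - 1\<close>; so \<open>p\<close> is of order \<open>1 / n\<close>, and so is
      \<open>p\<^sup>2\<close> times the exponent.\<close>
    have Nn: "real n - 1 \<le> ?N"
    proof -
      have "n - 1 \<le> (n - 1) choose k"
        using n k by (intro upper_le_binomial) auto
      hence "real (n - 1) \<le> ?N" by (rule of_nat_mono)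
      thus ?thesis using n4 by (simp add: of_nat_diff)
    qed
    have "p\<^sup>2 / 2 * real ?j \<le> p\<^sup>2 / 2 * ?N" using jle by (intro mult_left_mono) auto
    also have "\<dots> = c * p / 2" using c by (simp add: power2_eq_square)
    also have "\<dots> = c\<^sup>2 / ?N / 2" using pc by (simp add: power2_eq_square)
    also have "\<dots> \<le> c\<^sub>2\<^sup>2 / (real n - 1) / 2"
      using Nn c c0 n4 by (intro divide_right_mono frac_le power_mono) auto
    also have "\<dots> = c\<^sub>2\<^sup>2 / 2 * (1 / (real n - 1))" by simp
    also have "\<dots> \<le> c\<^sub>2\<^sup>2 / 2 * (2 / real n)" using half by (intro mult_left_mono) auto
    finally have 1: "p\<^sup>2 / 2 * real ?j \<le> c\<^sub>2\<^sup>2 / real n" by simp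
    have "\<bar>(1 - p) ^ ?j - exp (- p) ^ ?j\<bar> \<le> real ?j * \<bar>(1 - p) - exp (- p)\<bar>"
      using norm_power_diff[of "1 - p" "exp (- p)" ?j] p by simp
    also have "\<dots> \<le> real ?j * (p\<^sup>2 / 2)"
      using exp_neg_le_quadratic[OF p(1)] exp_ge_add_one_self[of "- p"]
      by (intro mult_left_mono) (simp_all add: abs_le_iff)
    also have "\<dots> \<le> c\<^sub>2\<^sup>2 / real n" using 1 by (simp only: mult.commute)
    also have "exp (- p) ^ ?j = exp (- (p * real ?j))"
      by (simp add: exp_of_nat_mult[symmetric] mult.commute)
    finally have 2: "\<bar>(1 - p) ^ ?j - exp (- (p * real ?j))\<bar> \<le> c\<^sub>2\<^sup>2 / real n" .
    have "\<bar>exp (- (p * real ?j)) - exp (- (c * (real S / real n) ^ k))\<bar> \<le>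
        \<bar>p * real ?j - c * (real S / real n) ^ k\<bar>"
      using p c0 by (intro exp_neg_lipschitz) auto
    also have "\<dots> = c * \<bar>real ?j / ?N - (real S / real n) ^ k\<bar>"
      unfolding pj right_diff_distrib[symmetric] abs_mult using c0 by simp
    also have "\<dots> \<le> c\<^sub>2 * (real (k * (1 + k)) / real n)"
      using choose_ratio[OF S, of 1 k] n c c0 by (intro mult_mono) auto
    also have "\<dots> = (c\<^sub>2 * (real k * real (k + 1))) / real n" by (simp add: algebra_simps)
    also have "\<dots> \<le> a / real n"
    proof (intro divide_right_mono a_ge)
      have "real k * real (k + 1) \<le> (real (k + 1))\<^sup>2"
        unfolding power2_eq_square by (intro mult_right_mono) auto
      thus "real k * real (k + 1) \<le> real (k + 1) ^ 3" using kpow(2) by (rule order.trans)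
    qed simp
    finally have 3: "\<bar>exp (- (p * real ?j)) - exp (- (c * (real S / real n) ^ k))\<bar> \<le> a / real n" .
    have "c\<^sub>2\<^sup>2 / real n + a / real n \<le> K / real n"
      using K_ge unfolding add_divide_distrib[symmetric] by (intro divide_right_mono) auto
    with 2 3 show ?thesis by argo
  qed
  show "\<bar>real n * (p * real ((S - 2) choose (k - 1))) - c * real k * (real S / real n) ^ (k - 1)\<bar> \<le> K / real n"
    if S: "S \<le> n"
  proof -
    let ?N2 = "real ((n - 2) choose (k - 1))" and ?j = "real ((S - 2) choose (k - 1))"
    let ?x = "(real S / real n) ^ (k - 1)"
    have N2: "0 < ?N2" using n by simp
    have jle: "?j \<le> ?N2" using S by (intro of_nat_mono binomial_right_mono) auto
    have rat: "0 \<le> ?j / ?N2" "?j / ?N2 \<le> 1" using jle N2 by auto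
    have "p * ?j = (p * ?N2) * (?j / ?N2)" using N2 by simp
    hence "real n * (p * ?j) = c * real k * (real n / (real n - 1) * (?j / ?N2))"
      unfolding cod by simp
    hence "real n * (p * ?j) - c * real k * ?x = c * real k * (real n / (real n - 1) * (?j / ?N2) - ?x)"
      by (simp only: right_diff_distrib)
    hence "\<bar>real n * (p * ?j) - c * real k * ?x\<bar> =
        \<bar>c * real k\<bar> * \<bar>real n / (real n - 1) * (?j / ?N2) - ?x\<bar>"
      by (simp only: abs_mult)
    also have "\<bar>c * real k\<bar> = c * real k" using c0 by simp
    also have "real n / (real n - 1) * (?j / ?N2) - ?x = 1 / (real n - 1) * (?j / ?N2) + (?j / ?N2 - ?x)"
    proof -
      have "real n / (real n - 1) = 1 + 1 / (real n - 1)" using n4 by (simp add: field_simps)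
      thus ?thesis by (simp only: distrib_right mult_1)
    qed
    also have "\<bar>\<dots>\<bar> \<le> 2 / real n + real ((k - 1) * (2 + (k - 1))) / real n"
    proof (rule order.trans[OF abs_triangle_ineq add_mono])
      have "1 / (real n - 1) * (?j / ?N2) \<le> 2 / real n * 1"
        using half rat n4 by (intro mult_mono) auto
      thus "\<bar>1 / (real n - 1) * (?j / ?N2)\<bar> \<le> 2 / real n" using rat n4 by simp
      show "\<bar>?j / ?N2 - ?x\<bar> \<le> real ((k - 1) * (2 + (k - 1))) / real n"
        using choose_ratio[OF S, of 2 "k - 1"] n by auto
    qed
    finally have "\<bar>real n * (p * ?j) - c * real k * ?x\<bar> \<le>
        c * real k * (2 / real n + real ((k - 1) * (2 + (k - 1))) / real n)"
      using c0 by (simp add: mult_left_mono)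
    also have "\<dots> \<le> c\<^sub>2 * real k * (2 / real n + real ((k - 1) * (2 + (k - 1))) / real n)"
      using c by (intro mult_right_mono) auto
    also have "\<dots> = (c\<^sub>2 * (real k * (2 + real k' * (real k' + 2)))) / real n"
      unfolding add_divide_distrib[symmetric] by (simp add: k' algebra_simps)
    also have "\<dots> \<le> (2 * a) / real n"
    proof (intro divide_right_mono)
      have "real k * (2 + real k' * (real k' + 2)) \<le> 2 * real (k + 1) ^ 3"
        by (simp add: k' power3_eq_cube algebra_simps)
      hence "c\<^sub>2 * (real k * (2 + real k' * (real k' + 2))) \<le> c\<^sub>2 * (2 * real (k + 1) ^ 3)"
        using c2 by (rule mult_left_mono)
      thus "c\<^sub>2 * (real k * (2 + real k' * (real k' + 2))) \<le> 2 * a"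
        by (simp only: a_def mult.left_commute[of _ 2])
    qed simp
    also have "\<dots> \<le> K / real n" using K_ge a0 by (intro divide_right_mono) auto
    finally show ?thesis .
  qed
qed

subsection \<open>The fixed point equation\<close>

text \<open>The last claim is Rolle's theorem for \<open>ln x - c * (x ^ k - 1)\<close>, which
  vanishes at \<open>\<rho>\<close> and at \<open>1\<close>: a critical point \<open>z\<close> in
  between satisfies \<open>c * k * z ^ k = 1\<close>, and \<open>\<rho> < z\<close>. It will make
  the linearisation at \<open>\<rho>\<close> nondegenerate.\<close>

lemma rho_facts:
  fixes c :: real
  assumes k: "1 \<le> k" and c: "1 < c * real k"
  defines "\<rho> \<equiv> rho (Suc k) c"
  shows "0 < \<rho>" "\<rho> < 1" "\<rho> = exp (c * (\<rho> ^ k - 1))" "c * real k * \<rho> ^ k < 1"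
proof -
  have "1 / (real (Suc k) - 1) < c" using k c by (simp add: field_simps)
  hence "\<exists>!r. 0 < r \<and> r < 1 \<and> r = exp (c * (r ^ (Suc k - 1) - 1))"
    using k by (intro rho_ex1) auto
  from theI'[OF this] have *: "0 < \<rho> \<and> \<rho> < 1 \<and> \<rho> = exp (c * (\<rho> ^ k - 1))"
    by (simp add: \<rho>_def rho_def)
  thus "0 < \<rho>" "\<rho> < 1" "\<rho> = exp (c * (\<rho> ^ k - 1))" by simp_all
  have "\<exists>z. \<rho> < z \<and> z < 1 \<and> (ln 1 - c * (1 ^ k - 1)) - (ln \<rho> - c * (\<rho> ^ k - 1)) =
      (1 - \<rho>) * (1 / z - c * (real k * z ^ (k - 1)))"
  proof (intro MVT2)
    fix x assume "\<rho> \<le> x" "x \<le> 1"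
    thus "((\<lambda>x. ln x - c * (x ^ k - 1)) has_real_derivative 1 / x - c * (real k * x ^ (k - 1))) (at x)"
      using * by (auto intro!: derivative_eq_intros simp: field_simps)
  qed (use * in auto)
  moreover have "ln \<rho> = c * (\<rho> ^ k - 1)" using * by (metis ln_exp)
  ultimately obtain z where z: "\<rho> < z" "z < 1" "(1 - \<rho>) * (1 / z - c * (real k * z ^ (k - 1))) = 0" by auto
  hence "1 / z = c * (real k * z ^ (k - 1))" using * by simp
  hence "c * real k * (z ^ (k - 1) * z) = 1" using z * by (simp add: field_simps)
  moreover have "z ^ (k - 1) * z = z ^ k" using k by (cases k) auto
  ultimately have z1: "c * real k * z ^ k = 1" by simp
  have "\<rho> ^ k < z ^ k" using z * k by (intro power_strict_mono) auto
  hence "c * real k * \<rho> ^ k < c * real k * z ^ k" using c by (intro mult_strict_left_mono) auto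
  thus "c * real k * \<rho> ^ k < 1" using z1 by simp
qed

text \<open>The logarithm of \<open>x * exp (- (c * x ^ k))\<close> is strictly concave and takes the same value at \<open>\<rho>\<close> and at
  \<open>1\<close>, so its slopes are controlled by its height above that value at one point \<open>b\<close> between the mode and
  \<open>1\<close>. Choosing \<open>b\<close> from \<open>c\<^sub>1\<close> alone makes the bounds uniform in \<open>c\<close>.\<close>

lemma supercritical_gap:
  fixes c\<^sub>1 c\<^sub>2 :: real
  assumes k: "1 \<le> k" and c1: "1 < c\<^sub>1 * real k"
  obtains \<delta> \<gamma> :: real where "0 < \<delta>" "\<delta> < 1" "0 < \<gamma>"
    and "\<And>c. c\<^sub>1 \<le> c \<Longrightarrow> c \<le> c\<^sub>2 \<Longrightarrow> rho (Suc k) c < 1 - \<delta> \<and>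
      \<gamma> \<le> 1 - c * real k * rho (Suc k) c ^ k \<and> 1 + 2 * \<gamma> \<le> c * real k * (1 - \<delta>) ^ k \<and>
      (\<forall>x. 0 \<le> x \<longrightarrow> x \<le> 1 - \<delta> \<longrightarrow>
        \<gamma> * \<bar>x - rho (Suc k) c\<bar> \<le> \<bar>x * exp (- (c * x ^ k)) - exp (- c)\<bar>)"
proof -
  \<comment> \<open>The midpoint of \<open>1 / (c\<^sub>1 * k)\<close> and \<open>1\<close>. The
    mode satisfies \<open>c * k * x ^ k = 1\<close>, so \<open>b\<close>, whose power
    \<open>b ^ k\<close> is \<open>B\<close>, lies to its right for every
    \<open>c \<ge> c\<^sub>1\<close>, with the margin \<open>e\<close>.\<close>
  define B where "B = (1 + 1 / (c\<^sub>1 * real k)) / 2"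
  define b where "b = root k B"
  define q where "q = 1 / (c\<^sub>1 * real k)"
  have "0 < q" "q < 1" using c1 by (simp_all add: q_def)
  hence B: "0 < B" "B < 1" unfolding B_def q_def[symmetric] by simp_all
  have b: "0 < b" "b < 1" "b ^ k = B" using k B by (auto simp: b_def)
  define e where "e = (c\<^sub>1 * real k - 1) / 2"
  have e0: "0 < e" using c1 by (simp add: e_def)
  have c1b: "c\<^sub>1 * real k * b ^ k = 1 + e" 
  proof -
    have "c\<^sub>1 * real k \<noteq> 0" using c1 by linarith
    hence "c\<^sub>1 * real k * q = 1" unfolding q_def times_divide_eq_right mult_1_right by (rule divide_self)
    thus ?thesis unfolding b(3) B_def e_def q_def[symmetric] by (simp add: distrib_left diff_divide_distrib)
  qed
  \<comment> \<open>A lower bound for the height at \<open>b\<close>, since the slope between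
    \<open>b\<close> and \<open>1\<close> is at most \<open>- e\<close>. The cap \<open>1\<close>
    keeps arguments in the range where \<open>1 - exp (- t) \<ge> t / 2\<close>.\<close>
  define \<kappa> where "\<kappa> = min 1 ((1 - b) * e)"
  have \<kappa>: "0 < \<kappa>" "\<kappa> \<le> 1" "\<kappa> \<le> (1 - b) * e" using b e0 by (auto simp: \<kappa>_def)
  define \<gamma> where "\<gamma> = min (e / 2) (exp (- c\<^sub>2) * \<kappa> / 2)"
  show ?thesis
  proof (rule that[of "1 - b" \<gamma>])
    show "0 < 1 - b" "1 - b < 1" "0 < \<gamma>" using b e0 \<kappa> by (auto simp: \<gamma>_def)
    fix c assume c: "c\<^sub>1 \<le> c" "c \<le> c\<^sub>2"
    define \<rho> where "\<rho> = rho (Suc k) c"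
    define g where "g x = ln x - c * (x ^ k - 1)" for x :: real
    define g' where "g' x = 1 / x - c * real k * x ^ (k - 1)" for x :: real
    have ck: "1 < c * real k" using c c1 mult_right_mono[OF c(1), of "real k"] by linarith
    have c0: "0 < c" using ck mult_nonpos_nonneg[of c "real k"] by (cases "0 < c") auto
    note \<rho> = rho_facts[OF k ck, folded \<rho>_def]
    have \<rho>_exp: "exp (- c) \<le> \<rho>"
    proof -
      have "exp (- c) \<le> exp (c * (\<rho> ^ k - 1))"
        using c0 \<rho>(1) by (simp add: algebra_simps)
      thus ?thesis using \<rho>(3) by simp
    qed
    have xk: "x ^ (k - 1) * x = x ^ k" for x :: real using k by (cases k) auto
    have deriv: "(g has_real_derivative g' x) (at x)" if "0 < x" for x
      unfolding g_def g'_def using that by (auto intro!: derivative_eq_intros simp: field_simps)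
    have mvt: "\<exists>z. x < z \<and> z < y \<and> g y - g x = (y - x) * g' z" if "0 < x" "x < y" for x y
      using that by (intro MVT2 deriv) auto
    have g'_eq: "x * g' x = 1 - c * real k * x ^ k" if "0 < x" for x
      using that xk[of x] by (simp add: g'_def right_diff_distrib mult_ac)
    have g'_anti: "g' y \<le> g' x" if "0 < x" "x \<le> y" for x y
    proof -
      have "1 / y \<le> 1 / x" using that by (intro divide_left_mono) auto
      moreover have "c * real k * x ^ (k - 1) \<le> c * real k * y ^ (k - 1)"
        using that c0 by (intro mult_left_mono power_mono) auto
      ultimately show ?thesis by (simp add: g'_def)
    qed
    have g\<rho>: "g \<rho> = 0" using \<rho>(3) unfolding g_def by (metis ln_exp right_minus_eq)
    have cb: "1 + e \<le> c * real k * b ^ k"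
      unfolding c1b[symmetric] using c b by (intro mult_right_mono) auto
    have gb: "\<kappa> \<le> g b"
    proof -
      obtain z where z: "b < z" "z < 1" "g 1 - g b = (1 - b) * g' z" using mvt[of b 1] b by auto
      have "c * real k * b ^ k \<le> c * real k * z ^ k" using z b c0 by (intro mult_left_mono power_mono) auto
      hence "z * g' z \<le> - e" using g'_eq[of z] z b cb by simp
      moreover have "z * g' z \<ge> g' z" if "g' z \<le> 0"
        using that z b mult_right_mono_neg[of z 1 "g' z"] by simp
      ultimately have "g' z \<le> - e" using e0 z b by (smt (verit) mult_nonneg_nonneg)
      hence "(1 - b) * g' z \<le> (1 - b) * (- e)" using b by (intro mult_left_mono) auto
      thus ?thesis using z(3) \<kappa> by (simp add: g_def)
    qed
    have \<rho>b: "\<rho> < b"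
    proof (rule ccontr)
      assume "\<not> \<rho> < b"
      hence "c * real k * b ^ k \<le> c * real k * \<rho> ^ k" using b c0 by (intro mult_left_mono power_mono) auto
      thus False using cb \<rho>(4) e0 by linarith
    qed
    \<comment> \<open>By concavity the slope up to \<open>\<rho>\<close> is at least the mean slope
      from \<open>\<rho>\<close> to \<open>b\<close>, and this exceeds \<open>g b\<close> because
      the interval is shorter than one.\<close>
    have slope: "\<kappa> \<le> g' x" if "0 < x" "x \<le> \<rho>" for x
    proof -
      obtain z where z: "\<rho> < z" "z < b" "g b - g \<rho> = (b - \<rho>) * g' z" using mvt[OF \<rho>(1) \<rho>b] by auto
      have "(b - \<rho>) * g' z \<le> 1 * g' z"
      proof (intro mult_right_mono)
        have "0 < (b - \<rho>) * g' z" using z(3) gb g\<rho> \<kappa> by linarith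
        thus "0 \<le> g' z" using \<rho>b by (simp add: zero_less_mult_iff)
      qed (use b \<rho> in auto)
      hence "\<kappa> \<le> g' z" using z(3) gb g\<rho> by simp
      thus ?thesis using g'_anti[of x z] that z by simp
    qed
    \<comment> \<open>Concavity again: between \<open>\<rho>\<close> and \<open>b\<close> the graph
      lies above its chord.\<close>
    have up: "\<kappa> * (x - \<rho>) \<le> g x" if x: "\<rho> < x" "x \<le> b" for x
    proof (cases "x = b")
      case True
      have "\<kappa> * (b - \<rho>) \<le> \<kappa> * 1" using \<kappa> b \<rho> by (intro mult_left_mono) auto
      thus ?thesis using gb True by simp
    next
      case False
      obtain z1 where z1: "\<rho> < z1" "z1 < x" "g x - g \<rho> = (x - \<rho>) * g' z1" using mvt[OF \<rho>(1) x(1)] by auto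
      obtain z2 where z2: "x < z2" "z2 < b" "g b - g x = (b - x) * g' z2"
        using mvt[of x b] x False \<rho> by auto
      have "(b - x) * g' z2 \<le> (b - x) * g' z1"
        using z1 z2 x \<rho> by (intro mult_left_mono g'_anti) auto
      hence "g b \<le> (b - \<rho>) * g' z1" using z1 z2 g\<rho> by (simp add: algebra_simps)
      moreover have "(b - \<rho>) * g' z1 \<le> 1 * g' z1"
      proof (intro mult_right_mono)
        have "0 < (b - \<rho>) * g' z1" using calculation gb \<kappa> by linarith
        thus "0 \<le> g' z1" using \<rho>b by (simp add: zero_less_mult_iff)
      qed (use b \<rho> in auto)
      ultimately have "\<kappa> \<le> g' z1" using gb by simp
      thus ?thesis using z1(3) g\<rho> x mult_left_mono[of \<kappa> "g' z1" "x - \<rho>"] by (simp add: mult.commute)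
    qed
    have ec: "exp (- c\<^sub>2) \<le> exp (- c)" using c by simp
    have \<gamma>_le: "\<gamma> \<le> exp (- c) * \<kappa> / 2" "\<gamma> \<le> e / 2"
    proof -
      have "\<gamma> \<le> exp (- c\<^sub>2) * \<kappa> / 2" by (simp add: \<gamma>_def)
      also have "\<dots> \<le> exp (- c) * \<kappa> / 2"
        using ec \<kappa> by (intro divide_right_mono mult_right_mono) auto
      finally show "\<gamma> \<le> exp (- c) * \<kappa> / 2" .
    qed (simp add: \<gamma>_def)
    have g0: "0 < \<gamma>" using e0 \<kappa> by (simp add: \<gamma>_def)
    have exp_g: "x * exp (- (c * x ^ k)) = exp (- c) * exp (g x)" if "0 < x" for x
    proof -
      have "exp (- c) * exp (g x) = exp (ln x + - (c * x ^ k))"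
        unfolding exp_add[symmetric] by (simp add: g_def right_diff_distrib)
      thus ?thesis using that by (simp only: exp_add exp_ln)
    qed
    have gap: "\<gamma> * \<bar>x - \<rho>\<bar> \<le> \<bar>x * exp (- (c * x ^ k)) - exp (- c)\<bar>" if x: "0 \<le> x" "x \<le> b" for x
    proof -
      consider "x = 0" | "0 < x" "x < \<rho>" | "x = \<rho>" | "\<rho> < x" using x by linarith
      thus ?thesis
      proof cases
        case 1
        have "\<gamma> * \<rho> \<le> (exp (- c) * \<kappa> / 2) * 1" using \<gamma>_le g0 \<rho> by (intro mult_mono) auto
        also have "\<dots> \<le> exp (- c) * 1" using \<kappa> by simp
        finally show ?thesis using 1 k \<rho> by (simp add: power_0_left)
      next
        case 2
        obtain z where z: "x < z" "z < \<rho>" "g \<rho> - g x = (\<rho> - x) * g' z" using mvt[OF 2] by auto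
        let ?t = "\<kappa> * (\<rho> - x)"
        have "?t \<le> (\<rho> - x) * g' z"
          using slope[of z] z 2 mult_left_mono[of \<kappa> "g' z" "\<rho> - x"] by (simp add: mult.commute)
        hence gx: "g x \<le> - ?t" using z(3) g\<rho> by linarith
        have t: "0 \<le> ?t" "?t \<le> 1"
          using 2 \<kappa> \<rho> mult_mono[of \<kappa> 1 "\<rho> - x" 1] by auto
        have "?t\<^sup>2 \<le> ?t" using t by (simp add: power2_eq_square mult_left_le)
        hence "exp (- ?t) \<le> 1 - ?t / 2" using exp_neg_le_quadratic[OF t(1)] by simp
        hence "exp (g x) \<le> 1 - ?t / 2" using gx by (meson exp_le_cancel_iff order.trans)
        hence "exp (- c) * (?t / 2) \<le> exp (- c) * (1 - exp (g x))" by (intro mult_left_mono) auto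
        moreover have "\<gamma> * (\<rho> - x) \<le> exp (- c) * (?t / 2)"
          using mult_right_mono[OF \<gamma>_le(1), of "\<rho> - x"] 2 by simp
        moreover have "exp (- c) * (1 - exp (g x)) \<le> \<bar>x * exp (- (c * x ^ k)) - exp (- c)\<bar>"
          unfolding exp_g[OF 2(1)] by (simp add: right_diff_distrib)
        ultimately have "\<gamma> * (\<rho> - x) \<le> \<bar>x * exp (- (c * x ^ k)) - exp (- c)\<bar>" by linarith
        moreover have "\<bar>x - \<rho>\<bar> = \<rho> - x" using 2 by simp
        ultimately show ?thesis by (simp only:)
      next
        case 3
        thus ?thesis by simp
      next
        case 4
        have "1 + \<kappa> * (x - \<rho>) \<le> exp (g x)"
          using up[OF 4 x(2)] exp_ge_add_one_self[of "g x"] by linarith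
        hence "exp (- c) * (\<kappa> * (x - \<rho>)) \<le> exp (- c) * (exp (g x) - 1)" by (intro mult_left_mono) auto
        moreover have "\<gamma> * (x - \<rho>) \<le> exp (- c) * \<kappa> / 2 * (x - \<rho>)"
          using mult_right_mono[OF \<gamma>_le(1), of "x - \<rho>"] 4 by simp
        moreover have "exp (- c) * \<kappa> / 2 * (x - \<rho>) \<le> exp (- c) * (\<kappa> * (x - \<rho>))"
          using 4 \<kappa> by (simp add: mult.assoc)
        moreover have "exp (- c) * (exp (g x) - 1) \<le> \<bar>x * exp (- (c * x ^ k)) - exp (- c)\<bar>"
          using exp_g[of x] 4 \<rho> by (simp add: right_diff_distrib)
        ultimately have "\<gamma> * (x - \<rho>) \<le> \<bar>x * exp (- (c * x ^ k)) - exp (- c)\<bar>" by linarith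
        moreover have "\<bar>x - \<rho>\<bar> = x - \<rho>" using 4 by simp
        ultimately show ?thesis by (simp only:)
      qed
    qed
    have "\<gamma> \<le> 1 - c * real k * \<rho> ^ k"
    proof -
      have "exp (- c) * \<kappa> \<le> \<rho> * g' \<rho>" using \<rho>_exp slope[of \<rho>] \<rho> \<kappa> by (intro mult_mono) auto
      moreover have "exp (- c) * \<kappa> / 2 \<le> exp (- c) * \<kappa>" using \<kappa> by simp
      ultimately show ?thesis using \<gamma>_le(1) g'_eq[OF \<rho>(1)] by linarith
    qed
    moreover have "1 + 2 * \<gamma> \<le> c * real k * b ^ k" using \<gamma>_le(2) cb by linarith
    ultimately show "rho (Suc k) c < 1 - (1 - b) \<and> \<gamma> \<le> 1 - c * real k * rho (Suc k) c ^ k \<and>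
       1 + 2 * \<gamma> \<le> c * real k * (1 - (1 - b)) ^ k \<and>
      (\<forall>x. 0 \<le> x \<longrightarrow> x \<le> 1 - (1 - b) \<longrightarrow>
        \<gamma> * \<bar>x - rho (Suc k) c\<bar> \<le> \<bar>x * exp (- (c * x ^ k)) - exp (- c)\<bar>)"
      using \<rho>b gap unfolding \<rho>_def by simp
  qed
qed

lemma power_lipschitz:
  fixes x y :: real
  assumes "0 \<le> x" "x \<le> 1" "0 \<le> y" "y \<le> 1"
  shows "\<bar>x ^ j - y ^ j\<bar> \<le> real j * \<bar>x - y\<bar>"
  using norm_power_diff[of x y j] assms by simp

text \<open>The derivative of \<open>t * exp (- (c * t ^ k))\<close> is \<open>h (t ^ k)\<close>
  with \<open>h\<close> Lipschitz on the unit interval. After subtraction of the tangent at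
  \<open>y\<close> the derivative is therefore at most a constant times
  \<open>\<bar>x - y\<bar>\<close>, and the mean value inequality supplies the second
  factor.\<close>

lemma taylor_fixed_point_map:
  fixes c K :: real
  assumes c: "0 \<le> c" "c \<le> K" and x: "0 \<le> x" "x \<le> 1" "0 \<le> y" "y \<le> 1"
  shows "\<bar>x * exp (- (c * x ^ k)) - y * exp (- (c * y ^ k)) -
      exp (- (c * y ^ k)) * (1 - c * real k * y ^ k) * (x - y)\<bar>
    \<le> real k * (K * (1 + K * real k) + K * real k) * (x - y)\<^sup>2"
proof -
  define h where "h t = exp (- (c * t)) * (1 - c * real k * t)" for t :: real
  define L where "L = K * (1 + K * real k) + K * real k"
  have K0: "0 \<le> K" using c by simp
  have hder: "(h has_real_derivative (- c * exp (- (c * t)) * (1 - c * real k * t) - exp (- (c * t)) * (c * real k))) (at t)" for t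
    unfolding h_def by (auto intro!: derivative_eq_intros simp: algebra_simps)
  have hb: "\<bar>- c * exp (- (c * t)) * (1 - c * real k * t) - exp (- (c * t)) * (c * real k)\<bar> \<le> L"
    if t: "0 \<le> t" "t \<le> 1" for t
  proof -
    have e1: "exp (- (c * t)) \<le> 1" using c t by simp
    have ck: "c * real k \<le> K * real k" using c by (intro mult_right_mono) auto
    have "c * real k * t \<le> c * real k * 1" using c t by (intro mult_left_mono) auto
    moreover have "0 \<le> c * real k * t" using c t by simp
    ultimately have q: "\<bar>1 - c * real k * t\<bar> \<le> 1 + K * real k" using ck by linarith
    have "\<bar>c * exp (- (c * t)) * (1 - c * real k * t)\<bar> = c * exp (- (c * t)) * \<bar>1 - c * real k * t\<bar>"
      using c by (simp add: abs_mult)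
    also have "\<dots> \<le> K * 1 * (1 + K * real k)" using c e1 q K0 by (intro mult_mono) auto
    finally have 1: "\<bar>c * exp (- (c * t)) * (1 - c * real k * t)\<bar> \<le> K * (1 + K * real k)" by simp
    have "exp (- (c * t)) * (c * real k) \<le> 1 * (K * real k)" using c e1 ck by (intro mult_mono) auto
    moreover have "0 \<le> exp (- (c * t)) * (c * real k)" using c by simp
    ultimately show ?thesis using 1 by (simp add: L_def)
  qed
  have hlip: "\<bar>h s - h t\<bar> \<le> L * \<bar>s - t\<bar>" if "0 \<le> s" "s \<le> 1" "0 \<le> t" "t \<le> 1" for s t
    using field_differentiable_bound[of "{0..1}" h _ L s t] that hb
    by (force intro: has_field_derivative_at_within hder convex_closed_interval)
  have L0: "0 \<le> L" using K0 by (simp add: L_def)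
  define \<psi> where "\<psi> t = t * exp (- (c * t ^ k))" for t :: real
  have xk: "t * (real k * t ^ (k - 1)) = real k * t ^ k" for t :: real by (cases k) auto
  have \<psi>der: "(\<psi> has_real_derivative h (t ^ k)) (at t)" for t
    unfolding \<psi>_def h_def using xk[of t]
    by (auto intro!: derivative_eq_intros simp: algebra_simps)
  define \<phi> where "\<phi> t = \<psi> t - h (y ^ k) * t" for t
  have \<phi>der: "(\<phi> has_real_derivative (h (t ^ k) - h (y ^ k))) (at t)" for t
    unfolding \<phi>_def by (auto intro!: derivative_eq_intros \<psi>der)
  have "\<bar>\<phi> x - \<phi> y\<bar> \<le> (L * real k * \<bar>x - y\<bar>) * \<bar>x - y\<bar>"
  proof -
    have "norm (\<phi> x - \<phi> y) \<le> (L * real k * \<bar>x - y\<bar>) * norm (x - y)"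
    proof (rule field_differentiable_bound[of "closed_segment x y" \<phi> "\<lambda>t. h (t ^ k) - h (y ^ k)"])
      fix t assume t: "t \<in> closed_segment x y"
      hence t01: "0 \<le> t" "t \<le> 1" and ty: "\<bar>t - y\<bar> \<le> \<bar>x - y\<bar>"
        using x by (auto simp: closed_segment_eq_real_ivl split: if_splits)
      have "\<bar>h (t ^ k) - h (y ^ k)\<bar> \<le> L * \<bar>t ^ k - y ^ k\<bar>"
        using t01 x by (intro hlip) (auto simp: power_le_one)
      also have "\<dots> \<le> L * (real k * \<bar>x - y\<bar>)"
        using L0 order.trans[OF power_lipschitz[OF t01 x(3,4), of k] mult_left_mono[OF ty, of "real k"]]
        by (intro mult_left_mono) auto
      finally show "norm (h (t ^ k) - h (y ^ k)) \<le> L * real k * \<bar>x - y\<bar>"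
        by (simp only: real_norm_def mult.assoc)
      show "(\<phi> has_field_derivative h (t ^ k) - h (y ^ k)) (at t within closed_segment x y)"
        by (rule has_field_derivative_at_within[OF \<phi>der])
    qed auto
    thus ?thesis by simp
  qed
  moreover have "\<phi> x - \<phi> y = x * exp (- (c * x ^ k)) - y * exp (- (c * y ^ k)) -
      exp (- (c * y ^ k)) * (1 - c * real k * y ^ k) * (x - y)"
    by (simp add: \<phi>_def \<psi>_def h_def algebra_simps)
  moreover have "(L * real k * \<bar>x - y\<bar>) * \<bar>x - y\<bar> = real k * L * (x - y)\<^sup>2"
    by (simp add: power2_eq_square abs_mult[symmetric])
  ultimately show ?thesis by (simp only: L_def)
qed

subsection \<open>Deviations of the number of undiscovered vertices\<close>

lemma cmod_iexp_diff: "cmod (iexp a - iexp b) \<le> \<bar>a - b\<bar>"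
proof -
  have "iexp a - iexp b = iexp b * (iexp (a - b) - 1)"
    by (simp add: right_diff_distrib exp_add[symmetric] algebra_simps)
  hence "cmod (iexp a - iexp b) = cmod (iexp (a - b) - 1)"
    by (simp add: norm_mult)
  thus ?thesis using iexp_approx1[of "a - b" 0] by simp
qed

lemma exp_diff_le:
  fixes a b B :: real
  assumes "a \<le> B" "b \<le> B"
  shows "\<bar>exp a - exp b\<bar> \<le> exp B * \<bar>a - b\<bar>"
proof -
  have *: "exp a - exp b \<le> exp B * (a - b)" if "b \<le> a" "a \<le> B" for a b :: real
  proof -
    have "exp a - exp b = exp a * (1 - exp (- (a - b)))"
      by (simp add: right_diff_distrib exp_add[symmetric])
    also have "\<dots> \<le> exp B * (a - b)"
    proof (intro mult_mono)
      show "1 - exp (- (a - b)) \<le> a - b" using exp_ge_add_one_self[of "- (a - b)"] by linarith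
    qed (use that in auto)
    finally show ?thesis .
  qed
  show ?thesis using *[of a b] *[of b a] assms by (cases "b \<le> a") (auto simp: abs_if)
qed

lemma set_leftover_le: "finite V \<Longrightarrow> S \<in> set_pmf (leftover d p V U) \<Longrightarrow> S \<le> card V"
  by (auto simp: leftover_def intro: card_mono)

text \<open>All that later proofs use about \<open>c\<close> and \<open>\<rho>\<close>. The error
  constants defined from here on involve only \<open>k\<close>, \<open>K\<close>,
  \<open>\<delta>\<close>, \<open>\<gamma>\<close> and the Fourier variable, so they are the same
  for all \<open>n\<close>. The condition \<open>large\<close> lets the drift of the queue absorb
  errors of order \<open>1 / n\<close>.\<close>

locale giant_regime = sparse_regime k n p K for k n :: nat and p K :: real +
  fixes c \<rho> \<delta> \<gamma> :: real
  assumes c: "0 \<le> c" "c \<le> K"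
    and wt_approx': "S \<le> n \<Longrightarrow>
      \<bar>(1 - p) ^ ((S - 1) choose k) - exp (- (c * (real S / real n) ^ k))\<bar> \<le> K / real n"
    and codeg_approx': "S \<le> n \<Longrightarrow>
      \<bar>real n * (p * real ((S - 2) choose (k - 1))) - c * real k * (real S / real n) ^ (k - 1)\<bar> \<le> K / real n"
    and \<rho>: "0 < \<rho>" "\<rho> < 1 - \<delta>" "\<rho> = exp (c * (\<rho> ^ k - 1))"
    and \<delta>: "0 < \<delta>" "\<delta> < 1"
    and \<gamma>: "0 < \<gamma>" "\<gamma> \<le> 1 - c * real k * \<rho> ^ k" "1 + 2 * \<gamma> \<le> c * real k * (1 - \<delta>) ^ k"
    and gap: "0 \<le> x \<Longrightarrow> x \<le> 1 - \<delta> \<Longrightarrow> \<gamma> * \<bar>x - \<rho>\<bar> \<le> \<bar>x * exp (- (c * x ^ k)) - exp (- c)\<bar>"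
    and large: "K + K\<^sup>2 \<le> \<gamma> * real n"
begin

lemma wt_approx: "S \<le> n \<Longrightarrow> \<bar>wt S - exp (- (c * (real S / real n) ^ k))\<bar> \<le> K / real n"
  using wt_approx' by (simp add: wt_def)

lemma codeg_approx: "S \<le> n \<Longrightarrow>
    \<bar>real n * codeg S - c * real k * (real S / real n) ^ (k - 1)\<bar> \<le> K / real n"
  using codeg_approx' by (simp add: codeg_def)

text \<open>\<open>lam\<close> maximises \<open>lam * \<gamma> - lam\<^sup>2 * mom / 2\<close>, and
  \<open>zt\<close> is the maximum. They are exponential rates, \<open>lam\<close> in the length of
  the queue and \<open>zt\<close> in time.\<close>

definition lam :: real where "lam = \<gamma> / mom"
definition zt :: real where "zt = \<gamma>\<^sup>2 / (2 * mom)"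

lemma lam_pos: "0 < lam" and zt_pos: "0 < zt"
  using \<gamma> mom_ge by (auto simp: lam_def zt_def)

text \<open>A step takes one vertex out of the queue and adds at least \<open>1 + \<gamma>\<close>
  in mean, because \<open>u * codeg m\<close> is at least \<open>c * k * (1 - \<delta>) ^ k\<close>
  up to order \<open>1 / n\<close>. The quadratic bound for \<open>exp\<close> together with the
  second moment of the loss turns this drift into an exponential estimate.\<close>

lemma early_step:
  assumes "finite (V :: 'a set)" "card V \<le> n" "U \<subseteq> V" "v \<in> V" "v \<notin> U"
    and big: "(1 - \<delta>) * real n \<le> real (card U)"
  shows "expect (random_subset p (star (Suc k) V v))
    (\<lambda>E. exp (- (lam * (real (card U) - real (undisc U E))))) \<le> exp (- lam - zt)"
proof -
  interpret exploration_step k n p K V U v using assms by unfold_locales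
  have nn: "0 < real n" using n_pos by simp
  have "0 < (1 - \<delta>) * real n" using \<delta> nn by simp
  hence "0 < u" using big by linarith
  hence m2: "2 \<le> m" using u_less by linarith
  let ?e = "expect M (\<lambda>E. real (undisc U E))"
  let ?x = "real m / real n"
  have "?e = real u * (1 - p) ^ ((m - 2) choose (k - 1))"
    using expectation_undisc[OF V(1) U v p, of k] choose_codeg[OF m2] by simp
  also have "\<dots> \<le> real u * (1 - codeg m + (codeg m)\<^sup>2 / 2)"
    using one_minus_power_bounds(2)[OF p, of "(m - 2) choose (k - 1)"]
    by (intro mult_left_mono) (auto simp: codeg_def)
  finally have e: "real u * codeg m - real u * (codeg m)\<^sup>2 / 2 \<le> real u - ?e"
    by (simp add: algebra_simps)
  have "1 - \<delta> \<le> ?x" using big u_less nn by (simp add: field_simps)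
  hence "c * real k * (1 - \<delta>) ^ (k - 1) \<le> c * real k * ?x ^ (k - 1)"
    using c \<delta> by (intro mult_left_mono power_mono) auto
  hence "c * real k * (1 - \<delta>) ^ (k - 1) - K / real n \<le> real n * codeg m"
    using codeg_approx[OF V(2)] by linarith
  hence "(1 - \<delta>) * (c * real k * (1 - \<delta>) ^ (k - 1) - K / real n) \<le> (1 - \<delta>) * (real n * codeg m)"
    using \<delta> by (intro mult_left_mono) auto
  also have "\<dots> = ((1 - \<delta>) * real n) * codeg m" by simp
  also have "\<dots> \<le> real u * codeg m" using big codeg_nonneg by (intro mult_right_mono) auto
  finally have "(1 - \<delta>) * (c * real k * (1 - \<delta>) ^ (k - 1)) - (1 - \<delta>) * (K / real n) \<le> real u * codeg m"
    by (simp only: right_diff_distrib)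
  moreover have "(1 - \<delta>) * (c * real k * (1 - \<delta>) ^ (k - 1)) = c * real k * (1 - \<delta>) ^ k"
    using k by (cases k) auto
  moreover have "(1 - \<delta>) * (K / real n) \<le> 1 * (K / real n)"
    using \<delta> K1 nn by (intro mult_right_mono) auto
  ultimately have uc: "1 + 2 * \<gamma> - K / real n \<le> real u * codeg m" using \<gamma>(3) by linarith
  have "real u * (codeg m)\<^sup>2 / 2 \<le> real u * (codeg m)\<^sup>2" by simp
  also have "\<dots> \<le> real n * (K / real n)\<^sup>2"
    using u_le_n codeg_le'[OF V(2)] codeg_nonneg by (intro mult_mono power_mono) auto
  also have "\<dots> = K\<^sup>2 / real n" using nn by (simp add: power2_eq_square)
  finally have uc2: "real u * (codeg m)\<^sup>2 / 2 \<le> K\<^sup>2 / real n" .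
  have "(K + K\<^sup>2) / real n \<le> \<gamma>" using large nn by (simp add: field_simps)
  hence lower: "1 + \<gamma> \<le> real u - ?e" using e uc uc2 unfolding add_divide_distrib by linarith
  have "expect M (\<lambda>E. exp (- (lam * (real u - real (undisc U E))))) \<le>
    expect M (\<lambda>E. 1 - lam * (real u - real (undisc U E)) +
      lam\<^sup>2 / 2 * (real u - real (undisc U E))\<^sup>2)"
  proof (rule expectation_mono_finite)
    fix E assume "E \<in> set_pmf M"
    hence "undisc U E \<le> u" using undisc_loss_le(2)[OF V(1) U set_random_subset] by blast
    hence "0 \<le> lam * (real u - real (undisc U E))" using lam_pos by simp
    from exp_neg_le_quadratic[OF this]
    show "exp (- (lam * (real u - real (undisc U E)))) \<le> 1 - lam * (real u - real (undisc U E)) +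
      lam\<^sup>2 / 2 * (real u - real (undisc U E))\<^sup>2"
      by (simp add: power_mult_distrib)
  qed simp
  also have "\<dots> = 1 - lam * (real u - ?e) + lam\<^sup>2 / 2 *
      expect M (\<lambda>E. (real u - real (undisc U E))\<^sup>2)"
    by (simp add: expectation_add_finite expectation_diff_finite)
  also have "\<dots> \<le> 1 - lam * (1 + \<gamma>) + lam\<^sup>2 / 2 * mom"
    using lower lam_pos loss_moment2 by (intro add_mono diff_left_mono mult_left_mono) auto
  also have "\<dots> = 1 + (- lam - zt)"
    using mom_ge by (simp add: lam_def zt_def field_simps power2_eq_square)
  also have "\<dots> \<le> exp (- lam - zt)" by (rule exp_ge_add_one_self)
  finally show ?thesis .
qed

text \<open>The supermartingale is the exponential of \<open>zt\<close> times the elapsed time minus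
  \<open>lam\<close> times the queue length, set to zero once \<open>u\<close> falls below
  \<open>(1 - \<delta>) * n\<close>; as \<open>u\<close> never grows, it then stays zero. At the end
  the queue is empty and the time is \<open>n - S\<close>. Many seeds make early death unlikely, and
  a single seed gives an exponential tail for small clusters.\<close>

lemma early_death:
  assumes V: "finite (V :: 'a set)" "card V = n" "U \<subseteq> V"
  shows "expect (leftover (Suc k) p V U)
      (\<lambda>S. if (1 - \<delta>) * real n \<le> real S then exp (zt * (real n - real S)) else 0)
    \<le> exp (- (lam * (real n - real (card U))))"
proof -
  define \<Psi> where "\<Psi> m u = (if (1 - \<delta>) * real n \<le> real u
    then exp (zt * (real n - real m) - lam * (real m - real u)) else 0)" for m u :: nat
  have "expect (leftover (Suc k) p V U) (\<lambda>S. \<Psi> S S) \<le> \<Psi> (card V) (card U)"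
  proof (rule leftover_supermartingale[where n = n])
    fix V U :: "'a set" and v
    assume A: "finite V" "card V \<le> n" "U \<subseteq> V" "v \<in> V" "v \<notin> U"
    interpret exploration_step k n p K V U v using A by unfold_locales
    have und: "undisc U E \<le> u" if "E \<in> set_pmf M" for E
      using undisc_loss_le(2)[OF V(1) U set_random_subset[OF that]] .
    have m1: "real (m - 1) = real m - 1" using u_less by (simp add: of_nat_diff)
    show "expect M (\<lambda>E. \<Psi> (m - 1) (undisc U E)) \<le> \<Psi> m u"
    proof (cases "(1 - \<delta>) * real n \<le> real u")
      case True
      have "expect M (\<lambda>E. \<Psi> (m - 1) (undisc U E)) \<le>
        expect M (\<lambda>E. exp (zt * (real n - real m) - lam * (real m - real u)) * exp (lam + zt) *
          exp (- (lam * (real u - real (undisc U E)))))"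
      proof (rule expectation_mono_finite)
        fix E
        have "exp (zt * (real n - real (m - 1)) - lam * (real (m - 1) - real (undisc U E))) =
          exp (zt * (real n - real m) - lam * (real m - real u)) * exp (lam + zt) *
          exp (- (lam * (real u - real (undisc U E))))"
          unfolding m1 exp_add[symmetric] by (simp add: algebra_simps)
        thus "\<Psi> (m - 1) (undisc U E) \<le> exp (zt * (real n - real m) - lam * (real m - real u)) * exp (lam + zt) *
          exp (- (lam * (real u - real (undisc U E))))" by (simp add: \<Psi>_def)
      qed simp
      also have "\<dots> = exp (zt * (real n - real m) - lam * (real m - real u)) * exp (lam + zt) *
          expect M (\<lambda>E. exp (- (lam * (real u - real (undisc U E)))))" by simp
      also have "\<dots> \<le> exp (zt * (real n - real m) - lam * (real m - real u)) * exp (lam + zt) * exp (- lam - zt)"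
        using early_step[OF A True] by (intro mult_left_mono) auto
      also have "\<dots> = \<Psi> m u" using True by (simp add: \<Psi>_def mult.assoc exp_add[symmetric])
      finally show ?thesis .
    next
      case False
      have "expect M (\<lambda>E. \<Psi> (m - 1) (undisc U E)) = expect M (\<lambda>E. 0)"
      proof (rule expectation_cong_pmf)
        fix E assume "E \<in> set_pmf M"
        hence "real (undisc U E) \<le> real u" using und by simp
        thus "\<Psi> (m - 1) (undisc U E) = 0" using False by (simp add: \<Psi>_def)
      qed
      thus ?thesis using False by (simp add: \<Psi>_def)
    qed
  qed (use V in auto)
  also have "\<Psi> (card V) (card U) \<le> exp (- (lam * (real n - real (card U))))"
    using V by (simp add: \<Psi>_def)
  also have "(\<lambda>S. \<Psi> S S) = (\<lambda>S. if (1 - \<delta>) * real n \<le> real S then exp (zt * (real n - real S)) else 0)"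
    by (simp add: \<Psi>_def fun_eq_iff)
  finally show ?thesis .
qed

lemma mu_approx:
  assumes "u \<le> n"
  shows "\<bar>wt n * real u - real n * exp (- c)\<bar> \<le> K + (real n - real u)"
proof -
  have nn: "0 < real n" using n_pos by simp
  have "\<bar>wt n - exp (- c)\<bar> \<le> K / real n" using wt_approx[of n] nn by simp
  hence "\<bar>real n * (wt n - exp (- c))\<bar> \<le> real n * (K / real n)"
    unfolding abs_mult using nn by (intro mult_mono) auto
  hence 1: "\<bar>real n * wt n - real n * exp (- c)\<bar> \<le> K" using nn by (simp add: right_diff_distrib)
  have "0 \<le> wt n * (real n - real u)" "wt n * (real n - real u) \<le> 1 * (real n - real u)"
    using mult_right_mono[OF wt_le_1[of n], of "real n - real u"] wt_nonneg[of n] assms by auto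
  thus ?thesis using 1 by (simp add: algebra_simps)
qed

text \<open>\<open>wt S\<close> is close to \<open>exp (- (c * x ^ k))\<close>, and the starting
  value \<open>wt n * u\<close> to \<open>n * exp (- c)\<close> up to the \<open>n - u\<close>
  seeds. So the total change of the martingale measures by how much \<open>x\<close> misses the
  fixed point equation.\<close>

lemma potential_approx:
  assumes "S \<le> n" "u \<le> n"
  defines "x \<equiv> real S / real n"
  shows "\<bar>(wt S * real S - wt n * real u) - real n * (x * exp (- (c * x ^ k)) - exp (- c))\<bar>
    \<le> 2 * K + (real n - real u)"
proof -
  have nn: "0 < real n" using n_pos by simp
  have x: "0 \<le> x" "x \<le> 1" "real n * x = real S" using assms nn by (auto simp: x_def)
  have "\<bar>real S * (wt S - exp (- (c * x ^ k)))\<bar> \<le> real n * (K / real n)"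
    unfolding abs_mult using wt_approx[OF assms(1)] assms(1) by (intro mult_mono) (auto simp: x_def)
  hence "\<bar>wt S * real S - real S * exp (- (c * x ^ k))\<bar> \<le> K"
    using nn by (simp add: right_diff_distrib mult.commute)
  moreover have "real n * (x * exp (- (c * x ^ k)) - exp (- c)) = real S * exp (- (c * x ^ k)) - real n * exp (- c)"
    using x(3) by (simp add: right_diff_distrib mult.assoc[symmetric])
  ultimately show ?thesis using mu_approx[OF assms(2)] by linarith
qed

definition dev_const :: real where "dev_const = (2 * mom + 16 * K\<^sup>2 + 4) / \<gamma>\<^sup>2"

text \<open>Away from early death \<open>gap\<close> inverts the fixed point equation:
  \<open>\<gamma> * \<bar>S - \<rho> * n\<bar>\<close> is at most the deviation of the martingale
  plus \<open>2 * K\<close> plus the number of seeds. The condition \<open>few\<close> keeps the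
  square of that number within order \<open>n\<close>.\<close>

lemma late_deviation:
  assumes V: "finite (V :: 'a set)" "card V = n" "U \<subseteq> V"
    and few: "(real n - real (card U))\<^sup>2 \<le> real n"
  shows "expect (leftover (Suc k) p V U)
      (\<lambda>S. if (1 - \<delta>) * real n \<le> real S then 0 else (real S - \<rho> * real n)\<^sup>2)
    \<le> dev_const * real n"
proof -
  define \<mu> where "\<mu> = wt n * real (card U)"
  define \<kappa> where "\<kappa> = real n - real (card U)"
  have nn: "1 \<le> real n" using n_pos by simp
  have Un: "card U \<le> n" using V card_mono by metis
  have \<kappa>0: "0 \<le> \<kappa>" using Un by (simp add: \<kappa>_def)
  have "expect (leftover (Suc k) p V U)
      (\<lambda>S. if (1 - \<delta>) * real n \<le> real S then 0 else (real S - \<rho> * real n)\<^sup>2) \<le>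
    expect (leftover (Suc k) p V U)
      (\<lambda>S. 2 / \<gamma>\<^sup>2 * (wt S * real S - \<mu>)\<^sup>2 + 2 / \<gamma>\<^sup>2 * (2 * K + \<kappa>)\<^sup>2)"
  proof (rule expectation_mono_finite)
    fix S assume "S \<in> set_pmf (leftover (Suc k) p V U)"
    hence S: "S \<le> n" using set_leftover_le V by metis
    show "(if (1 - \<delta>) * real n \<le> real S then 0 else (real S - \<rho> * real n)\<^sup>2) \<le>
        2 / \<gamma>\<^sup>2 * (wt S * real S - \<mu>)\<^sup>2 + 2 / \<gamma>\<^sup>2 * (2 * K + \<kappa>)\<^sup>2"
    proof (cases "(1 - \<delta>) * real n \<le> real S")
      case False
      define x where "x = real S / real n"
      have x: "0 \<le> x" "x \<le> 1 - \<delta>" using False nn by (auto simp: x_def field_simps)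
      have "real n * (x - \<rho>) = real S - \<rho> * real n" using nn by (simp add: x_def algebra_simps)
      hence "\<gamma> * \<bar>real S - \<rho> * real n\<bar> = real n * (\<gamma> * \<bar>x - \<rho>\<bar>)"
        using nn by (metis abs_mult abs_of_nat mult.left_commute)
      also have "\<dots> \<le> real n * \<bar>x * exp (- (c * x ^ k)) - exp (- c)\<bar>"
        using gap[OF x] by (intro mult_left_mono) auto
      also have "\<dots> = \<bar>real n * (x * exp (- (c * x ^ k)) - exp (- c))\<bar>" by (simp add: abs_mult)
      also have "\<dots> \<le> \<bar>wt S * real S - \<mu>\<bar> + (2 * K + \<kappa>)"
        using potential_approx[OF S Un] unfolding x_def \<mu>_def \<kappa>_def by linarith
      finally have "(\<gamma> * \<bar>real S - \<rho> * real n\<bar>)\<^sup>2 \<le> (\<bar>wt S * real S - \<mu>\<bar> + (2 * K + \<kappa>))\<^sup>2"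
        using \<gamma> by (intro power_mono) auto
      also have "\<dots> \<le> 2 * \<bar>wt S * real S - \<mu>\<bar>\<^sup>2 + 2 * (2 * K + \<kappa>)\<^sup>2"
        using sum_squares_bound[of "\<bar>wt S * real S - \<mu>\<bar>" "2 * K + \<kappa>"]
        by (simp add: power2_sum)
      finally have "\<gamma>\<^sup>2 * (real S - \<rho> * real n)\<^sup>2 \<le> 2 * (wt S * real S - \<mu>)\<^sup>2 + 2 * (2 * K + \<kappa>)\<^sup>2"
        by (simp add: power_mult_distrib)
      hence "(real S - \<rho> * real n)\<^sup>2 \<le> (2 * (wt S * real S - \<mu>)\<^sup>2 + 2 * (2 * K + \<kappa>)\<^sup>2) / \<gamma>\<^sup>2"
        using \<gamma> by (simp add: field_simps)
      thus ?thesis using False by (simp add: add_divide_distrib)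
    qed simp
  qed (use V in simp)
  also have "\<dots> = 2 / \<gamma>\<^sup>2 * expect (leftover (Suc k) p V U) (\<lambda>S. (wt S * real S - \<mu>)\<^sup>2) +
      2 / \<gamma>\<^sup>2 * (2 * K + \<kappa>)\<^sup>2"
    using V by (simp add: expectation_add_finite)
  also have "\<dots> \<le> 2 / \<gamma>\<^sup>2 * (mom * real n) + 2 / \<gamma>\<^sup>2 * ((8 * K\<^sup>2 + 2) * real n)"
  proof (intro add_mono mult_left_mono)
    show "expect (leftover (Suc k) p V U) (\<lambda>S. (wt S * real S - \<mu>)\<^sup>2) \<le> mom * real n"
      using second_moment[OF V(1) _ V(3), of \<mu>] V(2) by (simp add: \<mu>_def)
    have "(2 * K + \<kappa>)\<^sup>2 \<le> 8 * K\<^sup>2 + 2 * \<kappa>\<^sup>2"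
      using sum_squares_bound[of "2 * K" \<kappa>] by (simp add: power2_sum power_mult_distrib)
    also have "\<dots> \<le> 8 * K\<^sup>2 * real n + 2 * real n"
    proof (rule add_mono)
      show "8 * K\<^sup>2 \<le> 8 * K\<^sup>2 * real n" using nn mult_left_mono[of 1 "real n" "8 * K\<^sup>2"] by simp
      show "2 * \<kappa>\<^sup>2 \<le> 2 * real n" using few by (simp add: \<kappa>_def)
    qed
    finally show "(2 * K + \<kappa>)\<^sup>2 \<le> (8 * K\<^sup>2 + 2) * real n" by (simp add: distrib_right)
  qed auto
  also have "\<dots> = dev_const * real n" using \<gamma> by (simp add: dev_const_def field_simps)
  finally show ?thesis .
qed

end

subsection \<open>Central limit theorem for the undiscovered vertices\<close>

context giant_regime
begin

text \<open>The derivative of \<open>x * exp (- (c * x ^ k))\<close> at \<open>\<rho>\<close>: it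
  converts a deviation of \<open>S\<close> into one of the martingale.\<close>

definition slope :: real where "slope = exp (- (c * \<rho> ^ k)) * (1 - c * real k * \<rho> ^ k)"
text \<open>The leading term of \<open>qvar\<close> divided by \<open>n\<close> when
  \<open>S\<close> is close to \<open>\<rho> * n\<close>; \<open>slope_sd\<close> ties it to the
  target variance.\<close>

definition var_lim :: real where
  "var_lim = (exp (- (c * \<rho> ^ k)))\<^sup>2 * (\<rho> * (1 - \<rho> + c * real k * (\<rho> - \<rho> ^ k)))"

lemma exp_c: "exp (- c) = \<rho> * exp (- (c * \<rho> ^ k))"
proof -
  have "\<rho> * exp (- (c * \<rho> ^ k)) = exp (c * (\<rho> ^ k - 1)) * exp (- (c * \<rho> ^ k))"
    using \<rho>(3) by simp
  thus ?thesis by (simp add: exp_add[symmetric] right_diff_distrib)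
qed

lemma \<rho>_less_1: "\<rho> < 1" and \<rho>_pow_le: "\<rho> ^ k \<le> \<rho>" and \<rho>_ge: "exp (- K) \<le> \<rho>"
proof -
  show 1: "\<rho> < 1" using \<rho> \<delta> by linarith
  show "\<rho> ^ k \<le> \<rho>" using power_decreasing[OF k, of \<rho>] \<rho> 1 by simp
  have "exp (- K) \<le> exp (- c)" using c by simp
  also have "\<dots> \<le> exp (c * (\<rho> ^ k - 1))"
    using c(1) \<rho>(1) by (simp add: right_diff_distrib)
  also have "\<dots> = \<rho>" using \<rho>(3) by simp
  finally show "exp (- K) \<le> \<rho>" .
qed

lemma var_lim_ge: "exp (- (3 * K)) * \<delta> \<le> var_lim"
proof -
  have "c * \<rho> ^ k \<le> K * 1" using c \<rho> \<rho>_less_1 by (intro mult_mono) (auto simp: power_le_one)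
  hence "(exp (- K))\<^sup>2 \<le> (exp (- (c * \<rho> ^ k)))\<^sup>2" by (intro power_mono) auto
  moreover have "exp (- K) * \<delta> \<le> \<rho> * (1 - \<rho> + c * real k * (\<rho> - \<rho> ^ k))"
  proof (intro mult_mono)
    have "0 \<le> c * real k * (\<rho> - \<rho> ^ k)" using c \<rho>_pow_le by simp
    thus "\<delta> \<le> 1 - \<rho> + c * real k * (\<rho> - \<rho> ^ k)" using \<rho> by linarith
  qed (use \<rho> \<rho>_ge \<delta> in auto)
  ultimately have "(exp (- K))\<^sup>2 * (exp (- K) * \<delta>) \<le> var_lim"
    unfolding var_lim_def by (rule mult_mono) (use \<delta> in auto)
  moreover have "(exp (- K))\<^sup>2 * (exp (- K) * \<delta>) = exp (- (3 * K)) * \<delta>"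
    by (simp add: power2_eq_square mult.assoc[symmetric] exp_add[symmetric])
  ultimately show ?thesis by simp
qed

lemma var_lim_pos: "0 < var_lim"
  using var_lim_ge \<delta> by (intro less_le_trans[OF _ var_lim_ge]) simp

lemma slope_pos: "0 < slope"
  using \<gamma> by (simp add: slope_def)

definition sd :: real where
  "sd = sqrt (\<rho> * (1 - \<rho> + c * real k * (\<rho> - \<rho> ^ k)) * real n / (1 - c * real k * \<rho> ^ k)\<^sup>2)"

lemma slope_sd: "slope * sd = sqrt (var_lim * real n)"
proof -
  have s: "0 < 1 - c * real k * \<rho> ^ k" using \<gamma> by linarith
  have "slope * sd = sqrt (slope\<^sup>2) * sd" using slope_pos by simp
  also have "\<dots> = sqrt (slope\<^sup>2 * (\<rho> * (1 - \<rho> + c * real k * (\<rho> - \<rho> ^ k)) * real n / (1 - c * real k * \<rho> ^ k)\<^sup>2))"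
    unfolding sd_def by (simp only: real_sqrt_mult)
  also have "slope\<^sup>2 * (\<rho> * (1 - \<rho> + c * real k * (\<rho> - \<rho> ^ k)) * real n / (1 - c * real k * \<rho> ^ k)\<^sup>2) =
      var_lim * real n"
    unfolding slope_def var_lim_def power_mult_distrib using s by simp
  finally show ?thesis .
qed

lemma sd_pos: "0 < sd"
proof -
  have "0 < slope * sd" unfolding slope_sd using var_lim_pos n_pos by simp
  thus ?thesis using slope_pos by (simp add: zero_less_mult_iff)
qed

text \<open>The leading term of \<open>qvar\<close> divided by \<open>n\<close> at
  \<open>S = x * n\<close>, with \<open>n * exp (- c)\<close> in place of
  \<open>\<mu>\<close>.\<close>

definition var_fun :: "real \<Rightarrow> real" where
  "var_fun x = exp (- c) * (exp (- (c * x ^ k)) - exp (- c)) +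
     (exp (- c))\<^sup>2 * (c * real k * (1 - x ^ (k - 1)))"

text \<open>The fixed point equation in the form \<open>exp_c\<close> extracts the square of
  \<open>exp (- (c * \<rho> ^ k))\<close> as a common factor.\<close>

lemma var_fun_\<rho>: "var_fun \<rho> = var_lim"
proof -
  have "\<rho> * \<rho> ^ (k - 1) = \<rho> ^ k" using k by (cases k) auto
  hence H: "\<rho>\<^sup>2 * (1 - \<rho> ^ (k - 1)) = \<rho> * (\<rho> - \<rho> ^ k)"
    by (simp add: power2_eq_square right_diff_distrib mult.assoc)
  define e where "e = exp (- (c * \<rho> ^ k))"
  have "var_fun \<rho> = e\<^sup>2 * (\<rho> * (1 - \<rho>)) + e\<^sup>2 * (c * real k * (\<rho>\<^sup>2 * (1 - \<rho> ^ (k - 1))))"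
    unfolding var_fun_def exp_c e_def[symmetric] by (simp add: power2_eq_square algebra_simps)
  also have "\<dots> = e\<^sup>2 * (\<rho> * (1 - \<rho> + c * real k * (\<rho> - \<rho> ^ k)))"
    unfolding H by (simp add: algebra_simps)
  finally show ?thesis by (simp only: var_lim_def e_def)
qed

lemma var_fun_lipschitz:
  assumes "0 \<le> x" "x \<le> 1"
  shows "\<bar>var_fun x - var_fun \<rho>\<bar> \<le> 2 * K * (real k)\<^sup>2 * \<bar>x - \<rho>\<bar>"
proof -
  have k1: "1 \<le> real k" using k by simp
  have ec: "0 \<le> exp (- c)" "exp (- c) \<le> 1" using c by auto
  have "\<bar>exp (- c) * (exp (- (c * x ^ k)) - exp (- (c * \<rho> ^ k)))\<bar> \<le> 1 * (K * (real k * \<bar>x - \<rho>\<bar>))"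
    unfolding abs_mult
  proof (intro mult_mono)
    have "\<bar>exp (- (c * x ^ k)) - exp (- (c * \<rho> ^ k))\<bar> \<le> \<bar>c * x ^ k - c * \<rho> ^ k\<bar>"
      using assms c \<rho> by (intro exp_neg_lipschitz) auto
    also have "\<dots> = c * \<bar>x ^ k - \<rho> ^ k\<bar>"
      using c unfolding right_diff_distrib[symmetric] abs_mult by simp
    also have "\<dots> \<le> K * (real k * \<bar>x - \<rho>\<bar>)"
      using c assms \<rho> \<rho>_less_1 by (intro mult_mono power_lipschitz) auto
    finally show "\<bar>exp (- (c * x ^ k)) - exp (- (c * \<rho> ^ k))\<bar> \<le> K * (real k * \<bar>x - \<rho>\<bar>)" .
  qed (use ec in auto)
  moreover have "\<bar>(exp (- c))\<^sup>2 * (c * real k * (\<rho> ^ (k - 1) - x ^ (k - 1)))\<bar> \<le>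
      1 * (K * real k * (real k * \<bar>x - \<rho>\<bar>))"
    unfolding abs_mult
  proof (intro mult_mono)
    have "\<bar>\<rho> ^ (k - 1) - x ^ (k - 1)\<bar> \<le> real (k - 1) * \<bar>\<rho> - x\<bar>"
      using assms \<rho> \<rho>_less_1 by (intro power_lipschitz) auto
    also have "\<dots> \<le> real k * \<bar>x - \<rho>\<bar>" by (simp add: abs_minus_commute mult_right_mono)
    finally show "\<bar>\<rho> ^ (k - 1) - x ^ (k - 1)\<bar> \<le> real k * \<bar>x - \<rho>\<bar>" .
  qed (use ec c K1 in \<open>auto simp: power_le_one\<close>)
  moreover have "var_fun x - var_fun \<rho> = exp (- c) * (exp (- (c * x ^ k)) - exp (- (c * \<rho> ^ k))) +
      (exp (- c))\<^sup>2 * (c * real k * (\<rho> ^ (k - 1) - x ^ (k - 1)))"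
    unfolding var_fun_def by (simp add: algebra_simps)
  moreover have "1 * (K * (real k * \<bar>x - \<rho>\<bar>)) \<le> K * real k * (real k * \<bar>x - \<rho>\<bar>)"
    using k1 K1 mult_right_mono[of 1 "real k" "\<bar>x - \<rho>\<bar>"] by (simp add: mult.assoc mult_left_mono)
  moreover have "2 * K * (real k)\<^sup>2 * \<bar>x - \<rho>\<bar> = K * real k * (real k * \<bar>x - \<rho>\<bar>) + K * real k * (real k * \<bar>x - \<rho>\<bar>)"
    by (simp add: power2_eq_square mult_ac)
  ultimately show ?thesis by linarith
qed

lemma qvar_approx:
  assumes S: "S \<le> n" and u: "u \<le> n"
  defines "\<kappa> \<equiv> real n - real u"
  shows "\<bar>qvar (wt n * real u) S / real n - var_fun (real S / real n)\<bar> \<le> 7 * K\<^sup>2 * (1 + \<kappa>) / real n"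
proof -
  have nn: "0 < real n" using n_pos by simp
  define x where "x = real S / real n"
  define \<mu> where "\<mu> = wt n * real u / real n"
  define \<alpha> where "\<alpha> = wt S - wt n"
  define \<alpha>' where "\<alpha>' = exp (- (c * x ^ k)) - exp (- c)"
  define \<beta> where "\<beta> = real n * codeg n - real n * codeg S"
  define \<beta>' where "\<beta>' = c * real k * (1 - x ^ (k - 1))"
  define e where "e = exp (- c)"
  define \<epsilon> where "\<epsilon> = 1 / real n"
  have \<epsilon>: "0 < \<epsilon>" using nn by (simp add: \<epsilon>_def)
  have \<kappa>0: "0 \<le> \<kappa>" using u by (simp add: \<kappa>_def)
  have e: "0 \<le> e" "e \<le> 1" using c by (auto simp: e_def)
  have wu: "wt n * real u \<le> 1 * real n" using u wt_le_1 wt_nonneg by (intro mult_mono) auto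
  have \<mu>: "0 \<le> \<mu>" "\<mu> \<le> 1" using wu wt_nonneg nn by (auto simp: \<mu>_def)
  have "\<mu> - e = (wt n * real u - real n * e) * \<epsilon>" using nn by (simp add: \<mu>_def \<epsilon>_def field_simps)
  hence \<mu>e: "\<bar>\<mu> - e\<bar> \<le> (K + \<kappa>) * \<epsilon>"
    using mu_approx[OF u] \<epsilon> unfolding e_def \<kappa>_def by (simp add: abs_mult mult_right_mono)
  have \<alpha>1: "\<bar>\<alpha>\<bar> \<le> 1"
    using wt_nonneg[of n] wt_le_1[of S] wt_antimono[OF S] by (simp add: \<alpha>_def)
  have "\<bar>wt n - e\<bar> \<le> K * \<epsilon>" using wt_approx[of n] nn by (simp add: e_def \<epsilon>_def)
  moreover have "\<bar>wt S - exp (- (c * x ^ k))\<bar> \<le> K * \<epsilon>" using wt_approx[OF S] by (simp add: \<epsilon>_def x_def)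
  ultimately have \<alpha>\<alpha>: "\<bar>\<alpha> - \<alpha>'\<bar> \<le> 2 * K * \<epsilon>" unfolding \<alpha>_def \<alpha>'_def e_def by linarith
  have "real n * codeg n \<le> real n * (K / real n)" using codeg_le'[of n] by (intro mult_left_mono) auto
  hence "real n * codeg n \<le> K" using nn by simp
  moreover have "real n * codeg S \<le> real n * codeg n" using codeg_mono[OF S] by (intro mult_left_mono) auto
  moreover have "0 \<le> real n * codeg S" using codeg_nonneg by simp
  ultimately have \<beta>1: "\<bar>\<beta>\<bar> \<le> K" unfolding \<beta>_def by linarith
  have "\<bar>real n * codeg n - c * real k\<bar> \<le> K * \<epsilon>" using codeg_approx[of n] nn by (simp add: \<epsilon>_def)
  moreover have "\<bar>real n * codeg S - c * real k * x ^ (k - 1)\<bar> \<le> K * \<epsilon>"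
    using codeg_approx[OF S] by (simp add: \<epsilon>_def x_def)
  ultimately have \<beta>\<beta>: "\<bar>\<beta> - \<beta>'\<bar> \<le> 2 * K * \<epsilon>"
    unfolding \<beta>_def \<beta>'_def by (simp add: right_diff_distrib)
  have "\<bar>\<mu> * \<alpha> - e * \<alpha>'\<bar> \<le> \<bar>(\<mu> - e) * \<alpha>\<bar> + \<bar>e * (\<alpha> - \<alpha>')\<bar>"
  proof -
    have "\<mu> * \<alpha> - e * \<alpha>' = (\<mu> - e) * \<alpha> + e * (\<alpha> - \<alpha>')" by (simp add: algebra_simps)
    thus ?thesis by (simp only: abs_triangle_ineq)
  qed
  also have "\<bar>(\<mu> - e) * \<alpha>\<bar> \<le> (K + \<kappa>) * \<epsilon> * 1"
    unfolding abs_mult using \<mu>e \<alpha>1 K1 \<kappa>0 \<epsilon> by (intro mult_mono) auto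
  also have "\<bar>e * (\<alpha> - \<alpha>')\<bar> \<le> 1 * (2 * K * \<epsilon>)"
    unfolding abs_mult using e \<alpha>\<alpha> by (intro mult_mono) auto
  finally have 1: "\<bar>\<mu> * \<alpha> - e * \<alpha>'\<bar> \<le> (K + \<kappa>) * \<epsilon> + 2 * K * \<epsilon>" by simp
  have "\<bar>\<mu>\<^sup>2 * \<beta> - e\<^sup>2 * \<beta>'\<bar> \<le> \<bar>(\<mu>\<^sup>2 - e\<^sup>2) * \<beta>\<bar> + \<bar>e\<^sup>2 * (\<beta> - \<beta>')\<bar>"
  proof -
    have "\<mu>\<^sup>2 * \<beta> - e\<^sup>2 * \<beta>' = (\<mu>\<^sup>2 - e\<^sup>2) * \<beta> + e\<^sup>2 * (\<beta> - \<beta>')" by (simp add: algebra_simps)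
    thus ?thesis by (simp only: abs_triangle_ineq)
  qed
  also have "\<bar>(\<mu>\<^sup>2 - e\<^sup>2) * \<beta>\<bar> \<le> (2 * ((K + \<kappa>) * \<epsilon>)) * K"
    unfolding abs_mult
  proof (intro mult_mono)
    have "\<bar>\<mu>\<^sup>2 - e\<^sup>2\<bar> \<le> real 2 * \<bar>\<mu> - e\<bar>" using \<mu> e by (intro power_lipschitz) auto
    thus "\<bar>\<mu>\<^sup>2 - e\<^sup>2\<bar> \<le> 2 * ((K + \<kappa>) * \<epsilon>)" using \<mu>e by simp
  qed (use \<beta>1 K1 \<kappa>0 \<epsilon> in auto)
  also have "\<bar>e\<^sup>2 * (\<beta> - \<beta>')\<bar> \<le> 1 * (2 * K * \<epsilon>)"
    unfolding abs_mult using e \<beta>\<beta> by (intro mult_mono) (auto simp: power_le_one)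
  finally have 2: "\<bar>\<mu>\<^sup>2 * \<beta> - e\<^sup>2 * \<beta>'\<bar> \<le> (2 * ((K + \<kappa>) * \<epsilon>)) * K + 2 * K * \<epsilon>" by simp
  have eq: "qvar (wt n * real u) S / real n = \<mu> * \<alpha> + \<mu>\<^sup>2 * \<beta>"
    using nn by (simp add: qvar_def \<mu>_def \<alpha>_def \<beta>_def power2_eq_square field_simps)
  have eq': "var_fun x = e * \<alpha>' + e\<^sup>2 * \<beta>'" by (simp add: var_fun_def e_def \<alpha>'_def \<beta>'_def)
  have "\<bar>qvar (wt n * real u) S / real n - var_fun x\<bar> \<le>
      ((K + \<kappa>) + 2 * K + 2 * (K + \<kappa>) * K + 2 * K) * \<epsilon>"
  proof -
    have "\<bar>qvar (wt n * real u) S / real n - var_fun x\<bar> \<le>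
      ((K + \<kappa>) * \<epsilon> + 2 * K * \<epsilon>) + ((2 * ((K + \<kappa>) * \<epsilon>)) * K + 2 * K * \<epsilon>)"
      unfolding eq eq' using 1 2 by linarith
    also have "\<dots> = ((K + \<kappa>) + 2 * K + 2 * (K + \<kappa>) * K + 2 * K) * \<epsilon>"
      by (simp add: algebra_simps)
    finally show ?thesis .
  qed
  also have "\<dots> \<le> (7 * K\<^sup>2 * (1 + \<kappa>)) * \<epsilon>"
  proof (intro mult_right_mono)
    have KK: "K \<le> K\<^sup>2" "1 \<le> K\<^sup>2" using K1 by (auto simp: power2_eq_square intro: mult_mono[of 1 K 1 K, simplified])
    have "\<kappa> * 1 \<le> \<kappa> * K\<^sup>2" "K * \<kappa> \<le> K\<^sup>2 * \<kappa>"
      using mult_left_mono[OF KK(2) \<kappa>0] mult_right_mono[OF KK(1) \<kappa>0] by simp_all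
    moreover have "2 * (K + \<kappa>) * K = 2 * K\<^sup>2 + 2 * (K * \<kappa>)" by (simp add: power2_eq_square algebra_simps)
    moreover have "7 * K\<^sup>2 * (1 + \<kappa>) = 7 * K\<^sup>2 + 7 * (K\<^sup>2 * \<kappa>)" by (simp add: algebra_simps)
    moreover have "\<kappa> * K\<^sup>2 = K\<^sup>2 * \<kappa>" "0 \<le> K\<^sup>2 * \<kappa>" using \<kappa>0 by (auto simp: mult.commute)
    ultimately show "(K + \<kappa>) + 2 * K + 2 * (K + \<kappa>) * K + 2 * K \<le> 7 * K\<^sup>2 * (1 + \<kappa>)"
      using KK by linarith
  qed (use \<epsilon> in simp)
  finally show ?thesis by (simp add: x_def \<epsilon>_def)
qed

text \<open>The second summand bounds \<open>\<tau>\<^sup>2 * n = \<theta>\<^sup>2 / var_lim\<close>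
  by way of \<open>var_lim_ge\<close>; the first makes the constant at least one, as
  \<open>char_leftover\<close> demands.\<close>

definition theta_const :: "real \<Rightarrow> real" where
  "theta_const \<theta> = 1 + \<theta>\<^sup>2 * exp (3 * K) / \<delta>"

text \<open>\<open>9 * K\<^sup>2\<close> joins \<open>7 * K\<^sup>2\<close> from
  \<open>qvar_approx\<close> with the error \<open>2 * K + \<kappa>\<close> of
  \<open>potential_approx\<close>; the rest is the Lipschitz constant of \<open>var_fun\<close> and
  the remainder of \<open>taylor_fixed_point_map\<close>.\<close>

definition lin_const :: real where
  "lin_const = 9 * K\<^sup>2 + 2 * K * (real k)\<^sup>2 + real k * (K * (1 + K * real k) + K * real k)"

definition char_const :: "real \<Rightarrow> real" where
  "char_const \<theta> = clt_const (theta_const \<theta>) +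
     exp (theta_const \<theta> * K) * (2 + theta_const \<theta> * lin_const * (1 + dev_const))"

text \<open>The random compensator of \<open>char_leftover\<close> is exchanged for
  \<open>exp (\<theta>\<^sup>2 / 2)\<close> and the martingale for its linearisation at
  \<open>\<rho>\<close>. Away from early death the exponents change by the order of
  \<open>(1 + \<kappa> + D S / n) / sqrt n\<close>, and \<open>late_deviation\<close> bounds the
  mean of \<open>D S / n\<close>. On early death both exponentials are merely bounded, whence the
  probability on the right.\<close>

lemma char_undiscovered:
  assumes V: "finite (V :: 'a set)" "card V = n" "U \<subseteq> V"
    and few: "(real n - real (card U))\<^sup>2 \<le> real n"
  defines "\<kappa> \<equiv> real n - real (card U)"
  shows "cmod (expect (leftover (Suc k) p V U)
      (\<lambda>S. iexp (\<theta> * ((real S - \<rho> * real n) / sd))) - exp (- (\<theta>\<^sup>2) / 2))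
    \<le> char_const \<theta> * ((1 + \<kappa>) / sqrt (real n) + expect (leftover (Suc k) p V U)
        (\<lambda>S. if (1 - \<delta>) * real n \<le> real S then 1 else 0))"
proof -
  let ?L = "leftover (Suc k) p V U"
  define r where "r = sqrt (real n)"
  \<comment> \<open>With this scale \<open>\<tau> * slope = \<theta> / sd\<close> and
    \<open>\<tau>\<^sup>2 * n * var_lim = \<theta>\<^sup>2\<close>, so phases and compensators agree
    to leading order.\<close>
  define \<tau> where "\<tau> = \<theta> / sqrt (var_lim * real n)"
  define \<Theta> where "\<Theta> = theta_const \<theta>"
  define \<mu> where "\<mu> = wt n * real (card U)"
  define P where "P = expect ?L (\<lambda>S. if (1 - \<delta>) * real n \<le> real S then 1 else 0 :: real)"
  define T where "T = real k * (K * (1 + K * real k) + K * real k)"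
  define G where "G = exp (\<Theta> * K)"
  have nn: "1 \<le> real n" using n_pos by simp
  have r0: "0 < r" and rn: "r\<^sup>2 = real n" using nn by (auto simp: r_def)
  have Un: "card U \<le> n" using V card_mono by metis
  have \<kappa>0: "0 \<le> \<kappa>" using Un by (simp add: \<kappa>_def)
  have T0: "0 \<le> T" using K1 by (simp add: T_def)
  have \<Theta>1: "1 \<le> \<Theta>" using \<delta> by (simp add: \<Theta>_def theta_const_def)
  have \<tau>2: "\<tau>\<^sup>2 * real n = \<theta>\<^sup>2 / var_lim"
    using var_lim_pos nn by (simp add: \<tau>_def power_divide)
  have \<tau>n: "\<tau>\<^sup>2 * real n \<le> \<Theta>"
  proof -
    have "\<theta>\<^sup>2 / var_lim \<le> \<theta>\<^sup>2 / (exp (- (3 * K)) * \<delta>)"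
      using var_lim_ge \<delta> var_lim_pos by (intro divide_left_mono) auto
    also have "\<dots> = \<theta>\<^sup>2 * exp (3 * K) / \<delta>" by (simp add: exp_minus field_simps)
    finally show ?thesis unfolding \<tau>2 by (simp add: \<Theta>_def theta_const_def)
  qed
  have \<theta>2: "\<theta>\<^sup>2 \<le> \<Theta>"
  proof -
    have "1 \<le> exp (3 * K)" using K1 by simp
    hence "\<delta> \<le> exp (3 * K)" using \<delta> by linarith
    hence "1 \<le> exp (3 * K) / \<delta>" by (simp only: pos_le_divide_eq[OF \<delta>(1)] mult_1)
    hence "\<theta>\<^sup>2 * 1 \<le> \<theta>\<^sup>2 * (exp (3 * K) / \<delta>)" by (intro mult_left_mono) auto
    thus ?thesis unfolding \<Theta>_def theta_const_def times_divide_eq_right by linarith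
  qed
  have \<tau>r: "\<bar>\<tau>\<bar> \<le> \<Theta> / r"
  proof -
    have "(\<bar>\<tau>\<bar> * r)\<^sup>2 \<le> \<Theta>" using \<tau>n by (simp add: power_mult_distrib rn)
    also have "\<Theta> \<le> \<Theta>\<^sup>2" using \<Theta>1 by (simp add: power2_eq_square)
    finally have "\<bar>\<tau>\<bar> * r \<le> \<Theta>" by (rule power2_le_imp_le) (use \<Theta>1 in simp)
    thus ?thesis by (simp only: pos_le_divide_eq[OF r0])
  qed
  define X where "X S = exp (complex_of_real (\<tau>\<^sup>2 * qvar \<mu> S / 2)) * iexp (\<tau> * (wt S * real S - \<mu>))" for S
  define Y where "Y S = exp (complex_of_real (\<theta>\<^sup>2 / 2)) * iexp (\<theta> * ((real S - \<rho> * real n) / sd))" for S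
  define D where "D S = (if (1 - \<delta>) * real n \<le> real S then 0 else (real S - \<rho> * real n)\<^sup>2)" for S
  define W where "W = lin_const"
  have W0: "0 \<le> W" using K1 by (simp add: W_def lin_const_def)
  have G0: "0 < G" by (simp add: G_def)
  have mu: "0 \<le> \<mu>" "\<mu> \<le> real n"
    using wt_nonneg[of n] wt_le_1[of n] Un mult_mono[of "wt n" 1 "real (card U)" "real n"] by (auto simp: \<mu>_def)
  have pointwise: "cmod (X S - Y S) \<le> 2 * G * (if (1 - \<delta>) * real n \<le> real S then 1 else 0) +
      G * (\<Theta> / r * W) * (1 + \<kappa>) + G * (\<Theta> / r * W) / real n * D S"
    if "S \<in> set_pmf ?L" for S
  proof -
    have S: "S \<le> n" using that set_leftover_le V by metis
    define A where "A = \<tau>\<^sup>2 * qvar \<mu> S / 2"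
    define B where "B = \<theta>\<^sup>2 / 2"
    define a where "a = \<tau> * (wt S * real S - \<mu>)"
    define b where "b = \<theta> * ((real S - \<rho> * real n) / sd)"
    have "\<tau>\<^sup>2 * qvar \<mu> S \<le> \<tau>\<^sup>2 * (2 * K * real n)"
      using qvar_bounds[OF mu S] by (intro mult_left_mono) auto
    also have "\<dots> = \<tau>\<^sup>2 * real n * (2 * K)" by simp
    also have "\<dots> \<le> \<Theta> * (2 * K)" using \<tau>n K1 by (intro mult_right_mono) auto
    finally have A: "A \<le> \<Theta> * K" by (simp add: A_def)
    have "\<Theta> * 1 \<le> \<Theta> * K" using \<Theta>1 K1 by (intro mult_left_mono) auto
    hence B: "B \<le> \<Theta> * K" using \<theta>2 \<Theta>1 unfolding B_def by linarith
    have XA: "cmod (X S) \<le> G" using A by (simp add: X_def A_def G_def norm_mult exp_of_real)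
    have YB: "cmod (Y S) \<le> G" using B by (simp add: Y_def B_def G_def norm_mult exp_of_real)
    have rest: "0 \<le> G * (\<Theta> / r * W) * (1 + \<kappa>) + G * (\<Theta> / r * W) / real n * D S"
      using G0 \<Theta>1 r0 W0 \<kappa>0 by (simp add: D_def)
    show ?thesis
    proof (cases "(1 - \<delta>) * real n \<le> real S")
      case True
      have "cmod (X S - Y S) \<le> 2 * G" using norm_triangle_ineq4[of "X S" "Y S"] XA YB by linarith
      thus ?thesis using True rest by simp
    next
      case False
      define x where "x = real S / real n"
      define y where "y = (real S - \<rho> * real n)\<^sup>2"
      have x: "0 \<le> x" "x \<le> 1" using S nn by (auto simp: x_def)
      have xn: "real n * (x - \<rho>) = real S - \<rho> * real n" using nn by (simp add: x_def algebra_simps)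
      have "\<theta> / sd = \<tau> * slope"
        using slope_sd sd_pos slope_pos var_lim_pos nn
        by (simp add: \<tau>_def field_simps)
      hence b: "b = \<tau> * (slope * (real S - \<rho> * real n))"
        unfolding b_def by (metis mult.assoc times_divide_eq_left times_divide_eq_right)
      have lin: "\<bar>(wt S * real S - \<mu>) - slope * (real S - \<rho> * real n)\<bar> \<le> 2 * K + \<kappa> + T * (y / real n)"
      proof -
        have "\<bar>x * exp (- (c * x ^ k)) - \<rho> * exp (- (c * \<rho> ^ k)) - slope * (x - \<rho>)\<bar> \<le> T * (x - \<rho>)\<^sup>2"
          unfolding slope_def T_def using c x \<rho> \<rho>_less_1 by (intro taylor_fixed_point_map) auto
        hence "real n * \<bar>x * exp (- (c * x ^ k)) - exp (- c) - slope * (x - \<rho>)\<bar> \<le> real n * (T * (x - \<rho>)\<^sup>2)"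
          unfolding exp_c by (intro mult_left_mono) auto
        moreover have "real n * (T * (x - \<rho>)\<^sup>2) = T * (y / real n)"
          unfolding y_def xn[symmetric] using nn by (simp add: power2_eq_square)
        moreover have "real n * \<bar>x * exp (- (c * x ^ k)) - exp (- c) - slope * (x - \<rho>)\<bar> =
            \<bar>real n * (x * exp (- (c * x ^ k)) - exp (- c)) - slope * (real S - \<rho> * real n)\<bar>"
        proof -
          have "real n * (x * exp (- (c * x ^ k)) - exp (- c) - slope * (x - \<rho>)) =
            real n * (x * exp (- (c * x ^ k)) - exp (- c)) - slope * (real S - \<rho> * real n)"
            unfolding xn[symmetric] by (simp add: algebra_simps)
          thus ?thesis using nn by (metis abs_mult abs_of_nat)
        qed
        ultimately show ?thesis
          using potential_approx[OF S Un] unfolding x_def[symmetric] \<mu>_def[symmetric] \<kappa>_def by linarith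
      qed
      have "\<bar>a - b\<bar> = \<bar>\<tau>\<bar> * \<bar>(wt S * real S - \<mu>) - slope * (real S - \<rho> * real n)\<bar>"
        unfolding a_def b by (simp add: abs_mult[symmetric] right_diff_distrib)
      also have "\<dots> \<le> \<Theta> / r * (2 * K + \<kappa> + T * (y / real n))"
        using lin \<tau>r \<Theta>1 r0 by (intro mult_mono) auto
      finally have ab: "\<bar>a - b\<bar> \<le> \<Theta> / r * (2 * K + \<kappa> + T * (y / real n))" .
      \<comment> \<open>The Lipschitz bound for \<open>var_fun\<close> is linear in the deviation,
        but only the square is controlled in mean; the arithmetic-geometric mean inequality
        exchanges one for the other.\<close>
      have x\<rho>: "\<bar>x - \<rho>\<bar> \<le> (1 + y / real n) / r"
      proof -
        have "2 * \<bar>r * (x - \<rho>)\<bar> \<le> 1 + (r * (x - \<rho>))\<^sup>2"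
          using sum_squares_bound[of 1 "\<bar>r * (x - \<rho>)\<bar>"] by simp
        moreover have "(r * (x - \<rho>))\<^sup>2 = y / real n"
          unfolding y_def xn[symmetric] power_mult_distrib rn using nn by (simp add: power2_eq_square)
        moreover have "\<bar>r * (x - \<rho>)\<bar> = r * \<bar>x - \<rho>\<bar>" using r0 by (simp add: abs_mult)
        moreover have "0 \<le> r * \<bar>x - \<rho>\<bar>" using r0 by simp
        ultimately have "r * \<bar>x - \<rho>\<bar> \<le> 1 + y / real n" by linarith
        thus ?thesis using r0 by (simp add: field_simps)
      qed
      have vf: "\<bar>qvar \<mu> S / real n - var_lim\<bar> \<le> (7 * K\<^sup>2 * (1 + \<kappa>) + 2 * K * (real k)\<^sup>2 * (1 + y / real n)) / r"
      proof -
        have "\<bar>qvar \<mu> S / real n - var_fun x\<bar> \<le> 7 * K\<^sup>2 * (1 + \<kappa>) / real n"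
          using qvar_approx[OF S Un] unfolding \<mu>_def x_def \<kappa>_def .
        also have "\<dots> \<le> 7 * K\<^sup>2 * (1 + \<kappa>) / r"
        proof (intro divide_left_mono)
          have "r * 1 \<le> r * r" using r0 nn by (intro mult_left_mono) (auto simp: r_def)
          thus "r \<le> real n" unfolding rn[symmetric] by (simp add: power2_eq_square)
        qed (use \<kappa>0 r0 nn in auto)
        finally have 1: "\<bar>qvar \<mu> S / real n - var_fun x\<bar> \<le> 7 * K\<^sup>2 * (1 + \<kappa>) / r" .
        have "\<bar>var_fun x - var_lim\<bar> \<le> 2 * K * (real k)\<^sup>2 * \<bar>x - \<rho>\<bar>"
          using var_fun_lipschitz[OF x] unfolding var_fun_\<rho> .
        also have "\<dots> \<le> 2 * K * (real k)\<^sup>2 * ((1 + y / real n) / r)"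
          using x\<rho> K1 by (intro mult_left_mono) auto
        finally have "\<bar>var_fun x - var_lim\<bar> \<le> 2 * K * (real k)\<^sup>2 * (1 + y / real n) / r" by simp
        thus ?thesis using 1 unfolding add_divide_distrib by linarith
      qed
      have AB_eq: "A - B = \<tau>\<^sup>2 * real n / 2 * (qvar \<mu> S / real n - var_lim)"
      proof -
        have eq1: "\<tau>\<^sup>2 * real n * var_lim = \<theta>\<^sup>2" unfolding \<tau>2 using var_lim_pos by simp
        have eq2: "\<tau>\<^sup>2 * real n * (qvar \<mu> S / real n) = \<tau>\<^sup>2 * qvar \<mu> S" using nn by simp
        have "t / 2 * (a - b) = (t * a - t * b) / 2" for t a b :: real by (simp add: field_simps)
        thus ?thesis unfolding A_def B_def by (simp only: eq1 eq2 diff_divide_distrib)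
      qed
      have "\<bar>A - B\<bar> = \<tau>\<^sup>2 * real n / 2 * \<bar>qvar \<mu> S / real n - var_lim\<bar>"
        unfolding AB_eq abs_mult by simp
      also have "\<dots> \<le> \<Theta> * ((7 * K\<^sup>2 * (1 + \<kappa>) + 2 * K * (real k)\<^sup>2 * (1 + y / real n)) / r)"
        using vf \<tau>n \<Theta>1 by (intro mult_mono) (auto intro: order.trans[of _ "\<tau>\<^sup>2 * real n"])
      finally have AB: "\<bar>A - B\<bar> \<le> \<Theta> / r * (7 * K\<^sup>2 * (1 + \<kappa>) + 2 * K * (real k)\<^sup>2 * (1 + y / real n))"
        by simp
      have y0: "0 \<le> y / real n" by (simp add: y_def)
      have sum: "\<bar>A - B\<bar> + \<bar>a - b\<bar> \<le> \<Theta> / r * (W * ((1 + \<kappa>) + y / real n))"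
      proof -
        have "(7 * K\<^sup>2 * (1 + \<kappa>) + 2 * K * (real k)\<^sup>2 * (1 + y / real n)) + (2 * K + \<kappa> + T * (y / real n))
          \<le> W * ((1 + \<kappa>) + y / real n)"
        proof -
          have KK: "K \<le> K\<^sup>2" "1 \<le> K\<^sup>2" using K1 by (auto simp: power2_eq_square intro: mult_mono[of 1 K 1 K, simplified])
          have e1: "W * ((1 + \<kappa>) + y / real n) = 9 * K\<^sup>2 * (1 + \<kappa>) + 9 * K\<^sup>2 * (y / real n) +
            2 * K * (real k)\<^sup>2 * (1 + \<kappa>) + 2 * K * (real k)\<^sup>2 * (y / real n) + T * (1 + \<kappa>) + T * (y / real n)"
            unfolding W_def lin_const_def T_def[symmetric] by (simp only: distrib_left distrib_right)
          have "2 * K + \<kappa> \<le> 2 * K\<^sup>2 + 2 * (K\<^sup>2 * \<kappa>)"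
            using KK \<kappa>0 mult_right_mono[of 1 "K\<^sup>2" \<kappa>] by linarith
          hence e2: "2 * K + \<kappa> \<le> 2 * K\<^sup>2 * (1 + \<kappa>)" by (simp add: distrib_left)
          have "0 \<le> 2 * K * (real k)\<^sup>2 * \<kappa>" using K1 \<kappa>0 by simp
          hence e3: "2 * K * (real k)\<^sup>2 * (1 + y / real n) \<le> 2 * K * (real k)\<^sup>2 * (1 + \<kappa>) + 2 * K * (real k)\<^sup>2 * (y / real n)"
            unfolding distrib_left by linarith
          have e4: "0 \<le> 9 * K\<^sup>2 * (y / real n)" "0 \<le> T * (1 + \<kappa>)" using y0 T0 \<kappa>0 by (auto intro!: mult_nonneg_nonneg simp del: times_divide_eq_right)
          have e5: "9 * K\<^sup>2 * (1 + \<kappa>) = 7 * K\<^sup>2 * (1 + \<kappa>) + 2 * K\<^sup>2 * (1 + \<kappa>)" by (simp add: algebra_simps)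
          show ?thesis using e1 e2 e3 e4 e5 by argo
        qed
        from mult_left_mono[OF this, of "\<Theta> / r"]
        have "\<Theta> / r * (7 * K\<^sup>2 * (1 + \<kappa>) + 2 * K * (real k)\<^sup>2 * (1 + y / real n)) +
            \<Theta> / r * (2 * K + \<kappa> + T * (y / real n)) \<le> \<Theta> / r * (W * ((1 + \<kappa>) + y / real n))"
          using \<Theta>1 r0 unfolding distrib_left[of "\<Theta> / r" "_ + _" "2 * K + \<kappa> + T * (y / real n)"] by simp
        with add_mono[OF AB ab] show ?thesis by (rule order.trans)
      qed
      \<comment> \<open>The compensator is changed under the old phase, then the phase under the new
        compensator.\<close>
      have "X S - Y S = complex_of_real (exp A - exp B) * iexp a + complex_of_real (exp B) * (iexp a - iexp b)"
        unfolding X_def Y_def A_def B_def a_def b_def by (simp add: exp_of_real[symmetric] algebra_simps)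
      hence "cmod (X S - Y S) \<le> \<bar>exp A - exp B\<bar> + exp B * cmod (iexp a - iexp b)"
        by (metis (no_types, lifting) norm_triangle_ineq norm_mult norm_of_real norm_exp_i_times mult_1_right abs_exp_cancel)
      also have "\<dots> \<le> G * \<bar>A - B\<bar> + G * \<bar>a - b\<bar>"
        using exp_diff_le[OF A B] cmod_iexp_diff[of a b] B
        by (intro add_mono mult_mono) (auto simp: G_def)
      also have "\<dots> = G * (\<bar>A - B\<bar> + \<bar>a - b\<bar>)" by (simp add: distrib_left)
      also have "\<dots> \<le> G * (\<Theta> / r * (W * ((1 + \<kappa>) + y / real n)))"
        using sum G0 by (intro mult_left_mono) auto
      also have "\<dots> = G * (\<Theta> / r * W) * (1 + \<kappa>) + G * (\<Theta> / r * W) / real n * D S"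
      proof -
        have "D S = y" using False by (simp add: D_def y_def)
        moreover have "G * (C * (W * (a + y / N))) = G * (C * W) * a + G * (C * W) / N * y"
          for C a N :: real by (simp add: algebra_simps)
        ultimately show ?thesis by (simp only:)
      qed
      finally show ?thesis using False by simp
    qed
  qed
  have fin: "finite (set_pmf ?L)" using V by simp
  have "cmod (expect ?L X - expect ?L Y) \<le>
      expect ?L (\<lambda>S. cmod (X S - Y S))"
    unfolding expectation_diff_finite[OF fin, symmetric] by (rule norm_expectation_le)
  also have "\<dots> \<le> expect ?L (\<lambda>S. 2 * G * (if (1 - \<delta>) * real n \<le> real S then 1 else 0) +
      G * (\<Theta> / r * W) * (1 + \<kappa>) + G * (\<Theta> / r * W) / real n * D S)"
    by (intro expectation_mono_finite fin pointwise)
  also have "\<dots> = 2 * G * P + G * (\<Theta> / r * W) * (1 + \<kappa>) + G * (\<Theta> / r * W) / real n * expect ?L D"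
    using fin by (simp add: expectation_add_finite P_def)
  also have "\<dots> \<le> 2 * G * P + G * (\<Theta> / r * W) * (1 + \<kappa>) + G * (\<Theta> / r * W) / real n * (dev_const * real n)"
    using late_deviation[OF V few] G0 \<Theta>1 r0 W0 unfolding D_def
    by (intro add_left_mono mult_left_mono) auto
  also have "\<dots> = 2 * G * P + G * \<Theta> * W * ((1 + \<kappa>) + dev_const) / r"
    using nn r0 by (simp add: field_simps)
  finally have XY: "cmod (expect ?L X - expect ?L Y) \<le>
      2 * G * P + G * \<Theta> * W * ((1 + \<kappa>) + dev_const) / r" .
  have X1: "cmod (expect ?L X - 1) \<le> clt_const \<Theta> / r"
    unfolding X_def r_def \<mu>_def by (rule char_leftover[OF V \<Theta>1 \<tau>n])
  define F where "F = expect ?L (\<lambda>S. iexp (\<theta> * ((real S - \<rho> * real n) / sd)))"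
  have EY: "expect ?L Y = exp (complex_of_real (\<theta>\<^sup>2 / 2)) * F"
    unfolding F_def Y_def[abs_def] by (rule integral_mult_right_zero)
  \<comment> \<open>Undoing the compensator multiplies the error by
    \<open>exp (- (\<theta>\<^sup>2) / 2) \<le> 1\<close>.\<close>
  have "F - exp (- (\<theta>\<^sup>2) / 2) = exp (complex_of_real (- (\<theta>\<^sup>2) / 2)) * (exp (complex_of_real (\<theta>\<^sup>2 / 2)) * F - 1)"
    by (simp add: right_diff_distrib mult.assoc[symmetric] exp_add[symmetric] exp_of_real[symmetric])
  hence "cmod (F - exp (- (\<theta>\<^sup>2) / 2)) = exp (- (\<theta>\<^sup>2) / 2) * cmod (expect ?L Y - 1)"
    unfolding EY by (simp only: norm_mult exp_of_real norm_of_real abs_exp_cancel)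
  also have "\<dots> \<le> 1 * cmod (expect ?L Y - 1)" by (intro mult_right_mono) auto
  also have "\<dots> \<le> cmod (expect ?L X - 1) + cmod (expect ?L X - expect ?L Y)"
    using norm_triangle_ineq4[of "expect ?L X - 1" "expect ?L X - expect ?L Y"]
    by simp
  also have "\<dots> \<le> clt_const \<Theta> / r + (2 * G * P + G * \<Theta> * W * ((1 + \<kappa>) + dev_const) / r)"
    using X1 XY by linarith
  also have "\<dots> \<le> char_const \<theta> * ((1 + \<kappa>) / r + P)"
  proof -
    have P0: "0 \<le> P" unfolding P_def by (intro expectation_nonneg) auto
    have C0: "0 \<le> clt_const \<Theta>" using mom_ge by (simp add: clt_const_def)
    have d0: "0 \<le> dev_const" using mom_ge by (simp add: dev_const_def)
    define q where "q = (1 + \<kappa>) / r"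
    have q: "1 / r \<le> q" "0 \<le> q" using \<kappa>0 r0 by (auto simp: q_def divide_right_mono)
    have "((1 + \<kappa>) + dev_const) / r = q + dev_const * (1 / r)" by (simp add: q_def add_divide_distrib)
    also have "\<dots> \<le> q + dev_const * q" using q d0 by (intro add_left_mono mult_left_mono) auto
    finally have "((1 + \<kappa>) + dev_const) / r \<le> (1 + dev_const) * q" by (simp add: distrib_right)
    hence "G * \<Theta> * W * (((1 + \<kappa>) + dev_const) / r) \<le> G * \<Theta> * W * ((1 + dev_const) * q)"
      using G0 \<Theta>1 W0 by (intro mult_left_mono) auto
    moreover have "clt_const \<Theta> / r \<le> clt_const \<Theta> * q"
      using mult_left_mono[OF q(1) C0] by simp
    moreover have "char_const \<theta> * (q + P) = clt_const \<Theta> * q + clt_const \<Theta> * P + 2 * G * q + 2 * G * P +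
        G * \<Theta> * W * ((1 + dev_const) * q) + G * \<Theta> * W * ((1 + dev_const) * P)"
      unfolding char_const_def \<Theta>_def[symmetric] W_def[symmetric] G_def[symmetric] by (simp add: algebra_simps)
    moreover have "0 \<le> clt_const \<Theta> * P" "0 \<le> 2 * G * q" "0 \<le> G * \<Theta> * W * ((1 + dev_const) * P)"
      using P0 C0 G0 q \<Theta>1 W0 d0 by auto
    ultimately show ?thesis unfolding q_def[symmetric] by (simp add: algebra_simps)
  qed
  finally show ?thesis unfolding F_def r_def P_def \<kappa>_def .
qed

end

subsection \<open>Uniqueness of the giant component\<close>

text \<open>A chain of intersecting edges passes from each edge to the next at a common vertex, so
  it is a walk along \<open>link\<close>. Conversely, chains of a single edge suffice because
  \<open>reachable\<close> is transitive.\<close>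

lemma reachable_Image_eq_cluster:
  assumes E: "E \<subseteq> Pow V" and v: "v \<in> V"
  shows "reachable (V, E) `` {v} = cluster E {v}"
proof
  have chain: "last es \<subseteq> cluster E {x}"
    if "es \<noteq> []" "set es \<subseteq> E" "successively (\<lambda>e f. e \<inter> f \<noteq> {}) es" "x \<in> hd es" for es x
    using that
  proof (induction es arbitrary: x rule: list_nonempty_induct)
    case (single e)
    have "x \<in> cluster E {x}" by (rule cluster_self)
    thus ?case using single cluster_link[of x E "{x}" e] by auto
  next
    case (cons e es)
    then obtain y where y: "y \<in> e" "y \<in> hd es" by (cases es) auto
    have "x \<in> cluster E {x}" by (rule cluster_self)
    hence "y \<in> cluster E {x}" using cluster_link[of x E "{x}" e y] y cons.prems by auto
    moreover have "last es \<subseteq> cluster E {y}"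
      using cons.IH[of y] cons.prems cons.hyps y by (cases es) auto
    ultimately show ?case using cons.hyps cluster_eq[of y E x] by simp
  qed
  show "reachable (V, E) `` {v} \<subseteq> cluster E {v}"
  proof
    fix w assume "w \<in> reachable (V, E) `` {v}"
    hence "v = w \<or> (\<exists>es. es \<noteq> [] \<and> set es \<subseteq> E \<and> v \<in> hd es \<and> w \<in> last es \<and>
        successively (\<lambda>e f. e \<inter> f \<noteq> {}) es)"
      by (auto simp: reachable_def)
    thus "w \<in> cluster E {v}"
    proof
      assume "v = w"
      thus ?thesis using subset_cluster[of "{v}" E] by simp
    next
      assume "\<exists>es. es \<noteq> [] \<and> set es \<subseteq> E \<and> v \<in> hd es \<and> w \<in> last es \<and>
        successively (\<lambda>e f. e \<inter> f \<noteq> {}) es"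
      then obtain es where "es \<noteq> []" "set es \<subseteq> E" "v \<in> hd es" "w \<in> last es"
        "successively (\<lambda>e f. e \<inter> f \<noteq> {}) es" by blast
      thus ?thesis using chain[of es v] by blast
    qed
  qed
  show "cluster E {v} \<subseteq> reachable (V, E) `` {v}"
  proof (rule cluster_least)
    show "{v} \<subseteq> reachable (V, E) `` {v}" using v by (simp add: reachable_def)
    fix e x w assume *: "e \<in> E" "x \<in> e" "w \<in> e" "x \<in> reachable (V, E) `` {v}"
    have "\<exists>es. es \<noteq> [] \<and> set es \<subseteq> E \<and> x \<in> hd es \<and> w \<in> last es \<and>
        successively (\<lambda>e f. e \<inter> f \<noteq> {}) es"
      using * by (intro exI[of _ "[e]"]) auto
    hence "(x, w) \<in> reachable (V, E)" using * E by (auto simp: reachable_def)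
    moreover have "trans (reachable (V, E))"
      using equiv_reachable[of "(V, E)"] by (simp add: equiv_def)
    ultimately show "w \<in> reachable (V, E) `` {v}" using *(4) by (auto dest: transD)
  qed
qed

lemma max_component_order_eq:
  assumes "E \<subseteq> Pow V"
  shows "max_component_order (V, E) = Max ((\<lambda>v. card (cluster E {v})) ` V)"
proof -
  have "components (V, E) = (\<lambda>v. reachable (V, E) `` {v}) ` V"
    by (auto simp: components_def quotient_def)
  also have "\<dots> = (\<lambda>v. cluster E {v}) ` V"
    using assms by (intro image_cong refl reachable_Image_eq_cluster)
  finally show ?thesis by (simp add: max_component_order_def image_image)
qed

text \<open>The deterministic part of uniqueness. Two distinct large clusters of seeds would both
  fit into the seeded cluster, so
  \<open>2 * (\<alpha> - \<epsilon>) \<le> \<alpha> + \<epsilon>\<close>, against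
  \<open>4 * \<epsilon> \<le> \<delta> < \<alpha>\<close>. Hence the seeded cluster is one large
  cluster together with small clusters of seeds, and these have at most \<open>Y\<close>
  vertices.\<close>

lemma largest_cluster_near_seeded_cluster:
  fixes \<delta> \<epsilon> \<alpha> :: real
  assumes V: "finite V" "\<Union>E \<subseteq> V" "R \<subseteq> V" and pos: "0 < \<epsilon>" "4 * \<epsilon> \<le> \<delta>" "\<delta> < \<alpha>" "0 < N"
  defines "T \<equiv> \<lambda>R. real (card (cluster E R))"
  defines "Y \<equiv> \<Sum>v\<in>R. if T {v} \<le> \<delta> * N then T {v} else 0"
  assumes TR: "\<delta> * N < T R"
    and midR: "\<bar>T R - \<alpha> * N\<bar> \<le> \<epsilon> * N"
    and mid: "\<And>v. v \<in> R \<Longrightarrow> T {v} \<le> \<delta> * N \<or> \<bar>T {v} - \<alpha> * N\<bar> \<le> \<epsilon> * N"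
    and Y: "Y \<le> \<delta> * N"
    and out: "\<And>v. v \<in> V \<Longrightarrow> v \<notin> cluster E R \<Longrightarrow> T {v} \<le> \<delta> * N"
  shows "\<bar>real (Max ((\<lambda>v. card (cluster E {v})) ` V)) - T R\<bar> \<le> Y"
proof -
  have fin: "finite (cluster E W)" if "W \<subseteq> V" for W
    using cluster_subset[OF that V(2)] V(1) finite_subset by blast
  have finR: "finite R" using V finite_subset by blast
  have Y0: "0 \<le> Y" unfolding Y_def T_def by (intro sum_nonneg) auto
  \<comment> \<open>If every seed had a small cluster, these would cover the seeded cluster, and
    \<open>Y\<close> would exceed \<open>\<delta> * N\<close>.\<close>
  have "\<exists>v\<in>R. \<delta> * N < T {v}"
  proof (rule ccontr)
    assume "\<not> (\<exists>v\<in>R. \<delta> * N < T {v})"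
    hence "Y = (\<Sum>v\<in>R. T {v})" unfolding Y_def by (intro sum.cong) (auto simp: not_less)
    moreover have "card (cluster E R) \<le> (\<Sum>v\<in>R. card (cluster E {v}))"
      unfolding cluster_UN[of E R] by (rule card_UN_le[OF finR])
    hence "T R \<le> (\<Sum>v\<in>R. T {v})" unfolding T_def by (simp flip: of_nat_sum)
    ultimately show False using TR Y by linarith
  qed
  then obtain v where v: "v \<in> R" "\<delta> * N < T {v}" by blast
  have same: "cluster E {w} = cluster E {v}" if w: "w \<in> R" "\<delta> * N < T {w}" for w
  proof (rule ccontr)
    assume ne: "cluster E {w} \<noteq> cluster E {v}"
    have "cluster E {w} \<union> cluster E {v} \<subseteq> cluster E R"
      using cluster_UN[of E R] w v by blast
    hence "card (cluster E {w} \<union> cluster E {v}) \<le> card (cluster E R)"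
      by (intro card_mono fin V)
    moreover have "card (cluster E {w} \<union> cluster E {v}) = card (cluster E {w}) + card (cluster E {v})"
      using cluster_disjoint[OF ne] w v V by (intro card_Un_disjoint fin) auto
    ultimately have "T {w} + T {v} \<le> T R" unfolding T_def by linarith
    moreover have "\<alpha> * N - \<epsilon> * N \<le> T {w}" "\<alpha> * N - \<epsilon> * N \<le> T {v}"
      using mid[OF w(1)] mid[OF v(1)] w v by linarith+
    ultimately have "\<alpha> * N \<le> 3 * (\<epsilon> * N)" using midR by linarith
    moreover have "4 * (\<epsilon> * N) < \<alpha> * N"
      using pos mult_strict_right_mono[of "4 * \<epsilon>" \<alpha> N] by simp
    moreover have "0 < \<epsilon> * N" using pos by simp
    ultimately show False by linarith
  qed
  have small: "T {w} \<le> Y" if "w \<in> R" "T {w} \<le> \<delta> * N" for w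
  proof -
    have "(if T {w} \<le> \<delta> * N then T {w} else 0) \<le> Y"
      unfolding Y_def by (rule member_le_sum) (use that finR in \<open>auto simp: T_def\<close>)
    thus ?thesis using that by simp
  qed
  have le: "T {w} \<le> T {v}" if w: "w \<in> V" for w
  proof (cases "w \<in> cluster E R")
    case False
    thus ?thesis using out[OF w] v by linarith
  next
    case True
    then obtain x where x: "x \<in> R" "w \<in> cluster E {x}" using cluster_UN[of E R] by blast
    have "T {w} = T {x}" using cluster_eq[OF x(2)] by (simp add: T_def)
    moreover have "T {x} \<le> T {v}"
    proof (cases "\<delta> * N < T {x}")
      case True
      with same[OF x(1)] have "cluster E {x} = cluster E {v}" .
      thus ?thesis by (simp only: T_def order.refl)
    qed (use v in linarith)
    ultimately show ?thesis by simp
  qed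
  have cov: "cluster E R \<subseteq> cluster E {v} \<union> (\<Union>w\<in>{w \<in> R. T {w} \<le> \<delta> * N}. cluster E {w})"
  proof
    fix x assume "x \<in> cluster E R"
    then obtain w where w: "w \<in> R" "x \<in> cluster E {w}" using cluster_UN[of E R] by blast
    show "x \<in> cluster E {v} \<union> (\<Union>w\<in>{w \<in> R. T {w} \<le> \<delta> * N}. cluster E {w})"
    proof (cases "\<delta> * N < T {w}")
      case True
      thus ?thesis using same[OF w(1)] w(2) by simp
    next
      case False
      thus ?thesis using w by (auto simp: not_less)
    qed
  qed
  have Max_eq: "Max ((\<lambda>v. card (cluster E {v})) ` V) = card (cluster E {v})"
  proof (rule Max_eqI)
    show "y \<le> card (cluster E {v})" if "y \<in> (\<lambda>v. card (cluster E {v})) ` V" for y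
      using that le unfolding T_def by auto
  qed (use V v in auto)
  have "cluster E {v} \<subseteq> cluster E R" using cluster_UN[of E R] v by blast
  hence lower: "T {v} \<le> T R" unfolding T_def using fin[OF V(3)] by (simp add: card_mono)
  let ?S = "{w \<in> R. T {w} \<le> \<delta> * N}"
  have "card (cluster E R) \<le> card (cluster E {v} \<union> (\<Union>w\<in>?S. cluster E {w}))"
    using V v finR by (intro card_mono[OF _ cov] finite_UnI finite_UN_I fin) auto
  also have "\<dots> \<le> card (cluster E {v}) + card (\<Union>w\<in>?S. cluster E {w})" by (rule card_Un_le)
  also have "card (\<Union>w\<in>?S. cluster E {w}) \<le> (\<Sum>w\<in>?S. card (cluster E {w}))"
    using finR by (intro card_UN_le) auto
  finally have "T R \<le> T {v} + (\<Sum>w\<in>?S. T {w})" unfolding T_def by (simp flip: of_nat_sum of_nat_add)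
  also have "(\<Sum>w\<in>?S. T {w}) = Y"
    unfolding Y_def using finR by (simp add: sum.inter_filter)
  finally show ?thesis using lower Y0 unfolding Max_eq T_def[symmetric] by (simp add: T_def)
qed

lemma expectation_size_eq_leftover:
  fixes f :: "nat \<Rightarrow> 'b::{banach, second_countable_topology}"
  assumes "finite V" "R \<subseteq> V"
  shows "expect (leftover d p V (V - R)) f =
    expect (random_subset p (nsets V d)) (\<lambda>E. f (card V - card (cluster E R)))"
proof -
  have R: "V - (V - R) = R" using assms by auto
  show ?thesis unfolding leftover_def integral_map_pmf R
  proof (rule expectation_cong_pmf)
    fix E assume "E \<in> set_pmf (random_subset p (nsets V d))"
    hence "E \<subseteq> nsets V d" by (rule set_random_subset)
    hence "\<Union>E \<subseteq> V" by (auto simp: nsets_def)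
    hence "cluster E R \<subseteq> V" using assms by (intro cluster_subset)
    thus "f (card (V - cluster E R)) = f (card V - card (cluster E R))"
      using assms by (simp add: card_Diff_subset finite_subset)
  qed
qed

section \<open>Small, atypical and stray clusters of the random hypergraph\<close>

context giant_regime
begin

abbreviation "G \<equiv> random_subset p (nsets {1..n} (Suc k))"
abbreviation "T \<equiv> \<lambda>E R. real (card (cluster E R))"

lemma finite_G [simp]: "finite (set_pmf G)"
  by simp

lemma G_subset:
  assumes "E \<in> set_pmf G"
  shows "\<Union>E \<subseteq> {1..n}" "E \<subseteq> Pow {1..n}"
  using set_random_subset[OF assms] by (auto simp: nsets_def)

lemma T_le_n: "E \<in> set_pmf G \<Longrightarrow> R \<subseteq> {1..n} \<Longrightarrow> T E R \<le> real n"
  using card_mono[OF _ cluster_subset[OF _ G_subset(1)], of R E] by simp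

lemma n_minus: "E \<in> set_pmf G \<Longrightarrow> R \<subseteq> {1..n} \<Longrightarrow> real (n - card (cluster E R)) = real n - T E R"
  using T_le_n by (simp add: of_nat_diff)

lemma early_cond: "(1 - \<delta>) * real n \<le> real n - t \<longleftrightarrow> t \<le> \<delta> * real n"
  by (simp add: left_diff_distrib)

lemma card_co: "R \<subseteq> {1..n} \<Longrightarrow> real n - real (card ({1..n} - R)) = real (card R)"
  by (simp add: card_Diff_subset finite_subset[OF _ finite_atLeastAtMost] of_nat_diff card_mono[of "{1..n}", simplified])

lemma small_cluster:
  assumes "R \<subseteq> {1..n}"
  shows "expect G (\<lambda>E. if T E R \<le> \<delta> * real n then exp (zt * T E R) else 0)
    \<le> exp (- (lam * real (card R)))"
proof -
  have "expect (leftover (Suc k) p {1..n} ({1..n} - R))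
      (\<lambda>S. if (1 - \<delta>) * real n \<le> real S then exp (zt * (real n - real S)) else 0)
    \<le> exp (- (lam * real (card R)))"
    using early_death[of "{1..n}" "{1..n} - R"] card_co[OF assms] by simp
  also have "expect (leftover (Suc k) p {1..n} ({1..n} - R))
      (\<lambda>S. if (1 - \<delta>) * real n \<le> real S then exp (zt * (real n - real S)) else 0) =
    expect G (\<lambda>E. if T E R \<le> \<delta> * real n then exp (zt * T E R) else 0)"
    using assms
    by (subst expectation_size_eq_leftover) (auto intro!: expectation_cong_pmf simp: n_minus early_cond)
  finally show ?thesis .
qed

lemma prob_small:
  assumes "R \<subseteq> {1..n}"
  shows "measure_pmf.prob G {E. T E R \<le> \<delta> * real n} \<le> exp (- (lam * real (card R)))"
proof (rule order.trans[OF prob_le_expectation small_cluster[OF assms]])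
  fix E assume "E \<in> {E. T E R \<le> \<delta> * real n}"
  thus "1 \<le> (if T E R \<le> \<delta> * real n then exp (zt * T E R) else 0)"
    using zt_pos by simp
qed (auto simp: zero_le_mult_iff)

text \<open>The exponential moment in \<open>small_cluster\<close> dominates through
  \<open>t \<le> exp (zt * t) / zt\<close>. The bound is free of \<open>n\<close>, so the small
  clusters of all seeds have total mean size at most proportional to the number of seeds.\<close>

lemma expectation_small:
  assumes "v \<in> {1..n}"
  shows "expect G (\<lambda>E. if T E {v} \<le> \<delta> * real n then T E {v} else 0) \<le> 1 / zt"
proof -
  have "expect G (\<lambda>E. if T E {v} \<le> \<delta> * real n then T E {v} else 0) \<le>
    expect G (\<lambda>E. 1 / zt * (if T E {v} \<le> \<delta> * real n then exp (zt * T E {v}) else 0))"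
  proof (rule expectation_mono_finite)
    fix E
    have "zt * T E {v} \<le> exp (zt * T E {v})" using exp_ge_add_one_self[of "zt * T E {v}"] by linarith
    hence "T E {v} \<le> 1 / zt * exp (zt * T E {v})" using zt_pos by (simp add: field_simps)
    thus "(if T E {v} \<le> \<delta> * real n then T E {v} else 0) \<le>
      1 / zt * (if T E {v} \<le> \<delta> * real n then exp (zt * T E {v}) else 0)" by simp
  qed simp
  also have "\<dots> = 1 / zt * expect G (\<lambda>E. if T E {v} \<le> \<delta> * real n then exp (zt * T E {v}) else 0)"
    by (rule integral_mult_right_zero)
  also have "\<dots> \<le> 1 / zt * 1"
    using small_cluster[of "{v}"] assms zt_pos lam_pos
    by (intro mult_left_mono) (auto intro: order.trans)
  finally show ?thesis by simp
qed

text \<open>A cluster missing the seeds \<open>R\<close> but large makes one of the seed sets \<open>R\<close>, \<open>{v}\<close>, \<open>insert v R\<close> atypical, and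
  it contributes at least \<open>\<delta> n\<close> such vertices \<open>v\<close>; so Markov's inequality excludes it.\<close>

definition atypical :: "nat set \<Rightarrow> nat set set set" where
  "atypical R = {E. \<delta> * real n < T E R \<and> \<delta> / 4 * real n < \<bar>T E R - (1 - \<rho>) * real n\<bar>}"

lemma not_atypical:
  assumes "E \<notin> atypical R" "\<delta> * real n < T E R"
  shows "\<bar>T E R - (1 - \<rho>) * real n\<bar> \<le> \<delta> / 4 * real n"
  using assms unfolding atypical_def by (simp add: not_less)

definition atyp_const :: real where "atyp_const = 16 * dev_const / \<delta>\<^sup>2"

text \<open>Chebyshev's inequality: the second moment is of order \<open>n\<close> by
  \<open>late_deviation\<close> and the threshold \<open>\<delta> / 4 * n\<close> of order
  \<open>n\<close>; its square accounts for the \<open>16\<close> in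
  \<open>atyp_const\<close>.\<close>

lemma prob_atypical:
  assumes "R \<subseteq> {1..n}" "(real (card R))\<^sup>2 \<le> real n"
  shows "measure_pmf.prob G (atypical R) \<le> atyp_const / real n"
proof -
  have nn: "0 < real n" using n_pos by simp
  define q where "q = (\<delta> / 4 * real n)\<^sup>2"
  have q0: "0 < q" using \<delta> nn by (simp add: q_def)
  let ?g = "\<lambda>E. if T E R \<le> \<delta> * real n then 0 else (real n - T E R - \<rho> * real n)\<^sup>2"
  have "expect (leftover (Suc k) p {1..n} ({1..n} - R))
      (\<lambda>S. if (1 - \<delta>) * real n \<le> real S then 0 else (real S - \<rho> * real n)\<^sup>2) \<le> dev_const * real n"
    using late_deviation[of "{1..n}" "{1..n} - R"] card_co[OF assms(1)] assms(2) by simp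
  also have "expect (leftover (Suc k) p {1..n} ({1..n} - R))
      (\<lambda>S. if (1 - \<delta>) * real n \<le> real S then 0 else (real S - \<rho> * real n)\<^sup>2) =
    expect G ?g"
    using assms
    by (subst expectation_size_eq_leftover) (auto intro!: expectation_cong_pmf simp: n_minus early_cond)
  finally have g: "expect G ?g \<le> dev_const * real n" .
  have "measure_pmf.prob G (atypical R) \<le> expect G (\<lambda>E. ?g E / q)"
  proof (rule prob_le_expectation)
    fix E assume "E \<in> atypical R"
    hence *: "\<delta> * real n < T E R" "\<delta> / 4 * real n < \<bar>T E R - (1 - \<rho>) * real n\<bar>"
      by (auto simp: atypical_def)
    have "q \<le> \<bar>T E R - (1 - \<rho>) * real n\<bar>\<^sup>2"
      unfolding q_def using * \<delta> nn by (intro power_mono) auto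
    also have "\<dots> = (real n - T E R - \<rho> * real n)\<^sup>2"
      by (simp add: power2_eq_square algebra_simps)
    finally show "1 \<le> ?g E / q" using * q0 by simp
  qed (use q0 in auto)
  also have "\<dots> = expect G ?g / q" by simp
  also have "\<dots> \<le> dev_const * real n / q" using g q0 by (intro divide_right_mono) auto
  also have "\<dots> = atyp_const / real n"
    using nn \<delta> by (simp add: atyp_const_def q_def power2_eq_square field_simps)
  finally show ?thesis .
qed

definition stray :: "nat set \<Rightarrow> nat set set \<Rightarrow> nat set" where
  "stray R E = {v \<in> {1..n}. v \<notin> cluster E R \<and> \<delta> * real n < T E {v}}"

text \<open>Each of the \<open>n\<close> summands of \<open>?f\<close> has mean of order
  \<open>1 / n\<close>, so \<open>?f\<close> has bounded mean, while the event forces it to be at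
  least \<open>\<delta> * n\<close>. The bound on \<open>card R + 1\<close> is for the seed set
  \<open>insert v R\<close>.\<close>

lemma prob_stray:
  assumes R: "R \<subseteq> {1..n}" "(real (card R) + 1)\<^sup>2 \<le> real n"
  shows "measure_pmf.prob G {E. \<delta> * real n < T E R \<and> stray R E \<noteq> {}} \<le> 3 * atyp_const / (\<delta> * real n)"
proof -
  have nn: "0 < real n" using n_pos by simp
  have finR: "finite R" using R finite_subset by blast
  have "(real (card R))\<^sup>2 \<le> (real (card R) + 1)\<^sup>2" by (intro power_mono) auto
  hence R2: "(real (card R))\<^sup>2 \<le> real n" using R by linarith
  have "1 \<le> (real (card R) + 1)\<^sup>2" by (intro one_le_power) simp
  hence n1: "1 \<le> real n" using R by linarith
  let ?f = "\<lambda>E. \<Sum>v\<in>{1..n}. of_bool (E \<in> atypical R) + of_bool (E \<in> atypical {v}) + of_bool (E \<in> atypical (insert v R)) :: real"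
  have "measure_pmf.prob G {E. \<delta> * real n < T E R \<and> stray R E \<noteq> {}} \<le>
    expect G (\<lambda>E. ?f E / (\<delta> * real n))"
  proof (rule prob_le_expectation)
    fix E assume E: "E \<in> set_pmf G" and *: "E \<in> {E. \<delta> * real n < T E R \<and> stray R E \<noteq> {}}"
    have fin: "finite (cluster E W)" if "W \<subseteq> {1..n}" for W
      using cluster_subset[OF that G_subset(1)[OF E]] finite_subset by blast
    from * obtain v where v: "v \<in> stray R E" and TR: "\<delta> * real n < T E R" by blast
    have v': "v \<in> {1..n}" "v \<notin> cluster E R" "\<delta> * real n < T E {v}" using v by (auto simp: stray_def)
    have "cluster E {v} \<subseteq> stray R E"
    proof
      fix w assume w: "w \<in> cluster E {v}"
      hence eq: "cluster E {w} = cluster E {v}" by (rule cluster_eq)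
      have "w \<in> {1..n}" using cluster_subset[OF _ G_subset(1)[OF E], of "{v}"] v' w by blast
      moreover have "w \<notin> cluster E R"
      proof
        assume "w \<in> cluster E R"
        then obtain x where x: "x \<in> R" "w \<in> cluster E {x}" using cluster_UN[of E R] by blast
        have "v \<in> cluster E {w}" using w by (rule cluster_sym)
        hence "v \<in> cluster E {x}" using x(2) cluster_trans by metis
        thus False using v'(2) x(1) cluster_UN[of E R] by blast
      qed
      ultimately show "w \<in> stray R E" using eq v' by (simp add: stray_def)
    qed
    hence "T E {v} \<le> real (card (stray R E))" by (simp add: stray_def card_mono)
    hence big: "\<delta> * real n \<le> real (card (stray R E))" using v' by linarith
    have "real (card (stray R E)) = (\<Sum>v\<in>{1..n}. of_bool (v \<in> stray R E))"
      by (simp add: sum_of_bool_eq stray_def Int_def conj_commute)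
    also have "\<dots> \<le> ?f E"
    proof (rule sum_mono)
      fix v assume v: "v \<in> {1..n}"
      have "E \<in> atypical R \<or> E \<in> atypical {v} \<or> E \<in> atypical (insert v R)" if s: "v \<in> stray R E"
      proof (rule ccontr)
        assume "\<not> ?thesis"
        hence na': "E \<notin> atypical R" "E \<notin> atypical {v}" "E \<notin> atypical (insert v R)" by auto
        have sv: "v \<notin> cluster E R" "\<delta> * real n < T E {v}" using s by (auto simp: stray_def)
        have disj: "cluster E R \<inter> cluster E {v} = {}"
        proof (rule ccontr)
          assume "cluster E R \<inter> cluster E {v} \<noteq> {}"
          then obtain w x where "w \<in> cluster E {v}" "x \<in> R" "w \<in> cluster E {x}"
            using cluster_UN[of E R] by blast
          hence "v \<in> cluster E {x}" using cluster_sym[of w E v] cluster_trans[of w E x v] by blast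
          thus False using sv(1) \<open>x \<in> R\<close> cluster_UN[of E R] by blast
        qed
        have "cluster E (insert v R) = cluster E R \<union> cluster E {v}"
          using cluster_Un[of E R "{v}"] by simp
        hence sum: "T E (insert v R) = T E R + T E {v}"
          using disj v R fin by (simp add: card_Un_disjoint)
        have "(1 - \<rho>) * real n - \<delta> / 4 * real n \<le> T E R"
          using not_atypical[OF na'(1) TR] by linarith
        moreover have "(1 - \<rho>) * real n - \<delta> / 4 * real n \<le> T E {v}"
          using not_atypical[OF na'(2) sv(2)] by linarith
        moreover have "T E (insert v R) \<le> (1 - \<rho>) * real n + \<delta> / 4 * real n"
        proof -
          have "\<delta> * real n < T E (insert v R)" using sum TR by simp
          from not_atypical[OF na'(3) this] show ?thesis by linarith
        qed
        \<comment> \<open>Disjoint typical clusters of \<open>R\<close> and \<open>v\<close> with a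
          typical union would give \<open>1 - \<rho> \<le> 3 / 4 * \<delta>\<close>, but
          \<open>\<delta> < 1 - \<rho>\<close>.\<close>
        ultimately have "(1 - \<rho>) * real n \<le> 3 * (\<delta> / 4 * real n)" using sum by linarith
        moreover have "\<delta> * real n \<le> (1 - \<rho>) * real n" using \<rho> by (intro mult_right_mono) auto
        moreover have "0 < \<delta> * real n" using \<delta> nn by simp
        ultimately show False by linarith
      qed
      thus "of_bool (v \<in> stray R E) \<le> (of_bool (E \<in> atypical R) + of_bool (E \<in> atypical {v}) +
          of_bool (E \<in> atypical (insert v R)) :: real)" by auto
    qed
    finally show "1 \<le> ?f E / (\<delta> * real n)" using big \<delta> nn by simp
  qed (use \<delta> nn in \<open>auto intro!: divide_nonneg_pos sum_nonneg\<close>)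
  also have "\<dots> = expect G ?f / (\<delta> * real n)" by simp
  also have "expect G ?f = (\<Sum>v\<in>{1..n}. measure_pmf.prob G (atypical R) +
      measure_pmf.prob G (atypical {v}) + measure_pmf.prob G (atypical (insert v R)))"
    by (simp add: expectation_sum_finite expectation_add_finite prob_eq_expectation)
  also have "\<dots> \<le> (\<Sum>v\<in>{1..n}. 3 * (atyp_const / real n))"
  proof (rule sum_mono)
    fix v assume v: "v \<in> {1..n}"
    have "real (card (insert v R)) \<le> real (card R) + 1" using card_insert_le_m1 finR by (simp add: card_insert_if)
    hence "(real (card (insert v R)))\<^sup>2 \<le> (real (card R) + 1)\<^sup>2" by (intro power_mono) auto
    hence "(real (card (insert v R)))\<^sup>2 \<le> real n" using R by linarith
    hence "measure_pmf.prob G (atypical (insert v R)) \<le> atyp_const / real n"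
      using v R by (intro prob_atypical) auto
    moreover have "measure_pmf.prob G (atypical {v}) \<le> atyp_const / real n"
      using v n1 by (intro prob_atypical) auto
    moreover have "measure_pmf.prob G (atypical R) \<le> atyp_const / real n"
      by (rule prob_atypical[OF R(1) R2])
    ultimately show "measure_pmf.prob G (atypical R) + measure_pmf.prob G (atypical {v}) +
      measure_pmf.prob G (atypical (insert v R)) \<le> 3 * (atyp_const / real n)" by linarith
  qed
  also have "\<dots> = 3 * atyp_const" using nn by simp
  finally show ?thesis using \<delta> nn by (simp add: divide_right_mono)
qed

end

subsection \<open>The largest component\<close>

context giant_regime
begin

definition order_const :: "real \<Rightarrow> real" where
  "order_const \<theta> = char_const (- \<theta>) + \<bar>\<theta>\<bar> / (zt * sqrt (exp (- (3 * K)) * \<delta>)) +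
     2 * (1 + atyp_const + 1 / (zt * \<delta>) + 3 * atyp_const / \<delta>)"

text \<open>Since \<open>slope \<le> 1\<close>, \<open>sd\<close> is at least
  \<open>slope * sd\<close>, the square root of \<open>var_lim * n\<close>.\<close>

lemma sd_ge: "sqrt (exp (- (3 * K)) * \<delta>) * sqrt (real n) \<le> sd"
proof -
  have "sqrt (exp (- (3 * K)) * \<delta>) * sqrt (real n) \<le> sqrt (var_lim * real n)"
    unfolding real_sqrt_mult[symmetric] using var_lim_ge
    by (intro real_sqrt_le_mono mult_right_mono) auto
  also have "\<dots> = slope * sd" by (rule slope_sd[symmetric])
  also have "\<dots> \<le> 1 * sd"
  proof (intro mult_right_mono)
    have "exp (- (c * \<rho> ^ k)) * (1 - c * real k * \<rho> ^ k) \<le> 1 * 1"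
      using c \<rho> \<gamma> by (intro mult_mono) auto
    thus "slope \<le> 1" by (simp add: slope_def)
  qed (use sd_pos in simp)
  finally show ?thesis by simp
qed

text \<open>Outside a bad event the largest component differs from the seeded cluster by at most
  \<open>Y E\<close>. The mean of \<open>Y E\<close> is of the order of the number of seeds, and it
  is divided by \<open>sd\<close>, which is at least of order \<open>sqrt n\<close>.\<close>

lemma char_max_component:
  assumes R: "R \<subseteq> {1..n}" "(real (card R) + 1)\<^sup>2 \<le> real n"
  defines "N \<equiv> \<lambda>E. real (Max ((\<lambda>v. card (cluster E {v})) ` {1..n}))"
  shows "cmod (expect G (\<lambda>E. iexp (\<theta> * ((N E - (1 - \<rho>) * real n) / sd))) - exp (- (\<theta>\<^sup>2) / 2))
    \<le> order_const \<theta> * ((1 + real (card R)) / sqrt (real n) + exp (- (lam * real (card R))))"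
proof -
  define \<kappa> where "\<kappa> = real (card R)"
  define q where "q = (1 + \<kappa>) / sqrt (real n)"
  define x where "x = exp (- (lam * \<kappa>))"
  have nn: "0 < real n" "1 \<le> real n" using n_pos by simp_all
  have sq: "sqrt (real n) \<le> real n" "0 < sqrt (real n)" using nn by (auto simp: real_le_lsqrt power2_eq_square)
  have finR: "finite R" using R finite_subset by blast
  have \<kappa>0: "0 \<le> \<kappa>" by (simp add: \<kappa>_def)
  have "(real (card R))\<^sup>2 \<le> (real (card R) + 1)\<^sup>2" by (intro power_mono) auto
  hence R2: "(real (card R))\<^sup>2 \<le> real n" using R by linarith
  have A0: "0 \<le> atyp_const" using mom_ge by (simp add: atyp_const_def dev_const_def)
  have q_ge: "y / real n \<le> q" if "y \<le> 1 + \<kappa>" "0 \<le> y" for y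
    unfolding q_def using that sq \<kappa>0 by (intro frac_le) auto
  have x0: "0 \<le> x" by (simp add: x_def)
  have q0: "0 \<le> q" using \<kappa>0 sq by (simp add: q_def)
  define Y where "Y E = (\<Sum>v\<in>R. if T E {v} \<le> \<delta> * real n then T E {v} else 0)" for E
  have Y0: "0 \<le> Y E" for E unfolding Y_def by (intro sum_nonneg) auto
  \<comment> \<open>If this sum is below one, no indicator is set and
    \<open>Y E \<le> \<delta> * n\<close>, so all hypotheses of the deterministic lemma hold. Being
    a sum, it has a mean that splits into the probabilities already estimated.\<close>
  define bad where "bad E = of_bool (E \<in> {E. T E R \<le> \<delta> * real n}) + of_bool (E \<in> atypical R) +
     (\<Sum>v\<in>R. of_bool (E \<in> atypical {v})) + Y E / (\<delta> * real n) +
     of_bool (E \<in> {E. \<delta> * real n < T E R \<and> stray R E \<noteq> {}})" for E :: "nat set set"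
  have bad0: "0 \<le> bad E" for E
    unfolding bad_def using Y0[of E] \<delta> nn by (intro add_nonneg_nonneg sum_nonneg) auto
  let ?iN = "\<lambda>E. iexp (\<theta> * ((N E - (1 - \<rho>) * real n) / sd))"
  let ?iT = "\<lambda>E. iexp (\<theta> * ((T E R - (1 - \<rho>) * real n) / sd))"
  have pointwise: "cmod (?iN E - ?iT E) \<le> \<bar>\<theta>\<bar> / sd * Y E + 2 * bad E" if E: "E \<in> set_pmf G" for E
  proof (cases "1 \<le> bad E")
    case True
    have "cmod (?iN E - ?iT E) \<le> cmod (?iN E) + cmod (?iT E)" by (rule norm_triangle_ineq4)
    also have "\<dots> \<le> 2 * bad E" using True by simp
    also have "\<dots> \<le> \<bar>\<theta>\<bar> / sd * Y E + 2 * bad E" using Y0[of E] sd_pos by simp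
    finally show ?thesis .
  next
    case False
    have s0: "0 \<le> (\<Sum>v\<in>R. of_bool (E \<in> atypical {v}) :: real)" by (intro sum_nonneg) auto
    have Yd: "0 \<le> Y E / (\<delta> * real n)" using Y0[of E] \<delta> nn by simp
    have ob: "0 \<le> (of_bool Q :: real)" for Q by simp
    note obs = ob[of "E \<in> {E. T E R \<le> \<delta> * real n}"] ob[of "E \<in> atypical R"]
      ob[of "E \<in> {E. \<delta> * real n < T E R \<and> stray R E \<noteq> {}}"]
    have TR: "\<delta> * real n < T E R"
    proof (rule ccontr)
      assume "\<not> ?thesis"
      hence "of_bool (E \<in> {E. T E R \<le> \<delta> * real n}) = (1::real)" by simp
      thus False using False s0 Yd obs unfolding bad_def by linarith
    qed
    have natR: "E \<notin> atypical R"
    proof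
      assume "E \<in> atypical R"
      hence "of_bool (E \<in> atypical R) = (1::real)" by simp
      thus False using False s0 Yd obs unfolding bad_def by linarith
    qed
    have nat: "E \<notin> atypical {v}" if "v \<in> R" for v
    proof
      assume *: "E \<in> atypical {v}"
      have "of_bool (E \<in> atypical {v}) \<le> (\<Sum>v\<in>R. of_bool (E \<in> atypical {v}) :: real)"
        by (rule member_le_sum) (use that finR in auto)
      moreover have "of_bool (E \<in> atypical {v}) = (1::real)" using * by simp
      ultimately show False using False Yd obs unfolding bad_def by linarith
    qed
    have Ys: "Y E \<le> \<delta> * real n"
    proof (rule ccontr)
      assume "\<not> ?thesis"
      hence "1 \<le> Y E / (\<delta> * real n)" using \<delta> nn by simp
      thus False using False s0 obs unfolding bad_def by linarith
    qed
    have str: "stray R E = {}"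
    proof (rule ccontr)
      assume "stray R E \<noteq> {}"
      hence "of_bool (E \<in> {E. \<delta> * real n < T E R \<and> stray R E \<noteq> {}}) = (1::real)" using TR by simp
      thus False using False s0 Yd obs unfolding bad_def by linarith
    qed
    have "\<bar>real (Max ((\<lambda>v. card (cluster E {v})) ` {1..n})) - T E R\<bar> \<le> Y E"
      unfolding Y_def
    proof (rule largest_cluster_near_seeded_cluster[where \<epsilon> = "\<delta> / 4" and \<alpha> = "1 - \<rho>"])
      show "\<bar>T E R - (1 - \<rho>) * real n\<bar> \<le> \<delta> / 4 * real n" by (rule not_atypical[OF natR TR])
      show "T E {v} \<le> \<delta> * real n \<or> \<bar>T E {v} - (1 - \<rho>) * real n\<bar> \<le> \<delta> / 4 * real n" if "v \<in> R" for v
        using not_atypical[OF nat[OF that]] by (cases "T E {v} \<le> \<delta> * real n") (auto simp: not_le)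
      show "T E {v} \<le> \<delta> * real n" if "v \<in> {1..n}" "v \<notin> cluster E R" for v
        using str that by (auto simp: stray_def not_less)
      show "(\<Sum>v\<in>R. if T E {v} \<le> \<delta> * real n then T E {v} else 0) \<le> \<delta> * real n"
        using Ys by (simp add: Y_def)
    qed (use R E G_subset(1) \<delta> \<rho> nn TR in auto)
    hence NT: "\<bar>N E - T E R\<bar> \<le> Y E" by (simp only: N_def)
    have "\<bar>\<theta> * ((N E - (1 - \<rho>) * real n) / sd) - \<theta> * ((T E R - (1 - \<rho>) * real n) / sd)\<bar> = \<bar>\<theta>\<bar> / sd * \<bar>N E - T E R\<bar>"
    proof -
      have "\<theta> * ((N E - (1 - \<rho>) * real n) / sd) - \<theta> * ((T E R - (1 - \<rho>) * real n) / sd) = \<theta> / sd * (N E - T E R)"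
        using sd_pos by (simp add: field_simps)
      thus ?thesis using sd_pos by (simp only: abs_mult abs_divide abs_of_pos)
    qed
    also have "\<dots> \<le> \<bar>\<theta>\<bar> / sd * Y E" using NT sd_pos by (intro mult_left_mono) auto
    finally have "cmod (?iN E - ?iT E) \<le> \<bar>\<theta>\<bar> / sd * Y E" by (rule order.trans[OF cmod_iexp_diff])
    thus ?thesis using bad0[of E] by linarith
  qed
  have EY: "expect G Y \<le> \<kappa> / zt"
  proof -
    have "expect G Y =
      (\<Sum>v\<in>R. expect G (\<lambda>E. if T E {v} \<le> \<delta> * real n then T E {v} else 0))"
      unfolding Y_def[abs_def] by (rule expectation_sum_finite[OF finite_G])
    also have "\<dots> \<le> (\<Sum>v\<in>R. 1 / zt)" using R by (intro sum_mono expectation_small) auto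
    finally show ?thesis by (simp add: \<kappa>_def)
  qed
  have Ebad: "expect G bad \<le> x + atyp_const / real n + \<kappa> * (atyp_const / real n) +
      \<kappa> / zt / (\<delta> * real n) + 3 * atyp_const / (\<delta> * real n)"
  proof -
    have "expect G bad = measure_pmf.prob G {E. T E R \<le> \<delta> * real n} +
      measure_pmf.prob G (atypical R) + (\<Sum>v\<in>R. measure_pmf.prob G (atypical {v})) +
      expect G Y / (\<delta> * real n) +
      measure_pmf.prob G {E. \<delta> * real n < T E R \<and> stray R E \<noteq> {}}"
      unfolding bad_def[abs_def] prob_eq_expectation
      by (simp only: expectation_add_finite[OF finite_G] expectation_sum_finite[OF finite_G] integral_divide_zero)
    also have "\<dots> \<le> x + atyp_const / real n + (\<Sum>v\<in>R. atyp_const / real n) +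
      \<kappa> / zt / (\<delta> * real n) + 3 * atyp_const / (\<delta> * real n)"
    proof (intro add_mono sum_mono)
      show "measure_pmf.prob G {E. T E R \<le> \<delta> * real n} \<le> x"
        unfolding x_def \<kappa>_def by (rule prob_small[OF R(1)])
      show "measure_pmf.prob G (atypical {v}) \<le> atyp_const / real n" if "v \<in> R" for v
        using that R nn by (intro prob_atypical) auto
      show "expect G Y / (\<delta> * real n) \<le> \<kappa> / zt / (\<delta> * real n)"
        using EY \<delta> by (intro divide_right_mono) auto
    qed (rule prob_atypical[OF R(1) R2] prob_stray[OF R])+
    finally show ?thesis by (simp add: \<kappa>_def)
  qed
  have "cmod (expect G ?iN - expect G ?iT) \<le>
      expect G (\<lambda>E. cmod (?iN E - ?iT E))"
    unfolding expectation_diff_finite[OF finite_G, symmetric] by (rule norm_expectation_le)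
  also have "\<dots> \<le> expect G (\<lambda>E. \<bar>\<theta>\<bar> / sd * Y E + 2 * bad E)"
    by (intro expectation_mono_finite finite_G pointwise)
  also have "\<dots> = \<bar>\<theta>\<bar> / sd * expect G Y + 2 * expect G bad"
    by (simp only: expectation_add_finite[OF finite_G] integral_mult_right_zero)
  also have "\<dots> \<le> \<bar>\<theta>\<bar> / sd * (\<kappa> / zt) + 2 * (x + atyp_const / real n + \<kappa> * (atyp_const / real n) +
      \<kappa> / zt / (\<delta> * real n) + 3 * atyp_const / (\<delta> * real n))"
    using EY Ebad sd_pos by (intro add_mono mult_left_mono) auto
  also have "\<bar>\<theta>\<bar> / sd * (\<kappa> / zt) \<le> \<bar>\<theta>\<bar> / (zt * sqrt (exp (- (3 * K)) * \<delta>)) * q"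
  proof -
    have e: "0 < sqrt (exp (- (3 * K)) * \<delta>)" using \<delta> by simp
    have "\<bar>\<theta>\<bar> / sd * (\<kappa> / zt) \<le>
      \<bar>\<theta>\<bar> / (sqrt (exp (- (3 * K)) * \<delta>) * sqrt (real n)) * ((1 + \<kappa>) / zt)"
      using sd_ge sd_pos e sq zt_pos \<kappa>0
      by (intro mult_mono divide_left_mono divide_right_mono) auto
    also have "\<dots> = \<bar>\<theta>\<bar> / (zt * sqrt (exp (- (3 * K)) * \<delta>)) * q"
      by (simp add: q_def)
    finally show ?thesis .
  qed
  also have "x + atyp_const / real n + \<kappa> * (atyp_const / real n) +
      \<kappa> / zt / (\<delta> * real n) + 3 * atyp_const / (\<delta> * real n) \<le>
      x + (atyp_const + 1 / (zt * \<delta>) + 3 * atyp_const / \<delta>) * q"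
  proof -
    have "atyp_const / real n + \<kappa> * (atyp_const / real n) = atyp_const * ((1 + \<kappa>) / real n)"
      by (simp add: distrib_left add_divide_distrib mult.commute)
    also have "\<dots> \<le> atyp_const * q" using \<kappa>0 A0 by (intro mult_left_mono q_ge) auto
    finally have 1: "atyp_const / real n + \<kappa> * (atyp_const / real n) \<le> atyp_const * q" .
    have "\<kappa> / zt / (\<delta> * real n) = 1 / (zt * \<delta>) * (\<kappa> / real n)" by simp
    also have "\<dots> \<le> 1 / (zt * \<delta>) * q" using zt_pos \<delta> \<kappa>0 by (intro mult_left_mono q_ge) auto
    finally have 2: "\<kappa> / zt / (\<delta> * real n) \<le> 1 / (zt * \<delta>) * q" .
    have "3 * atyp_const / (\<delta> * real n) = 3 * atyp_const / \<delta> * (1 / real n)" by simp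
    also have "\<dots> \<le> 3 * atyp_const / \<delta> * q" using A0 \<delta> \<kappa>0 by (intro mult_left_mono q_ge) auto
    finally have 3: "3 * atyp_const / (\<delta> * real n) \<le> 3 * atyp_const / \<delta> * q" .
    show ?thesis unfolding distrib_right using 1 2 3 by linarith
  qed
  finally have NT: "cmod (expect G ?iN - expect G ?iT) \<le>
      \<bar>\<theta>\<bar> / (zt * sqrt (exp (- (3 * K)) * \<delta>)) * q +
      2 * (x + (atyp_const + 1 / (zt * \<delta>) + 3 * atyp_const / \<delta>) * q)"
    by simp
  \<comment> \<open>The sign of \<open>\<theta>\<close> flips because \<open>S = n - T E R\<close>,
    so that \<open>S - \<rho> * n\<close> is the negative of
    \<open>T E R - (1 - \<rho>) * n\<close>.\<close>
  have "cmod (expect (leftover (Suc k) p {1..n} ({1..n} - R))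
      (\<lambda>S. iexp (- \<theta> * ((real S - \<rho> * real n) / sd))) - exp (- ((- \<theta>)\<^sup>2) / 2))
    \<le> char_const (- \<theta>) * ((1 + \<kappa>) / sqrt (real n) +
      expect (leftover (Suc k) p {1..n} ({1..n} - R))
        (\<lambda>S. if (1 - \<delta>) * real n \<le> real S then 1 else 0))"
    using char_undiscovered[of "{1..n}" "{1..n} - R" "- \<theta>"] card_co[OF R(1)] R2 unfolding \<kappa>_def by simp
  also have "expect (leftover (Suc k) p {1..n} ({1..n} - R))
      (\<lambda>S. iexp (- \<theta> * ((real S - \<rho> * real n) / sd))) = expect G ?iT"
  proof (subst expectation_size_eq_leftover)
    show "expect G (\<lambda>E. iexp (- \<theta> * ((real (card {1..n} - card (cluster E R)) - \<rho> * real n) / sd))) =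
        expect G ?iT"
    proof (rule expectation_cong_pmf)
      fix E assume "E \<in> set_pmf G"
      hence "real (card {1..n} - card (cluster E R)) = real n - T E R" using n_minus[OF _ R(1)] by simp
      hence "- \<theta> * ((real (card {1..n} - card (cluster E R)) - \<rho> * real n) / sd) =
          \<theta> * ((T E R - (1 - \<rho>) * real n) / sd)"
        using sd_pos by (simp add: field_simps)
      thus "iexp (- \<theta> * ((real (card {1..n} - card (cluster E R)) - \<rho> * real n) / sd)) = ?iT E"
        by (simp only:)
    qed
  qed (use R in auto)
  also have "expect (leftover (Suc k) p {1..n} ({1..n} - R))
        (\<lambda>S. if (1 - \<delta>) * real n \<le> real S then 1 else 0) = measure_pmf.prob G {E. T E R \<le> \<delta> * real n}"
    unfolding prob_eq_expectation using R
    by (subst expectation_size_eq_leftover) (auto intro!: expectation_cong_pmf simp: n_minus early_cond)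
  finally have iT: "cmod (expect G ?iT - exp (- (\<theta>\<^sup>2) / 2)) \<le>
      char_const (- \<theta>) * (q + measure_pmf.prob G {E. T E R \<le> \<delta> * real n})"
    by (simp add: q_def)
  have C0: "0 \<le> char_const (- \<theta>)"
    using mom_ge K1 \<delta> by (simp add: char_const_def clt_const_def theta_const_def lin_const_def dev_const_def)
  have "char_const (- \<theta>) * (q + measure_pmf.prob G {E. T E R \<le> \<delta> * real n}) \<le> char_const (- \<theta>) * (q + x)"
    unfolding x_def \<kappa>_def by (intro mult_left_mono add_left_mono prob_small R C0)
  hence iT': "cmod (expect G ?iT - exp (- (\<theta>\<^sup>2) / 2)) \<le> char_const (- \<theta>) * (q + x)"
    using iT by linarith
  define c1 where "c1 = \<bar>\<theta>\<bar> / (zt * sqrt (exp (- (3 * K)) * \<delta>))"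
  define c2 where "c2 = atyp_const + 1 / (zt * \<delta>) + 3 * atyp_const / \<delta>"
  have c12: "0 \<le> c1" "0 \<le> c2" using zt_pos \<delta> A0 by (auto simp: c1_def c2_def)
  have "order_const \<theta> = char_const (- \<theta>) + c1 + 2 * (1 + c2)"
    by (simp add: order_const_def c1_def c2_def)
  hence "order_const \<theta> * (q + x) = char_const (- \<theta>) * (q + x) + (c1 * q + 2 * (x + c2 * q)) + (c1 * x + 2 * q + 2 * (c2 * x))"
    by (simp add: algebra_simps)
  moreover have "0 \<le> c1 * x" "0 \<le> 2 * q" "0 \<le> c2 * x" using c12 q0 x0 by auto
  moreover have "cmod (expect G ?iN - exp (- (\<theta>\<^sup>2) / 2)) \<le>
      cmod (expect G ?iN - expect G ?iT) +
      cmod (expect G ?iT - exp (- (\<theta>\<^sup>2) / 2))"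
    using norm_triangle_ineq[of "expect G ?iN - expect G ?iT"
        "expect G ?iT - exp (- (\<theta>\<^sup>2) / 2)"] by simp
  ultimately have "cmod (expect G ?iN - exp (- (\<theta>\<^sup>2) / 2)) \<le> order_const \<theta> * (q + x)"
    using NT iT' unfolding c1_def[symmetric] c2_def[symmetric] by linarith
  thus ?thesis by (simp only: q_def x_def \<kappa>_def)
qed

end

lemma random_hypergraph_eq:
  "random_hypergraph d n p = map_pmf (\<lambda>E. ({1..n}, E)) (random_subset p (nsets {1..n} d))"
  by (simp add: random_hypergraph_def random_subset_def map_pmf_comp)

theorem theorem1:
  fixes d :: nat and J :: "real set" and p c :: "nat \<Rightarrow> real"
  assumes "2 \<le> d"
    and "compact J" and "is_interval J" and "J \<subseteq> {1 / (real d - 1)<..}"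
    and "\<And>n. 0 \<le> p n \<and> p n \<le> 1"
    and "\<And>n. c n = real ((n - 1) choose (d - 1)) * p n"
    and "\<forall>\<^sub>F n in sequentially. c n \<in> J"
  shows "weak_conv_m
           (\<lambda>n. distr (measure_pmf (random_hypergraph d n (p n))) borel
                  (\<lambda>H. (real (max_component_order H) - (1 - rho d (c n)) * real n) /
                        sqrt (giant_variance d (c n) n)))
           std_normal_distribution"
proof (rule levy_continuity)
  show "real_distribution (distr (measure_pmf (random_hypergraph d n (p n))) borel
      (\<lambda>H. (real (max_component_order H) - (1 - rho d (c n)) * real n) /
            sqrt (giant_variance d (c n) n)))" for n
    by (intro prob_space.real_distribution_distr measure_pmf.prob_space_axioms) simp
  show "real_distribution std_normal_distribution"
    using real_dist_normal_dist .
  fix \<theta> :: real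
  obtain k where dk: "d = Suc k" "1 \<le> k" using assms(1) by (cases d) auto
  have J0: "J \<noteq> {}" using assms(7) by (auto simp: eventually_sequentially)
  obtain c\<^sub>1 where c1: "c\<^sub>1 \<in> J" "\<And>y. y \<in> J \<Longrightarrow> c\<^sub>1 \<le> y"
    using compact_attains_inf[OF assms(2) J0] by blast
  obtain c\<^sub>2 where c2: "c\<^sub>2 \<in> J" "\<And>y. y \<in> J \<Longrightarrow> y \<le> c\<^sub>2"
    using compact_attains_sup[OF assms(2) J0] by blast
  have "1 / real k < c\<^sub>1" using c1(1) assms(4) dk by auto
  hence c1k: "1 < c\<^sub>1 * real k" using dk by (simp add: field_simps)
  have pos: "0 < y" if "y \<in> J" for y
  proof -
    have "0 < 1 / real k" using dk by simp
    moreover have "1 / real k < y" using that assms(4) dk by auto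
    ultimately show ?thesis by linarith
  qed
  obtain \<delta> \<gamma> where \<delta>: "0 < \<delta>" "\<delta> < 1" "0 < \<gamma>"
    and gap: "\<And>c. c\<^sub>1 \<le> c \<Longrightarrow> c \<le> c\<^sub>2 \<Longrightarrow> rho (Suc k) c < 1 - \<delta> \<and>
      \<gamma> \<le> 1 - c * real k * rho (Suc k) c ^ k \<and> 1 + 2 * \<gamma> \<le> c * real k * (1 - \<delta>) ^ k \<and>
      (\<forall>x. 0 \<le> x \<longrightarrow> x \<le> 1 - \<delta> \<longrightarrow>
        \<gamma> * \<bar>x - rho (Suc k) c\<bar> \<le> \<bar>x * exp (- (c * x ^ k)) - exp (- c)\<bar>)"
    using supercritical_gap[OF dk(2) c1k, of c\<^sub>2] by blast
  define K where "K = 1 + c\<^sub>2 + c\<^sub>2\<^sup>2 + 4 * c\<^sub>2 * real (k + 1) ^ 3"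
  have c20: "0 < c\<^sub>2" using pos c2 by blast
  \<comment> \<open>The fourth root grows to infinity, so \<open>exp (- (L * \<kappa> n))\<close>
    vanishes, and slowly enough for \<open>\<kappa> n / sqrt n\<close> to vanish and for the squared
    bound on the seeds to hold eventually.\<close>
  define \<kappa> where "\<kappa> n = nat \<lfloor>sqrt (sqrt (real n))\<rfloor>" for n
  \<comment> \<open>Outside the locale the constants show their arguments: neither
    \<open>c n\<close> nor \<open>\<rho>\<close> nor \<open>n\<close> is among them, so
    \<open>L\<close> and \<open>C\<close> are genuine constants.\<close>
  define L where "L = giant_regime.lam k K \<gamma>"
  define C where "C = giant_regime.order_const k K \<delta> \<gamma> \<theta>"
  let ?M = "\<lambda>n. distr (measure_pmf (random_hypergraph d n (p n))) borel
      (\<lambda>H. (real (max_component_order H) - (1 - rho d (c n)) * real n) / sqrt (giant_variance d (c n) n))"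
  have ev1: "\<forall>\<^sub>F n in sequentially. max K (real k + 3) \<le> real n \<and> K + K\<^sup>2 \<le> \<gamma> * real n"
    using \<delta>(3) by (intro eventually_conj) real_asymp+
  have ev2: "\<forall>\<^sub>F n in sequentially. (sqrt (sqrt (real n)) + 1)\<^sup>2 \<le> real n" by real_asymp
  \<comment> \<open>Positivity of \<open>L\<close> is part of the claim because it is derived inside
    the locale, which can be interpreted only once \<open>n\<close> is large.\<close>
  have main: "\<forall>\<^sub>F n in sequentially. 0 < L \<and> cmod (char (?M n) \<theta> - exp (- (\<theta>\<^sup>2) / 2)) \<le>
      C * ((1 + real (\<kappa> n)) / sqrt (real n) + exp (- (L * real (\<kappa> n))))"
    using ev1 ev2 assms(7)
  proof eventually_elim
    case (elim n)
    have cJ: "c\<^sub>1 \<le> c n" "c n \<le> c\<^sub>2" using elim c1 c2 by auto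
    have pn: "0 \<le> p n" "p n \<le> 1" using assms(5) by auto
    have cn: "c n = real ((n - 1) choose k) * p n" using assms(6) dk by simp
    have Kn: "K \<le> real n" "k + 3 \<le> n" using elim by auto
    note asym = sparse_regime_asymptotics[OF dk(2) less_imp_le[OF c20], folded K_def, OF Kn pn cn cJ(2)]
    have ck: "1 < c n * real k"
      using c1k mult_right_mono[OF cJ(1), of "real k"] by linarith
    note rf = rho_facts[OF dk(2) ck]
    note g = gap[OF cJ]
    have "0 \<le> c\<^sub>2\<^sup>2 + 4 * c\<^sub>2 * real (k + 1) ^ 3" using c20 by simp
    hence c2K: "c\<^sub>2 \<le> K" unfolding K_def by linarith
    interpret sparse_regime k n "p n" K by (rule asym(1))
    interpret giant_regime k n "p n" K "c n" "rho (Suc k) (c n)" \<delta> \<gamma>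
      using asym(2,3) rf g \<delta> elim c2K cJ pos[of "c n"]
      by unfold_locales auto
    define R where "R = {1..\<kappa> n}"
    have \<kappa>n: "real (\<kappa> n) \<le> sqrt (sqrt (real n))" by (simp add: \<kappa>_def)
    have sqn: "(real (\<kappa> n) + 1)\<^sup>2 \<le> real n"
    proof -
      have "(real (\<kappa> n) + 1)\<^sup>2 \<le> (sqrt (sqrt (real n)) + 1)\<^sup>2" using \<kappa>n by (intro power_mono) auto
      thus ?thesis using elim by linarith
    qed
    have "real (\<kappa> n) \<le> (real (\<kappa> n) + 1)\<^sup>2" by (simp add: power2_eq_square algebra_simps)
    hence "\<kappa> n \<le> n" using sqn by linarith
    hence RV: "R \<subseteq> {1..n}" "card R = \<kappa> n" by (auto simp: R_def)
    have sd: "sqrt (giant_variance d (c n) n) = sd"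
      using dk(1) by (simp add: giant_variance_def sd_def)
    have "char (?M n) \<theta> = expect (random_hypergraph d n (p n))
        (\<lambda>H. iexp (\<theta> * ((real (max_component_order H) - (1 - rho d (c n)) * real n) / sd)))"
      unfolding char_def sd by (subst integral_distr) auto
    also have "\<dots> = expect G
        (\<lambda>E. iexp (\<theta> * ((real (max_component_order ({1..n}, E)) - (1 - rho d (c n)) * real n) / sd)))"
      unfolding random_hypergraph_eq integral_map_pmf dk(1) ..
    also have "\<dots> = expect G (\<lambda>E. iexp (\<theta> *
        ((real (Max ((\<lambda>v. card (cluster E {v})) ` {1..n})) - (1 - rho (Suc k) (c n)) * real n) / sd)))"
      unfolding dk(1) using G_subset(2) by (intro expectation_cong_pmf) (simp only: max_component_order_eq)
    finally have "cmod (char (?M n) \<theta> - exp (- (\<theta>\<^sup>2) / 2)) \<le>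
        order_const \<theta> * ((1 + real (card R)) / sqrt (real n) + exp (- (lam * real (card R))))"
      using char_max_component[OF RV(1), of \<theta>] sqn RV(2) by simp
    thus ?case using lam_pos unfolding RV(2) C_def L_def by simp
  qed
  have L0: "0 < L" using eventually_happens'[OF _ main] by auto
  have "(\<lambda>n. C * ((1 + real (\<kappa> n)) / sqrt (real n) + exp (- (L * real (\<kappa> n))))) \<longlonglongrightarrow> C * (0 + 0)"
  proof (intro tendsto_intros)
    show "(\<lambda>n. (1 + real (\<kappa> n)) / sqrt (real n)) \<longlonglongrightarrow> 0"
      unfolding \<kappa>_def by real_asymp
    show "(\<lambda>n. exp (- (L * real (\<kappa> n)))) \<longlonglongrightarrow> 0"
      unfolding \<kappa>_def using L0 by real_asymp
  qed
  hence lim: "(\<lambda>n. C * ((1 + real (\<kappa> n)) / sqrt (real n) + exp (- (L * real (\<kappa> n))))) \<longlonglongrightarrow> 0"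
    by simp
  have "(\<lambda>n. char (?M n) \<theta> - exp (- (\<theta>\<^sup>2) / 2)) \<longlonglongrightarrow> 0"
    by (rule Lim_null_comparison[OF eventually_mono[OF main conjunct2] lim])
  hence "(\<lambda>n. char (?M n) \<theta>) \<longlonglongrightarrow> exp (- (\<theta>\<^sup>2) / 2)"
    by (simp only: LIM_zero_iff)
  thus "(\<lambda>n. char (?M n) \<theta>) \<longlonglongrightarrow> char std_normal_distribution \<theta>"
    by (simp add: char_std_normal_distribution)
qed

end
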